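(* Assume Assumption (A), and that $f$ is affine, $f(q)=Aq+b$ with a constant symmetric $A\in\mathbb{R}^{d\times d}$ and $b\in\mathbb{R}^d$. Let $\mu$ be the unique invariant probability measure of the Langevin equation. Then for every $\psi\in C_b^6(\mathbb{R}^{2d},\mathbb{R})$ and every initial value $(p,q)$ there exist $h_0>0$ and $C>0$, independent of $h$ and $T$, such that for all $h\in(0,h_0]$ and $T=Nh$, $N\in\mathbb{N}$, $$\Big|\frac1N\sum_{n=1}^N\mathbf{E}\psi(P^h[n],Q^h[n])-\int_{\mathbb{R}^{2d}}\psi\,d\mu\Big|\le C\Big(h^2+\frac1T\Big).$$
   Context: Let $d\le m$, $F\in C^\infty(\mathbb{R}^d,\mathbb{R})$, $f=\nabla F$, $M\in\mathbb{R}^{d\times d}$ symmetric positive definite, $v>0$, $\sigma=(\sigma_1,\dots,\sigma_m)\in\mathbb{R}^{d\times m}$ with $\mathrm{rank}\,\sigma=d$, $W$ a standard $m$-dimensional Wiener process. Langevin equation: $dP=-f(Q)dt-vPdt-\sigma dW(t)$, $dQ=MPdt$, $P(0)=p$, $Q(0)=q$; under the stated assumptions it has a unique invariant probability measure $\mu$ on $\mathbb{R}^{2d}$. Assumption (A): $F\ge0$ and there exist $\alpha>0$, $\beta\in(0,1)$ with $\frac12q^\top f(q)\ge\beta F(q)+v^2\frac{\beta(2-\beta)}{8(1-\beta)}\|q\|^2-\alpha$ for all $q$. Scheme with step $h>0$, $t_n=nh$, $\Delta_{n+1}W=W(t_{n+1})-W(t_n)$, $(P^h[0],Q^h[0])=(p,q)$: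 $$P^h[n+1]=e^{-vh}P^h[n]-\tfrac{h^2}{2}\nabla^2F(Q^h[n])MP^h[n+1]-h\big(1+\tfrac{vh}{2}\big)e^{-vh}f(Q^h[n])-\big(1+\tfrac{vh}{2}\big)e^{-vh}\sigma\Delta_{n+1}W,$$ $$Q^h[n+1]=Q^h[n]+h\big(1-\tfrac{vh}{2}\big)e^{vh}MP^h[n+1]+\tfrac{h^2}{2}Mf(Q^h[n])+\tfrac{h}{2}M\sigma\Delta_{n+1}W.$$ $C_b^6(\mathbb{R}^{2d},\mathbb{R})$: six times continuously differentiable functions bounded together with all partial derivatives up to order 6. *)

theory Defs
  imports "HOL-Analysis.Analysis" "HOL-Probability.Probability"
begin

fun Ck :: "nat \<Rightarrow> ('a::euclidean_space \<Rightarrow> real) \<Rightarrow> bool" where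
  "Ck 0 g = continuous_on UNIV g"
| "Ck (Suc k) g = (continuous_on UNIV g \<and> (\<forall>x. g differentiable (at x)) \<and>
      (\<forall>i\<in>Basis. Ck k (\<lambda>x. frechet_derivative g (at x) i)))"

definition smooth_fun :: "('a::euclidean_space \<Rightarrow> real) \<Rightarrow> bool" where
  "smooth_fun g \<longleftrightarrow> (\<forall>k. Ck k g)"

fun Cb :: "nat \<Rightarrow> ('a::euclidean_space \<Rightarrow> real) \<Rightarrow> bool" where
  "Cb 0 g = (continuous_on UNIV g \<and> bounded (range g))"
| "Cb (Suc k) g = (continuous_on UNIV g \<and> bounded (range g) \<and> (\<forall>x. g differentiable (at x)) \<and>
      (\<forall>i\<in>Basis. Cb k (\<lambda>x. frechet_derivative g (at x) i)))"

definition sym_posdef :: "real^'d^'d \<Rightarrow> bool" where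
  "sym_posdef M \<longleftrightarrow> transpose M = M \<and> (\<forall>x. x \<noteq> 0 \<longrightarrow> x \<bullet> (M *v x) > 0)"

definition std_wiener :: "'a measure \<Rightarrow> (real \<Rightarrow> 'a \<Rightarrow> real^'m) \<Rightarrow> bool" where
  "std_wiener \<Omega> W \<longleftrightarrow> prob_space \<Omega> \<and>
     (\<forall>t\<ge>0. W t \<in> borel_measurable \<Omega>) \<and>
     (AE \<omega> in \<Omega>. W 0 \<omega> = 0) \<and>
     (AE \<omega> in \<Omega>. continuous_on {0..} (\<lambda>t. W t \<omega>)) \<and>
     (\<forall>s t. 0 \<le> s \<and> s < t \<longrightarrow>
        distributed \<Omega> lborel (\<lambda>\<omega>. W t \<omega> - W s \<omega>)
          (\<lambda>x. ennreal (\<Prod>i\<in>UNIV. normal_density 0 (sqrt (t - s)) (x $ i)))) \<and>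
     (\<forall>(n::nat) (ts::nat \<Rightarrow> real). 0 \<le> ts 0 \<and> mono ts \<longrightarrow>
        prob_space.indep_vars \<Omega> (\<lambda>_. borel) (\<lambda>i \<omega>. W (ts (Suc i)) \<omega> - W (ts i) \<omega>) {..<n})"

text \<open>Solution of dP = -f(Q)dt - vP dt - \<sigma> dW, dQ = MP dt, (P(0),Q(0)) = (p,q), driven by W.
  Since the noise is additive, the equation is written in integral form pathwise.
  The process is X t \<omega> = (P(t,\<omega>), Q(t,\<omega>)).\<close>
definition langevin_solution ::
  "'a measure \<Rightarrow> (real \<Rightarrow> 'a \<Rightarrow> real^'m) \<Rightarrow> (real^'d \<Rightarrow> real^'d) \<Rightarrow> real^'d^'d \<Rightarrow> real \<Rightarrow>
   real^'m^'d \<Rightarrow> (real^'d) \<times> (real^'d) \<Rightarrow> (real \<Rightarrow> 'a \<Rightarrow> (real^'d) \<times> (real^'d)) \<Rightarrow> bool" where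
  "langevin_solution \<Omega> W f M v \<sigma> x0 X \<longleftrightarrow>
     (\<forall>t\<ge>0. X t \<in> borel_measurable \<Omega>) \<and>
     (AE \<omega> in \<Omega>. continuous_on {0..} (\<lambda>t. X t \<omega>) \<and>
        (\<forall>t\<ge>0.
          fst (X t \<omega>) = fst x0 - integral {0..t} (\<lambda>s. f (snd (X s \<omega>)) + v *\<^sub>R fst (X s \<omega>))
                           - \<sigma> *v (W t \<omega> - W 0 \<omega>) \<and>
          snd (X t \<omega>) = snd x0 + integral {0..t} (\<lambda>s. M *v fst (X s \<omega>))))"

definition langevin_invariant ::
  "'a measure \<Rightarrow> (real \<Rightarrow> 'a \<Rightarrow> real^'m) \<Rightarrow> (real^'d \<Rightarrow> real^'d) \<Rightarrow> real^'d^'d \<Rightarrow> real \<Rightarrow>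
   real^'m^'d \<Rightarrow> ((real^'d) \<times> (real^'d)) measure \<Rightarrow> bool" where
  "langevin_invariant \<Omega> W f M v \<sigma> \<mu> \<longleftrightarrow>
     prob_space \<mu> \<and> sets \<mu> = sets borel \<and>
     (\<forall>X. (\<forall>x. langevin_solution \<Omega> W f M v \<sigma> x (X x)) \<longrightarrow>
        (\<forall>t\<ge>0. \<forall>B\<in>sets borel.
           (\<integral>\<^sup>+ x. emeasure \<Omega> {\<omega> \<in> space \<Omega>. X x t \<omega> \<in> B} \<partial>\<mu>) = emeasure \<mu> B))"

definition assumption_A :: "(real^'d \<Rightarrow> real) \<Rightarrow> (real^'d \<Rightarrow> real^'d) \<Rightarrow> real \<Rightarrow> bool" where
  "assumption_A F f v \<longleftrightarrow> (\<forall>q. F q \<ge> 0) \<and>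
     (\<exists>\<alpha> \<beta>. \<alpha> > 0 \<and> 0 < \<beta> \<and> \<beta> < 1 \<and>
        (\<forall>q. (1/2) * (q \<bullet> f q) \<ge> \<beta> * F q + v^2 * (\<beta> * (2 - \<beta>) / (8 * (1 - \<beta>))) * (norm q)^2 - \<alpha>))"

text \<open>H is the Hessian of F (here passed as the Jacobian of f = grad F).
  Ph n, Qh n are P^h[n], Q^h[n]; the increments are W((n+1)h) - W(nh).\<close>
definition langevin_scheme ::
  "(real \<Rightarrow> 'a \<Rightarrow> real^'m) \<Rightarrow> (real^'d \<Rightarrow> real^'d) \<Rightarrow> (real^'d \<Rightarrow> real^'d^'d) \<Rightarrow> real^'d^'d \<Rightarrow>
   real \<Rightarrow> real^'m^'d \<Rightarrow> real \<Rightarrow> real^'d \<Rightarrow> real^'d \<Rightarrow>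
   (nat \<Rightarrow> 'a \<Rightarrow> real^'d) \<Rightarrow> (nat \<Rightarrow> 'a \<Rightarrow> real^'d) \<Rightarrow> bool" where
  "langevin_scheme W f H M v \<sigma> h p q Ph Qh \<longleftrightarrow>
     (\<forall>\<omega>. Ph 0 \<omega> = p \<and> Qh 0 \<omega> = q) \<and>
     (\<forall>n \<omega>. let dW = W (real (Suc n) * h) \<omega> - W (real n * h) \<omega> in
        Ph (Suc n) \<omega> = exp (- v * h) *\<^sub>R Ph n \<omega>
            - (h^2 / 2) *\<^sub>R (H (Qh n \<omega>) *v (M *v Ph (Suc n) \<omega>))
            - (h * (1 + v * h / 2) * exp (- v * h)) *\<^sub>R f (Qh n \<omega>)
            - ((1 + v * h / 2) * exp (- v * h)) *\<^sub>R (\<sigma> *v dW) \<and>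
        Qh (Suc n) \<omega> = Qh n \<omega> + (h * (1 - v * h / 2) * exp (v * h)) *\<^sub>R (M *v Ph (Suc n) \<omega>)
            + (h^2 / 2) *\<^sub>R (M *v f (Qh n \<omega>))
            + (h / 2) *\<^sub>R (M *v (\<sigma> *v dW)))"

end

theory Submission
  imports Defs "HOL-Real_Asymp.Real_Asymp"
begin

text \<open>After the shift \<open>(p, q) \<mapsto> (p, q - q\<^sub>s)\<close> with \<open>A q\<^sub>s = - b\<close>, both the equation and the scheme are
  linear with additive Gaussian noise, so that all laws are Gaussian. A replacement argument of
  Lindeberg type bounds the difference of the expectations of a smooth bounded function under two
  Gaussian laws by the differences of the means and of the covariances. Covariances are viewed as
  functionals on bilinear forms; the covariance of the chain \<open>x \<mapsto> R x + S \<Delta>W\<close> satisfies a linear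
  recursion, which contracts in a Lyapunov norm by a factor \<open>1 - c h\<close> per step. The solution \<open>C\<close> of the
  Lyapunov equation of the Langevin equation solves this recursion up to a defect of order \<open>h\<^sup>3\<close> for the
  scheme and \<open>\<tau>\<^sup>2\<close> for the Euler method with step \<open>\<tau>\<close>. Hence the law after \<open>n\<close> steps of the scheme is
  within \<open>h\<^sup>2 + (1 - c h)^n\<close> of the stationary one, and the same bound for the Euler method, in the
  limit \<open>\<tau> \<rightarrow> 0\<close>, identifies the stationary law with the invariant measure. Averaging over \<open>n\<close> gives the
  claim.\<close>

section \<open>Gaussian averaging operators\<close>

text \<open>The equation is degenerate: noise and friction act on the momentum only, so neither
  smoothing nor decay can be read off coordinatewise. Linearity removes the first difficulty,
  because a Gaussian law is determined by mean and covariance and a second-order Taylor formula for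
  the test function suffices to compare two of them. The second is met by a quadratic Lyapunov form
  with a cross term. Covariances are kept as functionals on bilinear forms because their recursion
  then acts by substitution, \<open>\<beta>\<close> becoming
  \<open>\<lambda>x y. \<beta> (R x) (R y)\<close>, and contracts whenever \<open>R\<close> does.
  The order two has a precise source: the step of the scheme agrees with 1 + h B + (h^2/2) B^2 up to
  h^3 and its noise map with 1 + (h/2) B applied to the exact one up to h^2, so that the covariance
  injected per step is correct up to h^3; accumulation over about 1/h effective steps leaves h^2. No
  moments of the invariant measure are assumed, so it is tested against bounded integrands only,
  through truncation and dominated convergence as time tends to infinity.\<close>

definition BC :: "('e::euclidean_space \<Rightarrow> real) \<Rightarrow> bool" where
  "BC \<phi> \<longleftrightarrow> continuous_on UNIV \<phi> \<and> bounded (range \<phi>)"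

definition gauss :: "real measure" where
  "gauss = density lborel (\<lambda>x. ennreal (std_normal_density x))"

lemma prob_space_gauss: "prob_space gauss"
  unfolding gauss_def by (rule prob_space_normal_density) simp

interpretation gauss: prob_space gauss by (rule prob_space_gauss)

lemma sets_gauss [measurable_cong, simp]: "sets gauss = sets borel"
  by (simp add: gauss_def)

lemma space_gauss [simp]: "space gauss = UNIV"
  by (simp add: gauss_def)

lemma prob_gauss_UNIV [simp]: "measure gauss UNIV = 1"
  using gauss.prob_space by simp

lemma integral_gauss: "f \<in> borel_measurable borel \<Longrightarrow>
    (\<integral>z. f z \<partial>gauss) = (\<integral>z. std_normal_density z * f z \<partial>lborel)" for f :: "real \<Rightarrow> real"
  unfolding gauss_def by (subst integral_density) auto

lemma integrable_gauss: "f \<in> borel_measurable borel \<Longrightarrow>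
    integrable gauss f \<longleftrightarrow> integrable lborel (\<lambda>z. std_normal_density z * f z)" for f :: "real \<Rightarrow> real"
  unfolding gauss_def by (subst integrable_density) auto

lemma gauss_moments:
  "integrable gauss (\<lambda>z. z)" "(\<integral>z. z \<partial>gauss) = 0"
  "integrable gauss (\<lambda>z. z\<^sup>2)" "(\<integral>z. z\<^sup>2 \<partial>gauss) = 1"
  "integrable gauss (\<lambda>z. \<bar>z\<bar>)" "integrable gauss (\<lambda>z. \<bar>z\<bar>^3)"
  using integrable_std_normal_moment[of 1] integral_std_normal_moment_odd[of 0]
    integrable_std_normal_moment[of 2] integral_std_normal_moment_even[of 1]
    integrable_std_normal_moment_abs[of 1] integrable_std_normal_moment_abs[of 3]
  by (simp_all add: integrable_gauss integral_gauss)

text \<open>The heat operator along the direction \<open>a\<close> with unit variance. Composing it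
  over a list realises the centred Gaussian law with covariance equal to the sum of the rank-one
  matrices a a^T, so singular covariances are included and no matrix square root has to be
  formed.\<close>

definition gop :: "'e::euclidean_space \<Rightarrow> ('e \<Rightarrow> real) \<Rightarrow> 'e \<Rightarrow> real" where
  "gop a \<phi> x = (\<integral>z. \<phi> (x + z *\<^sub>R a) \<partial>gauss)"

definition gops :: "'e::euclidean_space list \<Rightarrow> ('e \<Rightarrow> real) \<Rightarrow> 'e \<Rightarrow> real" where
  "gops as = foldr gop as"

lemma gops_simps [simp]:
  "gops [] \<phi> = \<phi>" "gops (a # as) \<phi> = gop a (gops as \<phi>)" "gops (as @ bs) \<phi> = gops as (gops bs \<phi>)"
  by (simp_all add: gops_def)

lemma BC_measurable [measurable_dest]: "BC \<phi> \<Longrightarrow> \<phi> \<in> borel_measurable borel"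
  unfolding BC_def by (auto intro: borel_measurable_continuous_onI)

lemma BC_bound: "BC \<phi> \<Longrightarrow> \<exists>B\<ge>0. \<forall>x. \<bar>\<phi> x\<bar> \<le> B"
proof -
  assume "BC \<phi>"
  then obtain B where B: "\<forall>y\<in>range \<phi>. norm y \<le> B" unfolding BC_def bounded_iff by blast
  hence "\<forall>x. \<bar>\<phi> x\<bar> \<le> B" by auto
  moreover from this have "B \<ge> 0" by (meson abs_ge_zero order_trans)
  ultimately show ?thesis by blast
qed

lemma BC_I: "continuous_on UNIV \<phi> \<Longrightarrow> (\<And>x. \<bar>\<phi> x\<bar> \<le> B) \<Longrightarrow> BC \<phi>"
  unfolding BC_def by (auto simp: bounded_iff)

lemma BC_isCont: "BC \<phi> \<Longrightarrow> isCont \<phi> x"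
  by (simp add: BC_def continuous_on_eq_continuous_at)

lemma (in prob_space) integrable_BC:
  assumes "BC \<phi>" "X \<in> borel_measurable M"
  shows "integrable M (\<lambda>x. \<phi> (X x))"
proof -
  obtain B where "\<forall>x. \<bar>\<phi> x\<bar> \<le> B" using BC_bound assms by blast
  thus ?thesis using assms
    by (intro integrable_const_bound[of _ B]) (auto dest: BC_measurable)
qed

lemma (in prob_space) abs_integral_le_const:
  assumes "\<And>x. x \<in> space M \<Longrightarrow> \<bar>f x\<bar> \<le> B" "f \<in> borel_measurable M"
  shows "\<bar>\<integral>x. f x \<partial>M\<bar> \<le> (B::real)"
proof -
  have "integrable M f" using assms by (intro integrable_const_bound[of _ B]) auto
  hence "\<bar>\<integral>x. f x \<partial>M\<bar> \<le> (\<integral>x. \<bar>f x\<bar> \<partial>M)" by (intro integral_abs_bound)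
  also have "\<dots> \<le> (\<integral>x. B \<partial>M)" using assms \<open>integrable M f\<close> by (intro integral_mono) auto
  also have "\<dots> = B" by (simp add: prob_space)
  finally show ?thesis .
qed

lemma gop_abs_le:
  assumes "BC \<phi>" "\<And>x. \<bar>\<phi> x\<bar> \<le> B"
  shows "\<bar>gop a \<phi> x\<bar> \<le> B"
  unfolding gop_def using assms by (intro gauss.abs_integral_le_const) (auto dest: BC_measurable)

lemma integrable_gop [simp]: "BC \<phi> \<Longrightarrow> integrable gauss (\<lambda>z. \<phi> (x + z *\<^sub>R a))"
  by (rule gauss.integrable_BC) auto

lemma BC_gop [simp]:
  assumes "BC \<phi>" shows "BC (gop a \<phi>)"
proof -
  obtain B where B: "\<forall>x. \<bar>\<phi> x\<bar> \<le> B" using BC_bound assms by blast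
  have "isCont (gop a \<phi>) x" for x
    unfolding continuous_at_sequentially comp_def gop_def
  proof (intro allI impI)
    fix X :: "nat \<Rightarrow> 'a" assume X: "X \<longlonglongrightarrow> x"
    have "(\<lambda>n. \<phi> (X n + z *\<^sub>R a)) \<longlonglongrightarrow> \<phi> (x + z *\<^sub>R a)" for z
      by (rule isCont_tendsto_compose[OF BC_isCont[OF assms]]) (intro tendsto_intros X)
    thus "(\<lambda>n. \<integral>z. \<phi> (X n + z *\<^sub>R a) \<partial>gauss) \<longlonglongrightarrow> (\<integral>z. \<phi> (x + z *\<^sub>R a) \<partial>gauss)"
      using assms B
      by (intro integral_dominated_convergence[where w="\<lambda>_. B"]) (auto dest: BC_measurable)
  qed
  thus ?thesis using gop_abs_le[OF assms] B
    by (intro BC_I[of _ B]) (auto simp: continuous_on_eq_continuous_at)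
qed

lemma BC_gops [simp]: "BC \<phi> \<Longrightarrow> BC (gops as \<phi>)"
  by (induction as) auto

lemma BC_add [intro]: "BC \<phi> \<Longrightarrow> BC \<eta> \<Longrightarrow> BC (\<lambda>x. \<phi> x + \<eta> x)"
proof -
  assume a: "BC \<phi>" "BC \<eta>"
  obtain B C where "\<forall>x. \<bar>\<phi> x\<bar> \<le> B" "\<forall>x. \<bar>\<eta> x\<bar> \<le> C" using BC_bound a by metis
  thus ?thesis using a unfolding BC_def
    by (auto intro!: continuous_intros BC_I[unfolded BC_def, THEN conjunct2, of _ "B + C"]
        order.trans[OF abs_triangle_ineq] add_mono)
qed

lemma BC_cmult [intro]: "BC \<phi> \<Longrightarrow> BC (\<lambda>x. c * \<phi> x)"
proof -
  assume a: "BC \<phi>"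
  obtain B where "\<forall>x. \<bar>\<phi> x\<bar> \<le> B" using BC_bound a by metis
  thus ?thesis using a unfolding BC_def
    by (auto intro!: continuous_intros BC_I[unfolded BC_def, THEN conjunct2, of _ "\<bar>c\<bar> * B"]
        mult_left_mono simp: abs_mult)
qed

lemma BC_diff [intro]: "BC \<phi> \<Longrightarrow> BC \<eta> \<Longrightarrow> BC (\<lambda>x. \<phi> x - \<eta> x)"
  using BC_add[of \<phi> "\<lambda>x. (-1) * \<eta> x"] BC_cmult[of \<eta> "-1"] by simp

lemma BC_sum [intro]: "(\<And>i. i \<in> I \<Longrightarrow> BC (\<phi> i)) \<Longrightarrow> BC (\<lambda>x. \<Sum>i\<in>I. \<phi> i x)"
proof (induction I rule: infinite_finite_induct)
  case (insert i I) thus ?case by (simp add: BC_add)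
qed (auto simp: BC_def)

lemma BC_affine: "BC \<phi> \<Longrightarrow> bounded_linear R \<Longrightarrow> BC (\<lambda>x. \<phi> (R x + r))"
proof -
  assume a: "BC \<phi>" "bounded_linear R"
  obtain B where "\<forall>x. \<bar>\<phi> x\<bar> \<le> B" using BC_bound a by metis
  moreover have "continuous_on UNIV (\<lambda>x. R x + r)"
    by (intro continuous_on_add linear_continuous_on a continuous_on_const)
  hence "continuous_on UNIV (\<lambda>x. \<phi> (R x + r))"
    using a continuous_on_compose2[of UNIV \<phi> UNIV "\<lambda>x. R x + r"] by (simp add: BC_def)
  ultimately show ?thesis by (intro BC_I[of _ B]) auto
qed

lemma gop_diff: "BC \<phi> \<Longrightarrow> BC \<eta> \<Longrightarrow> gop a (\<lambda>x. \<phi> x - \<eta> x) = (\<lambda>x. gop a \<phi> x - gop a \<eta> x)"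
  unfolding gop_def by (intro ext Bochner_Integration.integral_diff) auto

lemma gops_diff: "BC \<phi> \<Longrightarrow> BC \<eta> \<Longrightarrow> gops as (\<lambda>x. \<phi> x - \<eta> x) = (\<lambda>x. gops as \<phi> x - gops as \<eta> x)"
  by (induction as) (auto simp: gop_diff)

lemma gops_abs_le:
  assumes "BC \<phi>" "\<And>x. \<bar>\<phi> x\<bar> \<le> B"
  shows "\<bar>gops as \<phi> x\<bar> \<le> B"
  using assms by (induction as arbitrary: x) (auto intro!: gop_abs_le)

section \<open>Commutation and additivity of the averages\<close>

lemma gop_commute:
  assumes "BC \<phi>" shows "gop a (gop b \<phi>) = gop b (gop a \<phi>)"
proof
  fix x
  interpret pair_sigma_finite gauss gauss ..
  interpret P: prob_space "gauss \<Otimes>\<^sub>M gauss" by (intro prob_space_pair prob_space_gauss)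
  have "integrable (gauss \<Otimes>\<^sub>M gauss) (\<lambda>(z, w). \<phi> (x + z *\<^sub>R a + w *\<^sub>R b))"
    unfolding split_beta by (rule P.integrable_BC[OF assms]) measurable
  from Fubini_integral[OF this] show "gop a (gop b \<phi>) x = gop b (gop a \<phi>) x"
    unfolding gop_def by (simp add: ac_simps)
qed

lemma gop_gops_commute: "BC \<phi> \<Longrightarrow> gop a (gops as \<phi>) = gops as (gop a \<phi>)"
  by (induction as arbitrary: \<phi>) (simp_all add: gop_commute[of "gops _ _"])

lemma gops_commute: "BC \<phi> \<Longrightarrow> gops as (gops bs \<phi>) = gops bs (gops as \<phi>)"
  by (induction as arbitrary: \<phi>) (simp_all add: gop_gops_commute)

text \<open>Brings scaled standard variables into the density form in which the convolution of
  independent normal variables is known; used for \<open>gop_add\<close> and for Wiener increments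
  of variance h.\<close>

lemma distributed_scale_gauss:
  assumes "\<alpha> > 0"
  shows "distr gauss borel (\<lambda>z. \<alpha> * z) = density lborel (\<lambda>x. ennreal (normal_density 0 \<alpha> x))"
proof -
  have "distributed gauss lborel (\<lambda>z. z) (\<lambda>x. ennreal (std_normal_density x))"
    unfolding distributed_def
    by (simp add: gauss_def distr_id2)
  from gauss.normal_density_affine[OF this, of \<alpha> 0] assms
  have "distr gauss lborel (\<lambda>z. \<alpha> * z) = density lborel (\<lambda>x. ennreal (normal_density 0 \<alpha> x))"
    by (simp add: distributed_def)
  moreover have "distr gauss lborel (\<lambda>z. \<alpha> * z) = distr gauss borel (\<lambda>z. \<alpha> * z)"
    by (rule distr_cong) auto
  ultimately show ?thesis by simp
qed

text \<open>Variances of independent normal variables add. The two coordinates of the product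
  \<open>gauss \<Otimes>\<^sub>M gauss\<close> serve as the independent pair, and Fubini turns the
  iterated average into one integral over the product.\<close>

lemma gop_add:
  assumes "BC \<phi>" and "\<alpha> > 0" "\<beta> > 0"
  shows "gop (\<alpha> *\<^sub>R a) (gop (\<beta> *\<^sub>R a) \<phi>) = gop (sqrt (\<alpha>\<^sup>2 + \<beta>\<^sup>2) *\<^sub>R a) \<phi>"
proof
  fix x
  define \<gamma> where "\<gamma> = sqrt (\<alpha>\<^sup>2 + \<beta>\<^sup>2)"
  have \<gamma>: "\<gamma> > 0" using assms unfolding \<gamma>_def by (simp add: add_pos_pos)
  interpret pair_sigma_finite gauss gauss ..
  interpret P: prob_space "gauss \<Otimes>\<^sub>M gauss" by (intro prob_space_pair prob_space_gauss)
  have m: "distr (gauss \<Otimes>\<^sub>M gauss) borel (\<lambda>p. \<alpha> * fst p) = distr gauss borel (\<lambda>z. \<alpha> * z)"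
    using distr_distr[of "\<lambda>z. \<alpha> * z" gauss borel fst "gauss \<Otimes>\<^sub>M gauss"]
    by (simp add: comp_def gauss.distr_pair_fst)
  have m': "distr (gauss \<Otimes>\<^sub>M gauss) borel (\<lambda>p. \<beta> * snd p) = distr gauss borel (\<lambda>z. \<beta> * z)"
    by (subst distr_pair_swap)
       (simp add: distr_distr comp_def split_beta
         distr_distr[of "\<lambda>z. \<beta> * z" gauss borel fst "gauss \<Otimes>\<^sub>M gauss", unfolded comp_def gauss.distr_pair_fst])
  \<comment> \<open>Independence is checked through the joint law: the image of the product measure
    under a coordinatewise map is the product of the images, which are identified by
    \<open>m\<close> and \<open>m'\<close>.\<close>
  have iv: "P.indep_var borel (\<lambda>p. \<alpha> * fst p) borel (\<lambda>p. \<beta> * snd p)"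
    unfolding P.indep_var_distribution_eq m m'
    by (subst pair_measure_distr)
       (auto intro!: prob_space_imp_sigma_finite gauss.prob_space_distr simp: case_prod_beta')
  have "distributed (gauss \<Otimes>\<^sub>M gauss) lborel (\<lambda>p. \<alpha> * fst p + \<beta> * snd p) (normal_density (0+0) \<gamma>)"
    unfolding \<gamma>_def
  proof (rule P.add_indep_normal[OF iv])
    have "distr (gauss \<Otimes>\<^sub>M gauss) lborel (\<lambda>p. \<alpha> * fst p) = distr (gauss \<Otimes>\<^sub>M gauss) borel (\<lambda>p. \<alpha> * fst p)"
      "distr (gauss \<Otimes>\<^sub>M gauss) lborel (\<lambda>p. \<beta> * snd p) = distr (gauss \<Otimes>\<^sub>M gauss) borel (\<lambda>p. \<beta> * snd p)"
      by (rule distr_cong; simp)+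
    thus "distributed (gauss \<Otimes>\<^sub>M gauss) lborel (\<lambda>p. \<alpha> * fst p) (normal_density 0 \<alpha>)"
      "distributed (gauss \<Otimes>\<^sub>M gauss) lborel (\<lambda>p. \<beta> * snd p) (normal_density 0 \<beta>)"
      by (simp_all add: distributed_def m m' distributed_scale_gauss assms)
  qed (use assms in auto)
  hence d: "distr (gauss \<Otimes>\<^sub>M gauss) borel (\<lambda>p. \<alpha> * fst p + \<beta> * snd p) = distr gauss borel (\<lambda>z. \<gamma> * z)"
    using distributed_scale_gauss[OF \<gamma>]
      distr_cong[of "gauss \<Otimes>\<^sub>M gauss" "gauss \<Otimes>\<^sub>M gauss" lborel borel
        "\<lambda>p. \<alpha> * fst p + \<beta> * snd p" "\<lambda>p. \<alpha> * fst p + \<beta> * snd p"]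
    by (simp add: distributed_def)
  have "gop (\<alpha> *\<^sub>R a) (gop (\<beta> *\<^sub>R a) \<phi>) x = (\<integral>z. \<integral>w. \<phi> (x + (\<alpha> * z + \<beta> * w) *\<^sub>R a) \<partial>gauss \<partial>gauss)"
    unfolding gop_def by (simp add: algebra_simps)
  also have "\<dots> = (\<integral>p. \<phi> (x + (\<alpha> * fst p + \<beta> * snd p) *\<^sub>R a) \<partial>(gauss \<Otimes>\<^sub>M gauss))"
    by (subst integral_fst'[symmetric]) (auto intro!: P.integrable_BC[OF assms(1)])
  also have "\<dots> = (\<integral>y. \<phi> (x + y *\<^sub>R a) \<partial>distr (gauss \<Otimes>\<^sub>M gauss) borel (\<lambda>p. \<alpha> * fst p + \<beta> * snd p))"
    by (intro integral_distr[symmetric] measurable_compose[OF _ BC_measurable[OF assms(1)]]) measurable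
  also have "\<dots> = gop (\<gamma> *\<^sub>R a) \<phi> x"
    unfolding d gop_def
    by (subst integral_distr)
       (auto intro!: measurable_compose[OF _ BC_measurable[OF assms(1)]] simp: mult.commute)
  finally show "gop (\<alpha> *\<^sub>R a) (gop (\<beta> *\<^sub>R a) \<phi>) x = gop (sqrt (\<alpha>\<^sup>2 + \<beta>\<^sup>2) *\<^sub>R a) \<phi> x"
    unfolding \<gamma>_def .
qed

section \<open>Comparison of Gaussian laws\<close>

text \<open>Iterated \<open>gop_add\<close>. Starting from one factor rather than none keeps both
  scales strictly positive, as \<open>gop_add\<close> demands.\<close>

lemma gop_power:
  assumes "BC \<phi>" "c > 0"
  shows "(gop (c *\<^sub>R a) ^^ Suc k) \<phi> = gop ((sqrt (Suc k) * c) *\<^sub>R a) \<phi>"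
proof (induction k)
  case (Suc k)
  have "sqrt (c\<^sup>2 + (sqrt (Suc k) * c)\<^sup>2) = sqrt (Suc (Suc k)) * c"
    using assms by (intro real_sqrt_unique) (simp_all add: power_mult_distrib algebra_simps)
  thus ?case using Suc gop_add[OF assms(1) assms(2), of "sqrt (Suc k) * c" a] assms by simp
qed simp

lemma gops_replicate: "(gops as ^^ k) \<phi> = gops (concat (replicate k as)) \<phi>"
  by (induction k) simp_all

lemma gop_replicate: "(gop a ^^ k) \<phi> = gops (replicate k a) \<phi>"
  by (induction k) simp_all

text \<open>Powers distribute over the composition because all averaging operators commute.\<close>

lemma gops_Cons_power:
  "BC \<phi> \<Longrightarrow> (gops (a # as) ^^ k) \<phi> = (gop a ^^ k) ((gops as ^^ k) \<phi>)"
proof (induction k)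
  case (Suc k)
  thus ?case by (simp add: gop_replicate gops_replicate gops_commute[of _ as])
qed simp

text \<open>Infinite divisibility: a Gaussian law is the \<open>k\<close>-fold convolution of its
  copy shrunk by \<open>1 / sqrt k\<close>. This is the splitting on which the replacement argument
  runs.\<close>

lemma gops_scaled_power:
  assumes "BC \<phi>" "k > 0"
  shows "(gops (map ((*\<^sub>R) (1 / sqrt (real k))) as) ^^ k) \<phi> = gops as \<phi>"
proof (induction as)
  case Nil
  show ?case by (induction k) auto
next
  case (Cons a as)
  obtain j where k: "k = Suc j" using assms(2) gr0_implies_Suc by blast
  have "gops (a # as) \<phi> = gop ((sqrt (real k) * (1 / sqrt (real k))) *\<^sub>R a) (gops as \<phi>)"
    using assms by simp
  also have "\<dots> = (gop ((1 / sqrt (real k)) *\<^sub>R a) ^^ k) (gops as \<phi>)"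
    using gop_power[of "gops as \<phi>" "1 / sqrt (real k)" j a] assms unfolding k by simp
  finally show ?case using Cons assms by (simp only: list.map gops_Cons_power)
qed

text \<open>\<open>g\<close> and \<open>H\<close> play gradient and Hessian, but no derivative is
  mentioned: only bounds and a Taylor inequality are recorded. In this form the data pass through
  averages by linearity, without differentiation under the integral. One constant \<open>L\<close>
  serves both the Lipschitz bound of \<open>H\<close> and the cubic remainder.\<close>

definition taylor_data ::
    "('e::euclidean_space \<Rightarrow> real) \<Rightarrow> ('e \<Rightarrow> 'e \<Rightarrow> real) \<Rightarrow> ('e \<Rightarrow> 'e \<Rightarrow> 'e \<Rightarrow> real) \<Rightarrow> real \<Rightarrow> real \<Rightarrow> bool" where
  "taylor_data \<phi> g H B L \<longleftrightarrow> BC \<phi> \<and> (\<forall>u\<in>Basis. BC (g u)) \<and>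
     (\<forall>u\<in>Basis. \<forall>w\<in>Basis. BC (H u w) \<and> (\<forall>x. \<bar>H u w x\<bar> \<le> B) \<and>
        (\<forall>x y. \<bar>H u w (x + y) - H u w x\<bar> \<le> L * norm y)) \<and>
     (\<forall>x y. \<bar>\<phi> (x + y) - \<phi> x - (\<Sum>u\<in>Basis. g u x * (y \<bullet> u))
        - (1/2) * (\<Sum>u\<in>Basis. \<Sum>w\<in>Basis. H u w x * ((y \<bullet> u) * (y \<bullet> w)))\<bar> \<le> L * norm y ^ 3)"

section \<open>Stability of Taylor data under averaging\<close>

lemma gop_lipschitz:
  assumes "BC \<phi>" "\<And>x y. \<bar>\<phi> (x + y) - \<phi> x\<bar> \<le> K * norm y"
  shows "\<bar>gop a \<phi> (x + y) - gop a \<phi> x\<bar> \<le> K * norm y"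
proof -
  have "gop a \<phi> (x + y) - gop a \<phi> x = (\<integral>z. \<phi> (x + y + z *\<^sub>R a) - \<phi> (x + z *\<^sub>R a) \<partial>gauss)"
    unfolding gop_def using assms by (subst Bochner_Integration.integral_diff) auto
  moreover have "\<bar>\<dots>\<bar> \<le> K * norm y"
  proof (rule gauss.abs_integral_le_const)
    show "\<bar>\<phi> (x + y + z *\<^sub>R a) - \<phi> (x + z *\<^sub>R a)\<bar> \<le> K * norm y" for z
      using assms(2)[of "x + z *\<^sub>R a" y] by (simp add: ac_simps)
  qed (use BC_measurable[OF assms(1)] in measurable)
  ultimately show ?thesis by simp
qed

lemma gops_lipschitz:
  assumes "BC \<phi>" "\<And>x y. \<bar>\<phi> (x + y) - \<phi> x\<bar> \<le> K * norm y"
  shows "\<bar>gops as \<phi> (x + y) - gops as \<phi> x\<bar> \<le> K * norm y"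
  using assms by (induction as arbitrary: x y) (auto intro!: gop_lipschitz)

lemma gop_cmult: "gop a (\<lambda>x. c * \<phi> x) x = c * gop a \<phi> x"
  by (simp add: gop_def)

lemma gop_sum: "(\<And>i. i \<in> I \<Longrightarrow> BC (\<phi> i)) \<Longrightarrow> gop a (\<lambda>x. \<Sum>i\<in>I. \<phi> i x) x = (\<Sum>i\<in>I. gop a (\<phi> i) x)"
  unfolding gop_def by (subst Bochner_Integration.integral_sum) auto

lemma gop_sum2:
  assumes "\<And>u w. u \<in> I \<Longrightarrow> w \<in> J \<Longrightarrow> BC (H u w)"
  shows "gop a (\<lambda>x. \<Sum>u\<in>I. \<Sum>w\<in>J. c u w * H u w x) x = (\<Sum>u\<in>I. \<Sum>w\<in>J. c u w * gop a (H u w) x)"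
proof -
  have "gop a (\<lambda>x. \<Sum>u\<in>I. \<Sum>w\<in>J. c u w * H u w x) x = (\<Sum>u\<in>I. gop a (\<lambda>x. \<Sum>w\<in>J. c u w * H u w x) x)"
    using assms by (intro gop_sum BC_sum BC_cmult)
  also have "\<dots> = (\<Sum>u\<in>I. \<Sum>w\<in>J. gop a (\<lambda>x. c u w * H u w x) x)"
    using assms by (intro sum.cong gop_sum BC_cmult) auto
  finally show ?thesis by (simp add: gop_cmult)
qed

lemma gop_diff4:
  assumes "BC \<phi>1" "BC \<phi>2" "BC \<phi>3" "BC \<phi>4"
  shows "gop a (\<lambda>x. \<phi>1 x - \<phi>2 x - \<phi>3 x - c * \<phi>4 x) x = gop a \<phi>1 x - gop a \<phi>2 x - gop a \<phi>3 x - c * gop a \<phi>4 x"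
  using assms by (simp add: gop_diff BC_diff BC_cmult gop_cmult)

lemma gop_diff3:
  assumes "BC \<phi>1" "BC \<phi>2" "BC \<phi>3"
  shows "gop a (\<lambda>x. \<phi>1 x - \<phi>2 x - c * \<phi>3 x) x = gop a \<phi>1 x - gop a \<phi>2 x - c * gop a \<phi>3 x"
  using assms by (simp add: gop_diff BC_diff BC_cmult gop_cmult)

lemma gop_translate: "gop a (\<lambda>x. \<phi> (x + y)) x = gop a \<phi> (x + y)"
  by (simp add: gop_def ac_simps)

lemma BC_translate: "BC \<phi> \<Longrightarrow> BC (\<lambda>x. \<phi> (x + y))"
  using BC_affine[of \<phi> "\<lambda>x. x" y] by (simp add: bounded_linear_ident)

text \<open>Each clause bounds a finite linear combination of translates, and averaging commutes
  with translations and preserves sup bounds; hence the constants do not deteriorate.\<close>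

lemma taylor_data_gop:
  assumes "taylor_data \<phi> g H B L"
  shows "taylor_data (gop a \<phi>) (\<lambda>u. gop a (g u)) (\<lambda>u w. gop a (H u w)) B L"
  unfolding taylor_data_def
proof (intro conjI ballI allI)
  note d = assms[unfolded taylor_data_def]
  show "BC (gop a \<phi>)" "u \<in> Basis \<Longrightarrow> BC (gop a (g u))" for u using d by auto
  show "BC (gop a (H u w))" "\<bar>gop a (H u w) x\<bar> \<le> B"
    "\<bar>gop a (H u w) (x + y) - gop a (H u w) x\<bar> \<le> L * norm y"
    if "u \<in> Basis" "w \<in> Basis" for u w x y
    using d that by (auto intro!: gop_abs_le gop_lipschitz)
  fix x y
  \<comment> \<open>The Taylor remainder as a function of the base point with the displacement
    \<open>y\<close> frozen. It is bounded by the cubic term everywhere, and so is its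
    average.\<close>
  define P where "P = (\<lambda>x. \<phi> (x + y) - \<phi> x - (\<Sum>u\<in>Basis. (y \<bullet> u) * g u x)
        - (1/2) * (\<Sum>u\<in>Basis. \<Sum>w\<in>Basis. ((y \<bullet> u) * (y \<bullet> w)) * H u w x))"
  have bc: "BC (\<lambda>x. \<Sum>u\<in>Basis. (y \<bullet> u) * g u x)"
    "BC (\<lambda>x. \<Sum>u\<in>Basis. \<Sum>w\<in>Basis. ((y \<bullet> u) * (y \<bullet> w)) * H u w x)"
    using d by (intro BC_sum BC_cmult; simp)+
  have "BC P" unfolding P_def
    using d by (intro BC_diff BC_cmult bc BC_translate) auto
  moreover have "\<bar>P x\<bar> \<le> L * norm y ^ 3" for x
    using d unfolding P_def by (simp add: mult.commute)
  ultimately have "\<bar>gop a P x\<bar> \<le> L * norm y ^ 3" by (rule gop_abs_le)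
  moreover have "gop a P x = gop a \<phi> (x + y) - gop a \<phi> x - (\<Sum>u\<in>Basis. (y \<bullet> u) * gop a (g u) x)
        - (1/2) * (\<Sum>u\<in>Basis. \<Sum>w\<in>Basis. ((y \<bullet> u) * (y \<bullet> w)) * gop a (H u w) x)"
  proof -
    have "gop a (\<lambda>x. \<Sum>u\<in>Basis. (y \<bullet> u) * g u x) x = (\<Sum>u\<in>Basis. (y \<bullet> u) * gop a (g u) x)"
      using d by (subst gop_sum) (auto simp: gop_cmult)
    moreover have "gop a (\<lambda>x. \<Sum>u\<in>Basis. \<Sum>w\<in>Basis. ((y \<bullet> u) * (y \<bullet> w)) * H u w x) x
        = (\<Sum>u\<in>Basis. \<Sum>w\<in>Basis. ((y \<bullet> u) * (y \<bullet> w)) * gop a (H u w) x)"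
      using d by (intro gop_sum2) auto
    ultimately show ?thesis unfolding P_def
      using d bc by (subst gop_diff4) (auto intro!: BC_translate simp: gop_translate)
  qed
  ultimately show "\<bar>gop a \<phi> (x + y) - gop a \<phi> x - (\<Sum>u\<in>Basis. gop a (g u) x * (y \<bullet> u))
        - (1/2) * (\<Sum>u\<in>Basis. \<Sum>w\<in>Basis. gop a (H u w) x * ((y \<bullet> u) * (y \<bullet> w)))\<bar> \<le> L * norm y ^ 3"
    by (simp add: mult.commute)
qed

text \<open>Only the two constants are fixed; gradient and Hessian may vary with the function. The
  class is therefore closed under all averages, and one local error estimate holds at every stage of
  the telescoping argument.\<close>

definition tclass :: "real \<Rightarrow> real \<Rightarrow> ('e::euclidean_space \<Rightarrow> real) \<Rightarrow> bool" where
  "tclass B L \<phi> \<longleftrightarrow> (\<exists>g H. taylor_data \<phi> g H B L)"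

lemma tclass_BC: "tclass B L \<phi> \<Longrightarrow> BC \<phi>"
  by (auto simp: tclass_def taylor_data_def)

lemma tclass_gops: "tclass B L \<phi> \<Longrightarrow> tclass B L (gops as \<phi>)"
  by (induction as) (auto simp: tclass_def dest: taylor_data_gop)

text \<open>The expectation of \<open>\<beta>\<close> on the diagonal under the Gaussian law coded
  by \<open>as\<close>, that is, the covariance matrix paired with the form \<open>\<beta>\<close>.
  Pushing the law forward by a linear map becomes pulling \<open>\<beta>\<close> back, as in
  \<open>cov_map\<close>.\<close>

definition cov :: "'e::euclidean_space list \<Rightarrow> ('e \<Rightarrow> 'e \<Rightarrow> real) \<Rightarrow> real" where
  "cov as \<beta> = (\<Sum>a\<leftarrow>as. \<beta> a a)"

abbreviation coord2 :: "'e::euclidean_space \<Rightarrow> 'e \<Rightarrow> 'e \<Rightarrow> 'e \<Rightarrow> real" where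
  "coord2 u w \<equiv> \<lambda>x y. (x \<bullet> u) * (y \<bullet> w)"

lemma cov_simps [simp]: "cov [] \<beta> = 0" "cov (a # as) \<beta> = \<beta> a a + cov as \<beta>"
    "cov (as @ bs) \<beta> = cov as \<beta> + cov bs \<beta>"
  by (simp_all add: cov_def)

lemma cov_coord2_bound:
  fixes \<epsilon> :: real
  assumes "\<And>a. a \<in> set as \<Longrightarrow> norm a \<le> \<epsilon>" "u \<in> Basis" "w \<in> Basis"
  shows "\<bar>cov as (coord2 u w)\<bar> \<le> length as * \<epsilon>\<^sup>2"
  using assms(1)
proof (induction as)
  case (Cons a as)
  have "\<bar>a \<bullet> u\<bar> \<le> \<epsilon>" "\<bar>a \<bullet> w\<bar> \<le> \<epsilon>"
    using Cons.prems[of a] Basis_le_norm[OF assms(2), of a] Basis_le_norm[OF assms(3), of a] by auto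
  hence "\<bar>(a \<bullet> u) * (a \<bullet> w)\<bar> \<le> \<epsilon>\<^sup>2"
    unfolding abs_mult power2_eq_square by (intro mult_mono) auto
  thus ?case using Cons by (simp add: algebra_simps)
qed simp

text \<open>The first-order term vanishes because the normal law is centred, and the second-order
  term is the covariance paired with the Hessian. The constant is chosen before the function, the
  list and \<open>\<epsilon>\<close>, so that it stays fixed when a list of given length is
  rescaled.\<close>

lemma gops_expansion:
  "\<exists>c\<ge>0. \<forall>(\<phi>::'e::euclidean_space \<Rightarrow> real) g H B L (as::'e list) \<epsilon> x. taylor_data \<phi> g H B L \<longrightarrow> L \<ge> 0 \<longrightarrow> \<epsilon> \<ge> 0 \<longrightarrow>
     length as = n \<longrightarrow> (\<forall>a\<in>set as. norm a \<le> \<epsilon>) \<longrightarrow>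
     \<bar>gops as \<phi> x - \<phi> x - (1/2) * (\<Sum>u\<in>Basis. \<Sum>w\<in>Basis. cov as (coord2 u w) * H u w x)\<bar> \<le> c * L * \<epsilon>^3"
proof (induction n)
  case 0
  show ?case by (intro exI[of _ 0]) auto
next
  case (Suc n)
  then obtain c where c: "c \<ge> 0" and IH: "\<And>(\<phi>::'e \<Rightarrow> real) g H B L (as::'e list) \<epsilon> x. taylor_data \<phi> g H B L \<Longrightarrow> L \<ge> 0 \<Longrightarrow> \<epsilon> \<ge> 0 \<Longrightarrow>
     length as = n \<Longrightarrow> (\<forall>a\<in>set as. norm a \<le> \<epsilon>) \<Longrightarrow>
     \<bar>gops as \<phi> x - \<phi> x - (1/2) * (\<Sum>u\<in>Basis. \<Sum>w\<in>Basis. cov as (coord2 u w) * H u w x)\<bar> \<le> c * L * \<epsilon>^3"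
    by blast
  define k1 where "k1 = (\<integral>z. \<bar>z\<bar> \<partial>gauss)"
  define k3 where "k3 = (\<integral>z. \<bar>z\<bar>^3 \<partial>gauss)"
  have k: "k1 \<ge> 0" "k3 \<ge> 0" unfolding k1_def k3_def by auto
  \<comment> \<open>Three sources of error: the expansion over the tail of the list, the cubic
    Taylor remainder along the new direction (third absolute moment \<open>k3\<close>), and the
    change of the Hessian under that direction, of order \<epsilon>, weighted by a covariance of
    order \<epsilon>^2 (first absolute moment \<open>k1\<close>).\<close>
  define c' where "c' = c + k3 + DIM('e) * (DIM('e) * (n * k1))"
  show ?case
  proof (intro exI[of _ c'] conjI allI impI)
    show "c' \<ge> 0" using c k unfolding c'_def by simp
    fix \<phi> :: "'e \<Rightarrow> real" and g H B L and as' :: "'e list" and \<epsilon> x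
    assume d: "taylor_data \<phi> g H B L" and L: "L \<ge> 0" and \<epsilon>: "\<epsilon> \<ge> 0" and len: "length as' = Suc n"
      and nm: "\<forall>a\<in>set as'. norm a \<le> \<epsilon>"
    obtain a as where as': "as' = a # as" and len': "length as = n" using len by (cases as') auto
    note dd = d[unfolded taylor_data_def]
    have a: "norm a \<le> \<epsilon>" and nm': "\<forall>a\<in>set as. norm a \<le> \<epsilon>" using nm as' by auto
    define S where "S = (\<lambda>y. \<Sum>u\<in>Basis. \<Sum>w\<in>Basis. cov as (coord2 u w) * H u w y)"
    \<comment> \<open>The error already made over the tail. Averaging it along \<open>a\<close> does
      not enlarge its bound, so only \<open>gop a \<phi>\<close> and \<open>gop a S\<close> remain
      to be expanded.\<close>
    define r where "r = (\<lambda>y. gops as \<phi> y - \<phi> y - (1/2) * S y)"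
    have S: "BC S" unfolding S_def using dd by (intro BC_sum BC_cmult) auto
    have BCr: "BC r" unfolding r_def using dd S by (intro BC_diff BC_cmult) auto
    have r: "\<bar>gop a r x\<bar> \<le> c * L * \<epsilon>^3"
      by (rule gop_abs_le[OF BCr]) (use IH[OF d L \<epsilon> len' nm'] in \<open>simp add: r_def S_def\<close>)
    have e1: "gop a r x = gops as' \<phi> x - gop a \<phi> x - (1/2) * gop a S x"
      unfolding r_def as' using dd S by (subst gop_diff3) auto
    define G where "G = (\<Sum>u\<in>Basis. g u x * (a \<bullet> u))"
    define Q where "Q = (\<Sum>u\<in>Basis. \<Sum>w\<in>Basis. H u w x * ((a \<bullet> u) * (a \<bullet> w)))"
    have e2: "\<bar>gop a \<phi> x - \<phi> x - (1/2) * Q\<bar> \<le> L * k3 * \<epsilon>^3"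
    proof -
      have "gop a \<phi> x - \<phi> x - (1/2) * Q = (\<integral>z. \<phi> (x + z *\<^sub>R a) - \<phi> x - z * G - z\<^sup>2 * (Q / 2) \<partial>gauss)"
        unfolding gop_def using dd gauss_moments
        by (subst Bochner_Integration.integral_diff; (intro Bochner_Integration.integrable_diff)?; simp?)+
      also have "\<bar>\<dots>\<bar> \<le> (\<integral>z. \<bar>\<phi> (x + z *\<^sub>R a) - \<phi> x - z * G - z\<^sup>2 * (Q / 2)\<bar> \<partial>gauss)"
        by (rule integral_abs_bound)
      also have "\<dots> \<le> (\<integral>z. L * \<epsilon>^3 * \<bar>z\<bar>^3 \<partial>gauss)"
      proof (rule integral_mono)
        fix z
        have "\<bar>\<phi> (x + z *\<^sub>R a) - \<phi> x - (\<Sum>u\<in>Basis. g u x * ((z *\<^sub>R a) \<bullet> u))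
           - (1/2) * (\<Sum>u\<in>Basis. \<Sum>w\<in>Basis. H u w x * (((z *\<^sub>R a) \<bullet> u) * ((z *\<^sub>R a) \<bullet> w)))\<bar> \<le> L * norm (z *\<^sub>R a) ^ 3"
          using dd by blast
        moreover have "(\<Sum>u\<in>Basis. g u x * ((z *\<^sub>R a) \<bullet> u)) = z * G"
          unfolding G_def sum_distrib_left by (intro sum.cong) auto
        moreover have "(\<Sum>u\<in>Basis. \<Sum>w\<in>Basis. H u w x * (((z *\<^sub>R a) \<bullet> u) * ((z *\<^sub>R a) \<bullet> w))) = z\<^sup>2 * Q"
          unfolding Q_def sum_distrib_left by (intro sum.cong) (auto simp: power2_eq_square)
        moreover have "L * norm (z *\<^sub>R a) ^ 3 \<le> L * (\<epsilon>^3 * \<bar>z\<bar>^3)"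
          using L a unfolding norm_scaleR power_mult_distrib
          by (intro mult_left_mono) (auto simp: mult.commute[of "\<bar>z\<bar> ^ 3"] intro!: mult_right_mono power_mono)
        ultimately show "\<bar>\<phi> (x + z *\<^sub>R a) - \<phi> x - z * G - z\<^sup>2 * (Q / 2)\<bar> \<le> L * \<epsilon>^3 * \<bar>z\<bar>^3" by simp
      qed (use dd gauss_moments in auto)
      also have "\<dots> = L * k3 * \<epsilon>^3" unfolding k3_def by simp
      finally show ?thesis .
    qed
    have e3: "\<bar>gop a (H u w) x - H u w x\<bar> \<le> L * \<epsilon> * k1" if "u \<in> Basis" "w \<in> Basis" for u w
    proof -
      have bc: "BC (H u w)" using dd that by auto
      have "gop a (H u w) x - H u w x = (\<integral>z. H u w (x + z *\<^sub>R a) - H u w x \<partial>gauss)"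
        unfolding gop_def using bc by (subst Bochner_Integration.integral_diff) auto
      also have "\<bar>\<dots>\<bar> \<le> (\<integral>z. \<bar>H u w (x + z *\<^sub>R a) - H u w x\<bar> \<partial>gauss)"
        by (rule integral_abs_bound)
      also have "\<dots> \<le> (\<integral>z. L * \<epsilon> * \<bar>z\<bar> \<partial>gauss)"
      proof (rule integral_mono)
        fix z
        have "\<bar>H u w (x + z *\<^sub>R a) - H u w x\<bar> \<le> L * norm (z *\<^sub>R a)" using dd that by blast
        also have "\<dots> \<le> L * (\<epsilon> * \<bar>z\<bar>)"
          using L a by (intro mult_left_mono) (auto simp: mult.commute[of "\<bar>z\<bar>"] intro!: mult_right_mono)
        finally show "\<bar>H u w (x + z *\<^sub>R a) - H u w x\<bar> \<le> L * \<epsilon> * \<bar>z\<bar>" by simp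
      qed (use bc gauss_moments in auto)
      finally show ?thesis by (simp add: k1_def)
    qed
    have e4: "\<bar>gop a S x - S x\<bar> \<le> DIM('e) * (DIM('e) * (n * k1)) * L * \<epsilon>^3"
    proof -
      have "gop a S x = (\<Sum>u\<in>Basis. \<Sum>w\<in>Basis. cov as (coord2 u w) * gop a (H u w) x)"
        unfolding S_def using dd by (intro gop_sum2) auto
      hence "gop a S x - S x = (\<Sum>u\<in>Basis. \<Sum>w\<in>Basis. cov as (coord2 u w) * (gop a (H u w) x - H u w x))"
        unfolding S_def by (simp add: sum_subtractf[symmetric] right_diff_distrib)
      also have "\<bar>\<dots>\<bar> \<le> (\<Sum>u\<in>(Basis::'e set). \<Sum>w\<in>(Basis::'e set). (n * \<epsilon>\<^sup>2) * (L * \<epsilon> * k1))"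
        using cov_coord2_bound[of as \<epsilon>] nm' e3 len' \<epsilon>
        by (intro order.trans[OF sum_abs] sum_mono) (auto simp: abs_mult intro!: mult_mono)
      also have "\<dots> = DIM('e) * (DIM('e) * (n * k1)) * L * \<epsilon>^3"
        by (simp add: power2_eq_square power3_eq_cube)
      finally show ?thesis .
    qed
    have "(\<Sum>u\<in>Basis. \<Sum>w\<in>Basis. cov as' (coord2 u w) * H u w x) = Q + S x"
      unfolding as' Q_def S_def by (simp add: algebra_simps sum.distrib)
    hence "\<bar>gops as' \<phi> x - \<phi> x - (1/2) * (\<Sum>u\<in>Basis. \<Sum>w\<in>Basis. cov as' (coord2 u w) * H u w x)\<bar>
        = \<bar>gop a r x + (gop a \<phi> x - \<phi> x - (1/2) * Q) + (1/2) * (gop a S x - S x)\<bar>"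
      by (intro arg_cong[where f = abs]) (simp add: e1 field_simps)
    also have "\<dots> \<le> c * L * \<epsilon>^3 + L * k3 * \<epsilon>^3 + DIM('e) * (DIM('e) * (n * k1)) * L * \<epsilon>^3"
      using r e2 e4 by argo
    also have "\<dots> = c' * L * \<epsilon>^3" unfolding c'_def by (simp add: algebra_simps)
    finally show "\<bar>gops as' \<phi> x - \<phi> x - (1/2) * (\<Sum>u\<in>Basis. \<Sum>w\<in>Basis. cov as' (coord2 u w) * H u w x)\<bar> \<le> c' * L * \<epsilon>^3" .
  qed
qed

text \<open>Telescoping with operators U for \<open>as\<close> and U' for \<open>bs\<close>: the
  difference of the powers \<open>k + 1\<close> is U^k (U - U') plus (U^k - U'^k) U'. The first part
  uses that averages contract the sup norm, the second that the class is closed under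
  averaging.\<close>

lemma gops_power_telescope:
  assumes "\<And>\<eta> y. tclass B L \<eta> \<Longrightarrow> \<bar>gops as \<eta> y - gops bs \<eta> y\<bar> \<le> e" "tclass B L \<phi>"
  shows "\<bar>(gops as ^^ k) \<phi> x - (gops bs ^^ k) \<phi> x\<bar> \<le> k * e"
  using assms(2)
proof (induction k arbitrary: \<phi> x)
  case (Suc k)
  have bc: "BC (gops as \<phi>)" "BC (gops bs \<phi>)" using tclass_BC[OF Suc.prems] by simp_all
  have "(gops as ^^ k) (gops as \<phi>) x - (gops as ^^ k) (gops bs \<phi>) x
      = (gops as ^^ k) (\<lambda>y. gops as \<phi> y - gops bs \<phi> y) x"
    using bc by (simp add: gops_replicate gops_diff)
  also have "\<bar>\<dots>\<bar> \<le> e"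
    unfolding gops_replicate using bc assms(1)[OF Suc.prems] by (intro gops_abs_le BC_diff)
  finally have "\<bar>(gops as ^^ k) (gops as \<phi>) x - (gops as ^^ k) (gops bs \<phi>) x\<bar> \<le> e" .
  moreover have "\<bar>(gops as ^^ k) (gops bs \<phi>) x - (gops bs ^^ k) (gops bs \<phi>) x\<bar> \<le> k * e"
    using Suc.IH[OF tclass_gops[OF Suc.prems]] by auto
  ultimately show ?case by (simp add: funpow_swap1 algebra_simps)
qed simp

lemma cov_coord2_scaled: "cov (map ((*\<^sub>R) c) as) (coord2 u w) = c\<^sup>2 * cov as (coord2 u w)"
  by (induction as) (simp_all add: algebra_simps power2_eq_square)

text \<open>Lindeberg's replacement argument: both Gaussian laws are split into \<open>k\<close> equal independent
  parts, so that the error terms of third order contribute \<open>k * (1 / sqrt k)\<^sup>3\<close> in total.\<close>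

lemma gauss_comparison:
  fixes \<phi> :: "'e::euclidean_space \<Rightarrow> real"
  assumes \<phi>: "tclass B L \<phi>" and L: "L \<ge> 0"
  shows "\<bar>gops as \<phi> x - gops bs \<phi> x\<bar>
     \<le> (B/2) * (\<Sum>u\<in>Basis. \<Sum>w\<in>Basis. \<bar>cov as (coord2 u w) - cov bs (coord2 u w)\<bar>)" (is "_ \<le> ?R")
proof -
  define M where "M = sum_list (map norm (as @ bs))"
  have M: "norm a \<le> M" if "a \<in> set as \<union> set bs" for a
    unfolding M_def using that by (intro member_le_sum_list) auto
  have M0: "M \<ge> 0" unfolding M_def by (intro sum_list_nonneg) auto
  obtain c1 where c1: "c1 \<ge> 0" and e1: "\<And>(\<phi>::'e \<Rightarrow> real) g H B L (as'::'e list) \<epsilon> x. taylor_data \<phi> g H B L \<Longrightarrow> L \<ge> 0 \<Longrightarrow> \<epsilon> \<ge> 0 \<Longrightarrow>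
     length as' = length as \<Longrightarrow> (\<forall>a\<in>set as'. norm a \<le> \<epsilon>) \<Longrightarrow>
     \<bar>gops as' \<phi> x - \<phi> x - (1/2) * (\<Sum>u\<in>Basis. \<Sum>w\<in>Basis. cov as' (coord2 u w) * H u w x)\<bar> \<le> c1 * L * \<epsilon>^3"
    using gops_expansion[of "length as", where ?'e='e] by blast
  obtain c2 where c2: "c2 \<ge> 0" and e2: "\<And>(\<phi>::'e \<Rightarrow> real) g H B L (as'::'e list) \<epsilon> x. taylor_data \<phi> g H B L \<Longrightarrow> L \<ge> 0 \<Longrightarrow> \<epsilon> \<ge> 0 \<Longrightarrow>
     length as' = length bs \<Longrightarrow> (\<forall>a\<in>set as'. norm a \<le> \<epsilon>) \<Longrightarrow>
     \<bar>gops as' \<phi> x - \<phi> x - (1/2) * (\<Sum>u\<in>Basis. \<Sum>w\<in>Basis. cov as' (coord2 u w) * H u w x)\<bar> \<le> c2 * L * \<epsilon>^3"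
    using gops_expansion[of "length bs", where ?'e='e] by blast
  have main: "\<bar>gops as \<phi> x - gops bs \<phi> x\<bar> \<le> ?R + (c1 + c2) * L * M^3 * (1 / sqrt (real (Suc k)))" for k
  proof -
    define s where "s = 1 / sqrt (real (Suc k))"
    have s: "s > 0" "real (Suc k) * s\<^sup>2 = 1" unfolding s_def by (auto simp: power_divide)
    define as' where "as' = map ((*\<^sub>R) s) as"
    define bs' where "bs' = map ((*\<^sub>R) s) bs"
    define e where "e = s\<^sup>2 * ?R + (c1 + c2) * L * (s * M)^3"
    have "\<bar>gops as' \<eta> y - gops bs' \<eta> y\<bar> \<le> e" if \<eta>: "tclass B L \<eta>" for \<eta> y
    proof -
      obtain g H where d: "taylor_data \<eta> g H B L" using \<eta> by (auto simp: tclass_def)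
      have H: "\<bar>H u w y\<bar> \<le> B" if "u \<in> Basis" "w \<in> Basis" for u w
        using d that by (auto simp: taylor_data_def)
      have sM: "s * M \<ge> 0" using s M0 by simp
      have "\<forall>a\<in>set as'. norm a \<le> s * M" "\<forall>a\<in>set bs'. norm a \<le> s * M"
        unfolding as'_def bs'_def using s M by (auto intro!: mult_left_mono)
      from e1[OF d L sM _ this(1), of y] e2[OF d L sM _ this(2), of y]
      have "\<bar>gops as' \<eta> y - \<eta> y - (1/2) * (\<Sum>u\<in>Basis. \<Sum>w\<in>Basis. cov as' (coord2 u w) * H u w y)\<bar> \<le> c1 * L * (s * M)^3"
        "\<bar>gops bs' \<eta> y - \<eta> y - (1/2) * (\<Sum>u\<in>Basis. \<Sum>w\<in>Basis. cov bs' (coord2 u w) * H u w y)\<bar> \<le> c2 * L * (s * M)^3"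
        by (auto simp: as'_def bs'_def)
      moreover have "(\<Sum>u\<in>Basis. \<Sum>w\<in>Basis. cov as' (coord2 u w) * H u w y) - (\<Sum>u\<in>Basis. \<Sum>w\<in>Basis. cov bs' (coord2 u w) * H u w y)
         = s\<^sup>2 * (\<Sum>u\<in>Basis. \<Sum>w\<in>Basis. (cov as (coord2 u w) - cov bs (coord2 u w)) * H u w y)" (is "?d = s\<^sup>2 * ?S")
        unfolding as'_def bs'_def cov_coord2_scaled sum_subtractf[symmetric] sum_distrib_left
        by (simp add: algebra_simps)
      moreover have "\<bar>?S\<bar> \<le> 2 * ?R"
        using H by (auto simp: sum_distrib_left abs_mult mult.commute[of B]
          intro!: order.trans[OF sum_abs] sum_mono mult_left_mono)
      hence "s\<^sup>2 * \<bar>?S\<bar> \<le> s\<^sup>2 * (2 * ?R)" by (intro mult_left_mono) auto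
      hence "\<bar>s\<^sup>2 * ?S\<bar> \<le> 2 * (s\<^sup>2 * ?R)" by (simp add: abs_mult)
      ultimately show ?thesis unfolding e_def distrib_right by argo
    qed
    from gops_power_telescope[OF this \<phi>, of "Suc k" x]
    have "\<bar>gops as \<phi> x - gops bs \<phi> x\<bar> \<le> real (Suc k) * e"
      using gops_scaled_power[OF tclass_BC[OF \<phi>], of "Suc k"] unfolding as'_def bs'_def s_def by simp
    also have "\<dots> = (real (Suc k) * s\<^sup>2) * (?R + (c1 + c2) * L * M^3 * s)"
      unfolding e_def by (simp add: algebra_simps power2_eq_square power3_eq_cube)
    finally show ?thesis unfolding s(2) by (simp add: s_def)
  qed
  have "(\<lambda>k. ?R + (c1 + c2) * L * M^3 * (1 / sqrt (real (Suc k)))) \<longlonglongrightarrow> ?R + (c1 + c2) * L * M^3 * 0"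
    by (intro tendsto_intros) real_asymp
  thus ?thesis using main by (intro LIMSEQ_le_const) auto
qed

section \<open>Taylor expansion of functions with bounded derivatives\<close>

lemma Cb_Suc_imp: "Cb (Suc k) g \<Longrightarrow> Cb k g"
proof (induction k arbitrary: g)
  case (Suc k)
  thus ?case by (metis Cb.simps(2))
qed simp

lemma Cb_BC: "Cb k g \<Longrightarrow> BC g"
  by (cases k) (auto simp: BC_def)

lemma has_real_derivative_line:
  fixes g :: "'e::euclidean_space \<Rightarrow> real"
  assumes "\<And>x. g differentiable (at x)"
  shows "((\<lambda>t. g (x + t *\<^sub>R y)) has_real_derivative
           (\<Sum>u\<in>Basis. (y \<bullet> u) * frechet_derivative g (at (x + t *\<^sub>R y)) u)) (at t)"
proof -
  let ?D = "frechet_derivative g (at (x + t *\<^sub>R y))"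
  have D: "(g has_derivative ?D) (at (x + t *\<^sub>R y))" using assms frechet_derivative_works by blast
  interpret linear ?D using D by (rule has_derivative_linear)
  have "?D (s *\<^sub>R y) = s * (\<Sum>u\<in>Basis. (y \<bullet> u) * ?D u)" for s
  proof -
    have "?D (s *\<^sub>R y) = s * ?D (\<Sum>u\<in>Basis. (y \<bullet> u) *\<^sub>R u)" by (simp add: scale euclidean_representation)
    also have "\<dots> = s * (\<Sum>u\<in>Basis. (y \<bullet> u) * ?D u)" unfolding sum by (simp add: scale)
    finally show ?thesis .
  qed
  moreover have "((\<lambda>t. g (x + t *\<^sub>R y)) has_derivative (\<lambda>s. ?D (0 + s *\<^sub>R y))) (at t)"
    by (rule has_derivative_compose[where f="\<lambda>t. x + t *\<^sub>R y" and g=g, OF _ D])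
       (auto intro!: derivative_eq_intros)
  ultimately show ?thesis unfolding has_field_derivative_def
    by (simp add: mult.commute[of _ "sum _ _"])
qed

lemma coord_sum_bound:
  fixes y :: "'e::euclidean_space" and K :: real
  assumes "\<And>u. u \<in> Basis \<Longrightarrow> \<bar>c u\<bar> \<le> K"
  shows "\<bar>\<Sum>u\<in>Basis. (y \<bullet> u) * c u\<bar> \<le> real DIM('e) * (norm y * K)"
proof -
  have "\<bar>\<Sum>u\<in>Basis. (y \<bullet> u) * c u\<bar> \<le> (\<Sum>u\<in>(Basis::'e set). norm y * K)"
    using assms Basis_le_norm[of _ y]
    by (intro order.trans[OF sum_abs] sum_mono) (auto simp: abs_mult intro!: mult_mono)
  thus ?thesis by simp
qed

lemma lipschitz_of_bounded_derivatives:
  fixes g :: "'e::euclidean_space \<Rightarrow> real" and K :: real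
  assumes "\<And>x. g differentiable (at x)" "\<And>u x. u \<in> Basis \<Longrightarrow> \<bar>frechet_derivative g (at x) u\<bar> \<le> K"
  shows "\<bar>g (x + y) - g x\<bar> \<le> DIM('e) * K * norm y"
proof -
  let ?h = "\<lambda>t. g (x + t *\<^sub>R y)"
  let ?h' = "\<lambda>t. \<Sum>u\<in>Basis. (y \<bullet> u) * frechet_derivative g (at (x + t *\<^sub>R y)) u"
  obtain t where "0 < t" "t < 1" "?h 1 - ?h 0 = (1 - 0) * ?h' t"
    using MVT2[of 0 1 ?h ?h'] has_real_derivative_line[OF assms(1)] by auto
  hence "\<bar>g (x + y) - g x\<bar> = \<bar>?h' t\<bar>" by simp
  also have "\<dots> \<le> real DIM('e) * (norm y * K)" by (intro coord_sum_bound assms(2))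
  finally show ?thesis by (simp add: mult_ac)
qed

lemma tclass_translate: "tclass B L \<phi> \<Longrightarrow> tclass B L (\<lambda>x. \<phi> (x + c))"
proof -
  assume "tclass B L \<phi>"
  then obtain g H where "taylor_data \<phi> g H B L" by (auto simp: tclass_def)
  note d = this[unfolded taylor_data_def]
  have eq: "x + y + c = (x + c) + y" for x y by (simp add: ac_simps)
  have "taylor_data (\<lambda>x. \<phi> (x + c)) (\<lambda>u x. g u (x + c)) (\<lambda>u w x. H u w (x + c)) B L"
    unfolding taylor_data_def eq using d by (blast intro: BC_translate)
  thus ?thesis by (auto simp: tclass_def)
qed

lemma BC_family_bound:
  assumes "finite I" "\<And>i. i \<in> I \<Longrightarrow> BC (f i)"
  shows "\<exists>K. \<forall>i\<in>I. \<forall>x. \<bar>f i x\<bar> \<le> K"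
  using assms
proof (induction I)
  case (insert i I)
  obtain K where "\<forall>i\<in>I. \<forall>x. \<bar>f i x\<bar> \<le> K" using insert by auto
  moreover obtain B where "\<forall>x. \<bar>f i x\<bar> \<le> B" using BC_bound[of "f i"] insert by auto
  ultimately show ?case by (intro exI[of _ "max K B"]) (auto simp: le_max_iff_disj)
qed simp

lemma Cb_imp_tclass:
  fixes \<psi> :: "'e::euclidean_space \<Rightarrow> real"
  assumes "Cb 3 \<psi>"
  obtains B L K where "B \<ge> 0" "L \<ge> 0" "K \<ge> 0" "tclass B L \<psi>" "\<And>x y. \<bar>\<psi> (x + y) - \<psi> x\<bar> \<le> K * norm y"
proof -
  let ?D = "\<lambda>g u x. frechet_derivative g (at x) u"
  have C: "Cb (Suc (Suc (Suc 0))) \<psi>" using assms by (simp only: numeral_3_eq_3)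
  hence d0: "\<And>x. \<psi> differentiable (at x)" and C1: "\<And>u. u \<in> Basis \<Longrightarrow> Cb 2 (?D \<psi> u)"
    by (auto simp: numeral_2_eq_2)
  hence d1: "\<And>u x. u \<in> Basis \<Longrightarrow> ?D \<psi> u differentiable (at x)"
    and C2: "\<And>u w. u \<in> Basis \<Longrightarrow> w \<in> Basis \<Longrightarrow> Cb 1 (?D (?D \<psi> u) w)"
    by (auto simp: numeral_2_eq_2)
  hence d2: "\<And>u w x. u \<in> Basis \<Longrightarrow> w \<in> Basis \<Longrightarrow> ?D (?D \<psi> u) w differentiable (at x)"
    and C3: "\<And>u w z. u \<in> Basis \<Longrightarrow> w \<in> Basis \<Longrightarrow> z \<in> Basis \<Longrightarrow> Cb 0 (?D (?D (?D \<psi> u) w) z)"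
    by auto
  let ?B = "Basis :: 'e set"
  obtain K1 where K1: "\<And>u x. u \<in> Basis \<Longrightarrow> \<bar>?D \<psi> u x\<bar> \<le> K1"
    using BC_family_bound[of ?B "?D \<psi>"] Cb_BC[OF C1] by auto
  obtain K2 where "\<And>p x. p \<in> ?B \<times> ?B \<Longrightarrow> \<bar>?D (?D \<psi> (fst p)) (snd p) x\<bar> \<le> K2"
    using BC_family_bound[of "?B \<times> ?B" "\<lambda>p. ?D (?D \<psi> (fst p)) (snd p)"] Cb_BC[OF C2] by fastforce
  hence K2: "\<bar>?D (?D \<psi> u) w x\<bar> \<le> K2" if "u \<in> Basis" "w \<in> Basis" for u w x
    using that by (metis SigmaI fst_conv snd_conv)
  obtain K3 where "\<And>p x. p \<in> ?B \<times> ?B \<times> ?B \<Longrightarrow> \<bar>?D (?D (?D \<psi> (fst p)) (fst (snd p))) (snd (snd p)) x\<bar> \<le> K3"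
    using BC_family_bound[of "?B \<times> ?B \<times> ?B" "\<lambda>p. ?D (?D (?D \<psi> (fst p)) (fst (snd p))) (snd (snd p))"]
      Cb_BC[OF C3] by fastforce
  hence K3: "\<bar>?D (?D (?D \<psi> u) w) z x\<bar> \<le> K3" if "u \<in> Basis" "w \<in> Basis" "z \<in> Basis" for u w z x
    using that by (metis SigmaI fst_conv snd_conv)
  obtain u0 :: 'e where "u0 \<in> Basis" using nonempty_Basis by blast
  with K1[of u0 0] K2[of u0 u0 0] K3[of u0 u0 u0 0] have pos: "K1 \<ge> 0" "K2 \<ge> 0" "K3 \<ge> 0" by linarith+
  define n :: real where "n = DIM('e)"
  have n: "n \<ge> 1" unfolding n_def by (simp add: Suc_leI)
  \<comment> \<open>Each of the three coordinate sums in the third directional derivative costs a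
    factor \<open>n\<close>. Since \<open>n\<close> is at least 1, the same number dominates the
    Lipschitz constant \<open>n * K3\<close> of the second derivatives.\<close>
  define L where "L = n ^ 3 * K3"
  have L: "n * K3 \<le> L"
    unfolding L_def using n pos power_increasing[of 1 3 n] by (intro mult_right_mono) auto
  have taylor: "\<bar>\<psi> (x + y) - \<psi> x - (\<Sum>u\<in>Basis. ?D \<psi> u x * (y \<bullet> u))
        - (1/2) * (\<Sum>u\<in>Basis. \<Sum>w\<in>Basis. ?D (?D \<psi> u) w x * ((y \<bullet> u) * (y \<bullet> w)))\<bar> \<le> L * norm y ^ 3" for x y
  proof -
    define h0 where "h0 = (\<lambda>t. \<psi> (x + t *\<^sub>R y))"
    define h1 where "h1 = (\<lambda>t. \<Sum>u\<in>Basis. (y \<bullet> u) * ?D \<psi> u (x + t *\<^sub>R y))"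
    define h2 where "h2 = (\<lambda>t. \<Sum>u\<in>Basis. (y \<bullet> u) * (\<Sum>w\<in>Basis. (y \<bullet> w) * ?D (?D \<psi> u) w (x + t *\<^sub>R y)))"
    define h3 where "h3 = (\<lambda>t. \<Sum>u\<in>Basis. (y \<bullet> u) * (\<Sum>w\<in>Basis. (y \<bullet> w) *
       (\<Sum>z\<in>Basis. (y \<bullet> z) * ?D (?D (?D \<psi> u) w) z (x + t *\<^sub>R y))))"
    have "(h0 has_real_derivative h1 t) (at t)" for t
      unfolding h0_def h1_def by (intro has_real_derivative_line d0)
    moreover have "(h1 has_real_derivative h2 t) (at t)" for t
      unfolding h1_def h2_def
      by (intro DERIV_sum DERIV_cmult has_real_derivative_line d1)
    moreover have "(h2 has_real_derivative h3 t) (at t)" for t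
      unfolding h2_def h3_def
      by (intro DERIV_sum DERIV_cmult has_real_derivative_line d2)
    \<comment> \<open>Maclaurin expansion on the segment up to order three. The case distinction
      lists the successive derivatives along the line; its default branch is reached at index 3, and
      larger indices do not occur.\<close>
    ultimately have "\<exists>t>0. t < 1 \<and> h0 1 = (\<Sum>m<3. (case m of 0 \<Rightarrow> h0 | Suc 0 \<Rightarrow> h1 | Suc (Suc 0) \<Rightarrow> h2 | _ \<Rightarrow> h3) 0 / fact m * 1 ^ m)
        + (case (3::nat) of 0 \<Rightarrow> h0 | Suc 0 \<Rightarrow> h1 | Suc (Suc 0) \<Rightarrow> h2 | _ \<Rightarrow> h3) t / fact 3 * 1 ^ 3"
      by (intro Maclaurin) (auto simp: numeral_3_eq_3 less_Suc_eq)
    then obtain t where t: "h0 1 = h0 0 + h1 0 + h2 0 / 2 + h3 t / 6"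
      by (auto simp: numeral_3_eq_3 numeral_2_eq_2 fact_numeral)
    have "\<bar>h3 t\<bar> \<le> n * (norm y * (n * (norm y * (n * (norm y * K3)))))"
      unfolding h3_def n_def by (intro coord_sum_bound K3)
    also have "\<dots> = L * norm y ^ 3" unfolding L_def n_def by (simp add: power3_eq_cube)
    finally have "\<bar>h3 t / 6\<bar> \<le> L * norm y ^ 3" by simp
    moreover have "h0 1 = \<psi> (x + y)" "h0 0 = \<psi> x" "h1 0 = (\<Sum>u\<in>Basis. ?D \<psi> u x * (y \<bullet> u))"
      "h2 0 = (\<Sum>u\<in>Basis. \<Sum>w\<in>Basis. ?D (?D \<psi> u) w x * ((y \<bullet> u) * (y \<bullet> w)))"
      unfolding h0_def h1_def h2_def by (simp_all add: mult.commute sum_distrib_left mult.assoc)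
    ultimately show ?thesis using t by simp
  qed
  have H: "\<bar>?D (?D \<psi> u) w (x + y) - ?D (?D \<psi> u) w x\<bar> \<le> L * norm y" if "u \<in> Basis" "w \<in> Basis" for u w x y
    using lipschitz_of_bounded_derivatives[OF d2[OF that] K3[OF that], of x y] L
      mult_right_mono[of "n * K3" L "norm y"] norm_ge_zero[of y] unfolding n_def by linarith
  have "taylor_data \<psi> (?D \<psi>) (\<lambda>u. ?D (?D \<psi> u)) K2 L"
    unfolding taylor_data_def using taylor H K2 Cb_BC[OF C] Cb_BC[OF C1] Cb_BC[OF C2] by blast
  hence "tclass K2 L \<psi>" by (auto simp: tclass_def)
  moreover have "L \<ge> 0" using pos n unfolding L_def by simp
  moreover have "\<bar>\<psi> (x + y) - \<psi> x\<bar> \<le> (n * K1) * norm y" for x y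
    unfolding n_def by (rule lipschitz_of_bounded_derivatives[OF d0 K1])
  ultimately show thesis using pos n by (intro that[of K2 L "n * K1"]) auto
qed

section \<open>Linear Markov chains with Gaussian noise\<close>

abbreviation ngauss :: "real \<Rightarrow> real measure" where
  "ngauss s \<equiv> density lborel (\<lambda>x. ennreal (normal_density 0 s x))"

lemma gop_scaled:
  assumes "s > 0" "BC \<phi>"
  shows "(\<integral>z. \<phi> (x + z *\<^sub>R a) \<partial>ngauss s) = gop (s *\<^sub>R a) \<phi> x"
  unfolding gop_def distributed_scale_gauss[OF assms(1), symmetric]
  by (subst integral_distr)
     (auto intro!: measurable_compose[OF _ BC_measurable[OF assms(2)]] simp: mult.commute)

text \<open>Fubini, one coordinate at a time: integrating out coordinate \<open>i\<close> applies
  the averaging operator along \<open>s *\<^sub>R a i\<close>.\<close>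

lemma gops_PiM:
  fixes a :: "'i \<Rightarrow> 'e::euclidean_space"
  assumes s: "s > 0"
  shows "BC \<phi> \<Longrightarrow> distinct xs \<Longrightarrow> (\<integral>z. \<phi> (x + (\<Sum>i\<in>set xs. z i *\<^sub>R a i)) \<partial>PiM (set xs) (\<lambda>_. ngauss s))
     = gops (map (\<lambda>i. s *\<^sub>R a i) xs) \<phi> x"
proof (induction xs arbitrary: x \<phi>)
  case Nil
  show ?case by (simp add: PiM_empty lebesgue_integral_count_space_finite)
next
  case (Cons j xs)
  note \<phi> = Cons.prems(1)
  interpret prob_space "ngauss s" using s by (rule prob_space_normal_density)
  interpret product_prob_space "\<lambda>_. ngauss s" "set xs" ..
  interpret Pins: prob_space "PiM (insert j (set xs)) (\<lambda>_. ngauss s)"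
    by (intro prob_space_PiM) unfold_locales
  interpret Pset: prob_space "PiM (set xs) (\<lambda>_. ngauss s)"
    by (intro prob_space_PiM) unfold_locales
  have j: "j \<notin> set xs" using Cons.prems by simp
  have upd: "x + (\<Sum>i\<in>insert j (set xs). (z(j := y)) i *\<^sub>R a i) = (x + (\<Sum>i\<in>set xs. z i *\<^sub>R a i)) + y *\<^sub>R a j" for z y
  proof -
    have "(\<Sum>i\<in>set xs. (z(j := y)) i *\<^sub>R a i) = (\<Sum>i\<in>set xs. z i *\<^sub>R a i)"
      using j by (intro sum.cong) auto
    thus ?thesis using j by simp
  qed
  have "(\<integral>z. \<phi> (x + (\<Sum>i\<in>insert j (set xs). z i *\<^sub>R a i)) \<partial>PiM (insert j (set xs)) (\<lambda>_. ngauss s))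
     = (\<integral>z. \<integral>y. \<phi> (x + (\<Sum>i\<in>insert j (set xs). (z(j := y)) i *\<^sub>R a i)) \<partial>ngauss s \<partial>PiM (set xs) (\<lambda>_. ngauss s))"
    by (rule product_integral_insert) (use j in \<open>auto intro!: Pins.integrable_BC[OF \<phi>]\<close>)
  also have "\<dots> = (\<integral>z. gop (s *\<^sub>R a j) \<phi> (x + (\<Sum>i\<in>set xs. z i *\<^sub>R a i)) \<partial>PiM (set xs) (\<lambda>_. ngauss s))"
    unfolding upd using gop_scaled[OF s \<phi>] by simp
  also have "\<dots> = gops (map (\<lambda>i. s *\<^sub>R a i) xs) (gop (s *\<^sub>R a j) \<phi>) x"
    using Cons.prems \<phi> by (intro Cons.IH[of "gop (s *\<^sub>R a j) \<phi>"]) auto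
  \<comment> \<open>The coordinate \<open>j\<close> was integrated innermost, so its operator stands
    next to \<open>\<phi>\<close>; commutation moves it to the head of the list.\<close>
  also have "\<dots> = gop (s *\<^sub>R a j) (gops (map (\<lambda>i. s *\<^sub>R a i) xs) \<phi>) x"
    using gop_gops_commute[OF \<phi>] by metis
  finally show ?case by simp
qed

text \<open>Tested on boxes, where the indicator factorises and the integral over the product splits
  into one-dimensional integrals.\<close>

lemma PiM_density:
  fixes f :: "real \<Rightarrow> real"
  assumes I: "finite I" and f: "f \<in> borel_measurable borel" "\<And>x. f x \<ge> 0" and p: "prob_space (density lborel (\<lambda>x. ennreal (f x)))"
  shows "density (PiM I (\<lambda>_. lborel)) (\<lambda>z. ennreal (\<Prod>i\<in>I. f (z i))) = PiM I (\<lambda>_. density lborel (\<lambda>x. ennreal (f x)))"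
proof -
  interpret prob_space "density lborel (\<lambda>x. ennreal (f x))" by (rule p)
  interpret product_sigma_finite "\<lambda>_. density lborel (\<lambda>x. ennreal (f x))" ..
  interpret L: product_sigma_finite "\<lambda>_. lborel :: real measure" ..
  note f(1)[measurable]
  show ?thesis
  proof (rule PiM_eqI[OF I])
    fix A assume A: "\<And>i. i \<in> I \<Longrightarrow> A i \<in> sets (density lborel (\<lambda>x. ennreal (f x)))"
    have ind: "indicator (Pi\<^sub>E I A) z = (\<Prod>i\<in>I. indicator (A i) (z i) :: ennreal)" if "z \<in> space (PiM I (\<lambda>_. lborel))" for z
    proof (cases "\<forall>i\<in>I. z i \<in> A i")
      case True
      thus ?thesis using that by (auto simp: space_PiM PiE_def)
    next
      case False
      thus ?thesis using I by (subst prod_zero[OF I]) (auto simp: indicator_def)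
    qed
    have "emeasure (density (PiM I (\<lambda>_. lborel)) (\<lambda>z. ennreal (\<Prod>i\<in>I. f (z i)))) (Pi\<^sub>E I A)
       = (\<integral>\<^sup>+z. ennreal (\<Prod>i\<in>I. f (z i)) * indicator (Pi\<^sub>E I A) z \<partial>PiM I (\<lambda>_. lborel))"
      using A I by (intro emeasure_density) (auto intro!: sets_PiM_I_finite)
    also have "\<dots> = (\<integral>\<^sup>+z. (\<Prod>i\<in>I. ennreal (f (z i)) * indicator (A i) (z i)) \<partial>PiM I (\<lambda>_. lborel))"
      using f(2) by (intro nn_integral_cong) (simp add: ind prod.distrib prod_ennreal)
    also have "\<dots> = (\<Prod>i\<in>I. \<integral>\<^sup>+x. ennreal (f x) * indicator (A i) x \<partial>lborel)"
      using A I by (intro L.product_nn_integral_prod) auto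
    also have "\<dots> = (\<Prod>i\<in>I. emeasure (density lborel (\<lambda>x. ennreal (f x))) (A i))"
      using A by (intro prod.cong refl emeasure_density[symmetric]) auto
    finally show "emeasure (density (PiM I (\<lambda>_. lborel)) (\<lambda>z. ennreal (\<Prod>i\<in>I. f (z i)))) (Pi\<^sub>E I A)
      = (\<Prod>i\<in>I. emeasure (density lborel (\<lambda>x. ennreal (f x))) (A i))" .
  qed (use I in \<open>auto intro!: sets_PiM_cong\<close>)
qed

text \<open>Lebesgue measure on the vector space is the image of a product of one-dimensional ones
  under the coordinate map, so the Gaussian vector becomes a family of independent scalars to which
  \<open>gops_PiM\<close> applies. The list \<open>xs\<close> merely fixes an order of the
  basis.\<close>

lemma expectation_normal_vec:
  fixes D :: "'a \<Rightarrow> real^'m" and S :: "real^'m \<Rightarrow> 'e::euclidean_space"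
  assumes D: "distributed M lborel D (\<lambda>x. ennreal (\<Prod>i\<in>UNIV. normal_density 0 s (x $ i)))"
    and s: "s > 0" and S: "linear S" and \<phi>: "BC \<phi>" and xs: "set xs = Basis" "distinct xs"
  shows "(\<integral>w. \<phi> (x + S w) \<partial>distr M borel D) = gops (map (\<lambda>b. s *\<^sub>R S b) xs) \<phi> x"
proof -
  let ?vec = "\<lambda>f::real^'m \<Rightarrow> real. \<Sum>b\<in>Basis. f b *\<^sub>R b"
  have bl: "bounded_linear S" using S by (simp add: linear_conv_bounded_linear)
  have Sm: "S \<in> borel_measurable borel"
    using bl by (intro borel_measurable_continuous_onI linear_continuous_on)
  have dens: "(\<Prod>i\<in>UNIV. normal_density 0 s (w $ i)) = (\<Prod>b\<in>Basis. normal_density 0 s (w \<bullet> b))" for w :: "real^'m"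
  proof -
    have "(Basis :: (real^'m) set) = (\<lambda>i. axis i 1) ` UNIV" by (auto simp: Basis_vec_def)
    hence "(\<Prod>b\<in>Basis. normal_density 0 s (w \<bullet> b)) = (\<Prod>b\<in>(\<lambda>i. axis i 1) ` UNIV. normal_density 0 s (w \<bullet> b))"
      by (rule arg_cong)
    also have "\<dots> = (\<Prod>i\<in>UNIV. normal_density 0 s (w \<bullet> axis i 1))"
      by (subst prod.reindex) (auto simp: inj_on_def axis_eq_axis)
    finally show ?thesis by (simp add: inner_axis)
  qed
  have m: "(\<lambda>w. \<phi> (x + S w)) \<in> borel_measurable borel"
    using Sm by (intro measurable_compose[OF _ BC_measurable[OF \<phi>]]) measurable
  have d: "distr M borel D = density lborel (\<lambda>w. ennreal (\<Prod>b\<in>Basis. normal_density 0 s (w \<bullet> b)))"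
    using D distr_cong[of M M lborel borel D D] by (simp add: distributed_def dens)
  also have "\<dots> = distr (density (\<Pi>\<^sub>M b\<in>Basis. lborel) (\<lambda>f. ennreal (\<Prod>b\<in>Basis. normal_density 0 s (?vec f \<bullet> b)))) borel ?vec"
    by (subst lborel_eq, subst density_distr) auto
  also have "density (\<Pi>\<^sub>M b\<in>Basis. lborel) (\<lambda>f. ennreal (\<Prod>b\<in>Basis. normal_density 0 s (?vec f \<bullet> b)))
     = density (\<Pi>\<^sub>M b\<in>Basis. lborel) (\<lambda>f. ennreal (\<Prod>b\<in>Basis. normal_density 0 s (f b)))"
    by (intro arg_cong2[where f=density] refl ext arg_cong[where f=ennreal] prod.cong)
       (simp add: inner_sum_left_Basis)
  also have "\<dots> = PiM Basis (\<lambda>_. ngauss s)"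
    using s by (intro PiM_density prob_space_normal_density) auto
  finally have d: "distr M borel D = distr (PiM Basis (\<lambda>_. ngauss s)) borel ?vec" .
  have "(\<integral>w. \<phi> (x + S w) \<partial>distr M borel D) = (\<integral>f. \<phi> (x + S (?vec f)) \<partial>PiM Basis (\<lambda>_. ngauss s))"
    unfolding d using m by (intro integral_distr) measurable
  also have "\<dots> = (\<integral>f. \<phi> (x + (\<Sum>b\<in>Basis. f b *\<^sub>R S b)) \<partial>PiM Basis (\<lambda>_. ngauss s))"
    by (simp add: linear_sum[OF S] linear_cmul[OF S])
  also have "\<dots> = gops (map (\<lambda>b. s *\<^sub>R S b) xs) \<phi> x"
    using gops_PiM[OF s \<phi> xs(2), of x S] unfolding xs(1) by simp
  finally show ?thesis .
qed

text \<open>List form of the covariance recursion in which a matrix K becomes R K R^T plus the noise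
  covariance. The empty list encodes the deterministic initial value.\<close>

primrec cov_chain :: "('e \<Rightarrow> 'e) \<Rightarrow> 'e list \<Rightarrow> nat \<Rightarrow> 'e list" where
  "cov_chain R ss 0 = []"
| "cov_chain R ss (Suc n) = map R (cov_chain R ss n) @ ss"

lemma gops_linear: "linear R \<Longrightarrow> gops (map R as) \<phi> (R y) = gops as (\<lambda>y. \<phi> (R y)) y"
proof (induction as arbitrary: y)
  case (Cons a as)
  thus ?case by (simp add: gop_def linear_add[symmetric] linear_cmul[symmetric])
qed simp

text \<open>The last increment is independent of the past, so integrating it first replaces
  \<open>\<phi>\<close> by its average composed with \<open>R\<close>. The induction therefore has
  to run over all test functions.\<close>

lemma (in prob_space) linear_chain_expectation:
  fixes \<delta> :: "nat \<Rightarrow> 'a \<Rightarrow> real^'m" and X :: "nat \<Rightarrow> 'a \<Rightarrow> 'e::euclidean_space"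
  assumes indep: "\<And>n. indep_vars (\<lambda>_. borel) \<delta> {..<n}"
    and D: "\<And>n. distributed M lborel (\<delta> n) (\<lambda>x. ennreal (\<Prod>i\<in>UNIV. normal_density 0 s (x $ i)))"
    and s: "s > 0" and R: "linear R" and S: "linear S" and xs: "set xs = Basis" "distinct xs"
    and X0: "\<And>\<omega>. X 0 \<omega> = x0" and X_Suc: "\<And>n \<omega>. X (Suc n) \<omega> = R (X n \<omega>) + S (\<delta> n \<omega>)"
    and \<phi>: "BC \<phi>"
  shows "expectation (\<lambda>\<omega>. \<phi> (X n \<omega>)) = gops (cov_chain R (map (\<lambda>b. s *\<^sub>R S b) xs) n) \<phi> ((R ^^ n) x0)"
  using \<phi>
proof (induction n arbitrary: \<phi>)
  case 0
  thus ?case by (simp add: X0 prob_space)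
next
  case (Suc n)
  let ?ss = "map (\<lambda>b. s *\<^sub>R S b) xs"
  have blR: "bounded_linear R" and blS: "bounded_linear S" using R S by (simp_all add: linear_conv_bounded_linear)
  have [measurable]: "R \<in> borel_measurable borel" "S \<in> borel_measurable borel"
    using blR blS by (auto intro!: borel_measurable_continuous_onI linear_continuous_on)
  \<comment> \<open>The chain as a deterministic functional of the whole increment sequence. Since
    \<open>G n\<close> reads only the entries below \<open>n\<close>, the state is a measurable
    function of the restricted sequence, on which the independence statement for blocks of
    increments can be used.\<close>
  define G where "G = rec_nat (\<lambda>_. x0) (\<lambda>n g d. R (g d) + S (d n))"
  have G_simps: "G 0 d = x0" "G (Suc n) d = R (G n d) + S (d n)" for n d
    by (simp_all add: G_def)
  have G: "G n (\<lambda>i. \<delta> i \<omega>) = X n \<omega>" for n \<omega>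
    by (induction n) (simp_all add: G_simps X0 X_Suc)
  have G_restrict: "m \<le> n \<Longrightarrow> G m (restrict d {..<n}) = G m d" for m d
    by (induction m) (simp_all add: G_simps)
  have G_meas: "k \<le> n \<Longrightarrow> G k \<in> borel_measurable (PiM {..<n} (\<lambda>_. borel))" for k
  proof (induction k)
    case 0
    have "G 0 = (\<lambda>_. x0)" using G_simps by auto
    thus ?case by simp
  next
    case (Suc k)
    have e: "G (Suc k) = (\<lambda>d. R (G k d) + S (d k))" by (rule ext) (rule G_simps)
    have "(\<lambda>d. d k) \<in> borel_measurable (PiM {..<n} (\<lambda>_. borel))"
      using Suc.prems by (intro measurable_component_singleton) auto
    moreover have "G k \<in> borel_measurable (PiM {..<n} (\<lambda>_. borel))" using Suc by simp
    ultimately show ?case unfolding e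
      by (intro borel_measurable_add) (auto intro: measurable_compose)
  qed
  have iv: "indep_var (PiM {..<n} (\<lambda>_. borel)) (\<lambda>\<omega>. restrict (\<lambda>i. \<delta> i \<omega>) {..<n}) (PiM {n} (\<lambda>_. borel)) (\<lambda>\<omega>. restrict (\<lambda>i. \<delta> i \<omega>) {n})"
    by (rule indep_var_restrict[OF indep[of "Suc n"]]) auto
  let ?MA = "PiM {..<n} (\<lambda>_. borel :: (real^'m) measure)" and ?MB = "PiM {n} (\<lambda>_. borel :: (real^'m) measure)"
  let ?A = "\<lambda>\<omega>. restrict (\<lambda>i. \<delta> i \<omega>) {..<n}" and ?B = "\<lambda>\<omega>. restrict (\<lambda>i. \<delta> i \<omega>) {n}"
  note eq = iv[unfolded indep_var_distribution_eq]
  hence A [measurable]: "?A \<in> measurable M ?MA" and B [measurable]: "?B \<in> measurable M ?MB" by auto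
  have [measurable]: "G n \<in> borel_measurable ?MA" "(\<lambda>d. d n) \<in> borel_measurable ?MB"
    by (auto intro: G_meas measurable_component_singleton)
  have X_meas [measurable]: "X n \<in> borel_measurable M"
    using measurable_compose[OF A, of "G n" borel] by (simp add: G_restrict G)
  have \<delta>_meas [measurable]: "\<delta> n \<in> borel_measurable M"
    using measurable_compose[OF B, of "\<lambda>d. d n" borel] by simp
  interpret D1: prob_space "distr M ?MA ?A" by (rule prob_space_distr) (rule A)
  interpret D2: prob_space "distr M ?MB ?B" by (rule prob_space_distr) (rule B)
  interpret PP: pair_prob_space "distr M ?MA ?A" "distr M ?MB ?B" ..
  let ?F = "\<lambda>p. R (G n (fst p)) + S (snd p n)"
  have F [measurable]: "?F \<in> borel_measurable (?MA \<Otimes>\<^sub>M ?MB)"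
    by measurable
  have "expectation (\<lambda>\<omega>. \<phi> (X (Suc n) \<omega>)) = expectation (\<lambda>\<omega>. \<phi> (?F (?A \<omega>, ?B \<omega>)))"
    by (simp add: X_Suc G_restrict G)
  also have "\<dots> = (\<integral>p. \<phi> (?F p) \<partial>distr M (?MA \<Otimes>\<^sub>M ?MB) (\<lambda>\<omega>. (?A \<omega>, ?B \<omega>)))"
    by (intro integral_distr[symmetric] measurable_compose[OF F BC_measurable[OF Suc.prems]] measurable_Pair A B)
  also have "\<dots> = (\<integral>p. \<phi> (?F p) \<partial>(distr M ?MA ?A \<Otimes>\<^sub>M distr M ?MB ?B))"
    using eq by simp
  also have "\<dots> = (\<integral>a. \<integral>b. \<phi> (?F (a, b)) \<partial>distr M ?MB ?B \<partial>distr M ?MA ?A)"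
    by (rule PP.integral_fst'[symmetric]) (rule PP.integrable_BC[OF Suc.prems], simp cong: measurable_cong_sets)
  also have "\<dots> = (\<integral>a. \<integral>w. \<phi> (R (G n a) + S w) \<partial>distr M borel (\<delta> n) \<partial>distr M ?MA ?A)"
  proof (intro Bochner_Integration.integral_cong refl)
    fix a
    have m: "(\<lambda>w. \<phi> (R (G n a) + S w)) \<in> borel_measurable borel"
      by (intro measurable_compose[OF _ BC_measurable[OF Suc.prems]]) measurable
    have "(\<integral>b. \<phi> (?F (a, b)) \<partial>distr M ?MB ?B) = expectation (\<lambda>\<omega>. \<phi> (R (G n a) + S (\<delta> n \<omega>)))"
      by (subst integral_distr[OF B]) (auto intro!: measurable_compose[OF _ m])
    also have "\<dots> = (\<integral>w. \<phi> (R (G n a) + S w) \<partial>distr M borel (\<delta> n))"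
      by (rule integral_distr[OF \<delta>_meas m, symmetric])
    finally show "(\<integral>b. \<phi> (?F (a, b)) \<partial>distr M ?MB ?B) = (\<integral>w. \<phi> (R (G n a) + S w) \<partial>distr M borel (\<delta> n))" .
  qed
  also have "\<dots> = (\<integral>a. gops ?ss \<phi> (R (G n a)) \<partial>distr M ?MA ?A)"
    using expectation_normal_vec[OF D s S Suc.prems xs] by simp
  also have "\<dots> = expectation (\<lambda>\<omega>. gops ?ss \<phi> (R (X n \<omega>)))"
    by (subst integral_distr[OF A])
       (auto simp: G_restrict G intro!: measurable_compose[OF _ BC_measurable[OF BC_gops[OF Suc.prems]]])
  also have "\<dots> = gops (cov_chain R ?ss n) (\<lambda>x. gops ?ss \<phi> (R x)) ((R ^^ n) x0)"
    using BC_affine[OF BC_gops[OF Suc.prems] blR, of _ 0] by (intro Suc.IH) simp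
  also have "\<dots> = gops (cov_chain R ?ss (Suc n)) \<phi> ((R ^^ Suc n) x0)"
    by (simp add: gops_linear[OF R, symmetric])
  finally show ?case .
qed

section \<open>The Lyapunov equation\<close>

text \<open>The adjoint of the Lyapunov operator taking a matrix K to B K + K B^T; equivalently the
  time derivative at 0 of \<open>\<beta>\<close> evaluated along the flow of \<open>B\<close> in
  both arguments.\<close>

definition lyap :: "('e::real_vector \<Rightarrow> 'e) \<Rightarrow> ('e \<Rightarrow> 'e \<Rightarrow> real) \<Rightarrow> 'e \<Rightarrow> 'e \<Rightarrow> real" where
  "lyap B \<beta> = (\<lambda>x y. \<beta> (B x) y + \<beta> x (B y))"

lemma bilinear_lin_comb:
  fixes \<beta> \<gamma> :: "'e::real_vector \<Rightarrow> 'e \<Rightarrow> real"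
  shows "bilinear \<beta> \<Longrightarrow> bilinear \<gamma> \<Longrightarrow> bilinear (\<lambda>x y. \<beta> x y + c * \<gamma> x y)"
  unfolding bilinear_def linear_iff by (simp add: algebra_simps)

lemma bilinear_comp:
  "bilinear \<beta> \<Longrightarrow> linear f \<Longrightarrow> linear g \<Longrightarrow> bilinear (\<lambda>x y. \<beta> (f x) (g y))"
  unfolding bilinear_def linear_iff by simp

lemma bilinear_lyap:
  fixes \<beta> :: "'e::real_vector \<Rightarrow> 'e \<Rightarrow> real"
  assumes "linear B" "bilinear \<beta>" shows "bilinear (lyap B \<beta>)"
  using bilinear_lin_comb[OF bilinear_comp[OF assms(2) assms(1) linear_id] bilinear_comp[OF assms(2) linear_id assms(1)], of 1]
  by (simp add: lyap_def)

lemma cov_lin_comb: "cov as (\<lambda>x y. \<beta> x y + c * \<gamma> x y) = cov as \<beta> + c * cov as \<gamma>"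
  by (induction as) (simp_all add: algebra_simps)

lemma cov_map: "cov (map f as) \<beta> = cov as (\<lambda>x y. \<beta> (f x) (f y))"
  by (induction as) simp_all

lemma cov_bound:
  assumes "\<And>a. a \<in> set as \<Longrightarrow> \<bar>\<beta> a a\<bar> \<le> k * m a"
  shows "\<bar>cov as \<beta>\<bar> \<le> k * sum_list (map m as)"
  using assms
proof (induction as)
  case (Cons a as)
  have "\<bar>\<beta> a a\<bar> \<le> k * m a" "\<bar>cov as \<beta>\<bar> \<le> k * sum_list (map m as)" using Cons by auto
  thus ?case by (simp add: algebra_simps)
qed simp

text \<open>An adapted inner product in which the flow of \<open>B\<close> decays at rate
  \<open>lam\<close>. The Euclidean norm would not do for the Langevin drift, whose friction acts on
  the momentum alone; there the decay becomes visible only after mixing position and momentum in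
  \<open>V\<close>.\<close>

locale lyapunov =
  fixes B :: "'e::euclidean_space \<Rightarrow> 'e" and V :: "'e \<Rightarrow> 'e \<Rightarrow> real" and lam v0 :: real
  assumes B: "linear B" and V: "bilinear V" and V_sym: "V x y = V y x"
    and v0: "v0 > 0" and V_coercive: "v0 * (norm x)\<^sup>2 \<le> V x x"
    and lam: "lam > 0" and dissipative: "V x (B x) \<le> - lam * V x x"
begin

definition N :: "'e \<Rightarrow> real" where "N x = sqrt (V x x)"

lemma V_nonneg: "V x x \<ge> 0"
  using V_coercive[of x] v0 by (meson mult_nonneg_nonneg less_imp_le zero_le_power2 order_trans)

lemma N_nonneg [simp]: "N x \<ge> 0"
  by (simp add: N_def V_nonneg)

lemma N_sq: "(N x)\<^sup>2 = V x x"
  by (simp add: N_def V_nonneg)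

text \<open>Operator norm of a form relative to \<open>N\<close> rather than to the Euclidean norm:
  if \<open>R\<close> contracts \<open>N\<close>, then substituting \<open>R\<close> into both
  arguments contracts this bound.\<close>

definition bnd :: "('e \<Rightarrow> 'e \<Rightarrow> real) \<Rightarrow> real \<Rightarrow> bool" where
  "bnd \<beta> k \<longleftrightarrow> (\<forall>x y. \<bar>\<beta> x y\<bar> \<le> k * (N x * N y))"

lemma norm_le_N: "norm x \<le> N x / sqrt v0"
proof -
  have "sqrt v0 * norm x = sqrt (v0 * (norm x)\<^sup>2)" by (simp add: real_sqrt_mult)
  also have "\<dots> \<le> N x" unfolding N_def using V_coercive by (rule real_sqrt_le_mono)
  finally show ?thesis using v0 by (simp add: field_simps)
qed

lemma V_bound: obtains v1 where "v1 > 0" "\<And>x y. \<bar>V x y\<bar> \<le> v1 * (norm x * norm y)"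
proof -
  from bilinear_bounded_pos[OF V] obtain v1 where "v1 > 0" "\<forall>x y. norm (V x y) \<le> v1 * norm x * norm y" by blast
  thus thesis by (intro that[of v1]) (auto simp: mult.assoc)
qed

lemma N_le_norm: obtains n1 where "n1 > 0" "\<And>x. N x \<le> n1 * norm x"
proof -
  obtain v1 where v1: "v1 > 0" "\<And>x y. \<bar>V x y\<bar> \<le> v1 * (norm x * norm y)" using V_bound by blast
  have "N x \<le> sqrt v1 * norm x" for x
  proof -
    have "V x x \<le> v1 * (norm x)\<^sup>2" using v1(2)[of x x] by (simp add: power2_eq_square)
    hence "N x \<le> sqrt (v1 * (norm x)\<^sup>2)" unfolding N_def by (rule real_sqrt_le_mono)
    thus ?thesis by (simp add: real_sqrt_mult)
  qed
  with v1 show thesis by (intro that[of "sqrt v1"]) auto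
qed

lemma bnd_norm: "\<exists>c>0.
  (\<forall>\<beta> K. K \<ge> 0 \<longrightarrow> (\<forall>x y. \<bar>\<beta> x y\<bar> \<le> K * (norm x * norm y)) \<longrightarrow> bnd \<beta> (c * K)) \<and>
  (\<forall>\<beta> k. k \<ge> 0 \<longrightarrow> bnd \<beta> k \<longrightarrow> (\<forall>x y. \<bar>\<beta> x y\<bar> \<le> c * k * (norm x * norm y)))"
proof -
  obtain n1 where n1: "n1 > 0" "\<And>x. N x \<le> n1 * norm x" using N_le_norm by blast
  define c where "c = max (1 / v0) (n1\<^sup>2)"
  have c: "c \<ge> 1 / v0" "c \<ge> n1\<^sup>2" "c > 0" unfolding c_def using v0 by (auto simp: less_max_iff_disj)
  show ?thesis
  proof (intro exI[of _ c] conjI allI impI c(3))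
    fix \<beta> :: "'e \<Rightarrow> 'e \<Rightarrow> real" and K :: real assume K: "K \<ge> 0" "\<forall>x y. \<bar>\<beta> x y\<bar> \<le> K * (norm x * norm y)"
    show "bnd \<beta> (c * K)" unfolding bnd_def
    proof (intro allI)
      fix x y
      have "norm x * norm y \<le> (N x / sqrt v0) * (N y / sqrt v0)"
        by (intro mult_mono norm_le_N) (auto simp: v0 less_imp_le)
      also have "\<dots> = (1 / v0) * (N x * N y)" using v0 by simp
      also have "\<dots> \<le> c * (N x * N y)" using c by (intro mult_right_mono) auto
      finally have "K * (norm x * norm y) \<le> K * (c * (N x * N y))" using K by (intro mult_left_mono) auto
      thus "\<bar>\<beta> x y\<bar> \<le> c * K * (N x * N y)" using K(2)[rule_format, of x y] by (simp add: mult_ac)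
    qed
  next
    fix \<beta> :: "'e \<Rightarrow> 'e \<Rightarrow> real" and k :: real and x y assume k: "k \<ge> 0" "bnd \<beta> k"
    have "N x * N y \<le> (n1 * norm x) * (n1 * norm y)"
      using n1 by (intro mult_mono) auto
    also have "\<dots> = n1\<^sup>2 * (norm x * norm y)" by (simp add: power2_eq_square)
    also have "\<dots> \<le> c * (norm x * norm y)" using c by (intro mult_right_mono) auto
    finally have "k * (N x * N y) \<le> k * (c * (norm x * norm y))" using k by (intro mult_left_mono) auto
    thus "\<bar>\<beta> x y\<bar> \<le> c * k * (norm x * norm y)" using k(2) unfolding bnd_def
      by (metis (no_types, lifting) mult.assoc mult.commute order_trans)
  qed
qed

lemma bnd_bilinear: assumes "bilinear \<beta>" obtains k where "k \<ge> 0" "bnd \<beta> k"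
proof -
  obtain c where c: "c > 0" "\<forall>\<beta> K. K \<ge> 0 \<longrightarrow> (\<forall>x y. \<bar>\<beta> x y\<bar> \<le> K * (norm x * norm y)) \<longrightarrow> bnd \<beta> (c * K)"
    using bnd_norm by blast
  obtain K where K: "K > 0" "\<And>x y. \<bar>\<beta> x y\<bar> \<le> K * (norm x * norm y)"
    using bilinear_bounded_pos[OF assms] unfolding real_norm_def mult.assoc by blast
  show thesis using c(2)[rule_format, of K \<beta>] K c(1) by (intro that[of "c * K"]) auto
qed

lemma norm_B: obtains b where "b > 0" "\<And>x. norm (B x) \<le> b * norm x"
  using linear_bounded_pos[OF B] by blast

text \<open>Expanding \<open>V (R x) (R x)\<close> gives the factor 1 - 2 \<open>lam\<close> h up to
  order h^2; for small h half of the decay absorbs the quadratic terms. The threshold is uniform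
  over all maps close to 1 + h B, so that it covers the Euler step as well as the scheme.\<close>

lemma N_contraction:
  "\<exists>h0>0. lam * h0 \<le> 1 \<and>
    (\<forall>h R. 0 < h \<longrightarrow> h \<le> h0 \<longrightarrow> (\<forall>x. norm (R x - x - h *\<^sub>R B x) \<le> \<kappa> * h\<^sup>2 * norm x) \<longrightarrow>
        (\<forall>x. N (R x) \<le> (1 - lam / 2 * h) * N x))"
proof -
  obtain v1 where v1: "v1 > 0" "\<And>x y. \<bar>V x y\<bar> \<le> v1 * (norm x * norm y)" using V_bound by blast
  obtain b where b: "b > 0" "\<And>x. norm (B x) \<le> b * norm x" using norm_B by blast
  define \<kappa>' where "\<kappa>' = max \<kappa> 0"
  \<comment> \<open>Collects the terms of order h^2 for h at most 1: \<open>V (B x) (B x)\<close>,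
    twice the cross term with the error \<open>e\<close>, and \<open>V e e\<close>. Division by
    \<open>v0\<close> converts the squared Euclidean norm into \<open>V x x\<close>. The parameter
    \<open>\<kappa>\<close> carries no sign, hence \<open>\<kappa>'\<close>.\<close>
  define c where "c = v1 * (b\<^sup>2 + 2 * (1 + b) * \<kappa>' + \<kappa>'\<^sup>2) / v0"
  have c: "c \<ge> 0" unfolding c_def using v1 b v0 by (auto simp: \<kappa>'_def)
  \<comment> \<open>The three entries simplify powers of h, keep the contraction factor nonnegative,
    and let \<open>lam\<close> absorb \<open>c\<close>; the summand 1 in \<open>c + 1\<close> covers
    the case that \<open>c\<close> vanishes.\<close>
  define h0 where "h0 = min 1 (min (1 / lam) (lam / (c + 1)))"
  have h0: "h0 > 0" "h0 \<le> 1" "lam * h0 \<le> 1" "h0 * c \<le> lam"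
  proof -
    show "h0 > 0" "h0 \<le> 1" unfolding h0_def using lam c by auto
    have "h0 \<le> 1 / lam" "h0 \<le> lam / (c + 1)" unfolding h0_def by auto
    thus "lam * h0 \<le> 1" "h0 * c \<le> lam" using lam c \<open>h0 > 0\<close> by (auto simp: field_simps)
  qed
  show ?thesis
  proof (intro exI[of _ h0] conjI allI impI h0)
    fix h R and x :: 'e assume h: "0 < h" "h \<le> h0" and R: "\<forall>x. norm (R x - x - h *\<^sub>R B x) \<le> \<kappa> * h\<^sup>2 * norm x"
    define e where "e = R x - x - h *\<^sub>R B x"
    define n where "n = norm x"
    have h1: "h \<le> 1" using h h0 by linarith
    have e: "norm e \<le> \<kappa>' * h\<^sup>2 * n"
      using R[rule_format, of x] mult_right_mono[of \<kappa> \<kappa>' "h\<^sup>2 * norm x"] unfolding e_def n_def \<kappa>'_def by (simp add: mult.assoc)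
    have k0: "\<kappa>' \<ge> 0" and n0: "n \<ge> 0" by (auto simp: \<kappa>'_def n_def)
    have Rx: "R x = x + h *\<^sub>R B x + e" by (simp add: e_def)
    have "V (R x) (R x) = V x x + 2 * h * V x (B x) + h\<^sup>2 * V (B x) (B x) + 2 * V (x + h *\<^sub>R B x) e + V e e"
      unfolding Rx using V_sym[of "B x" x] V_sym[of e x] V_sym[of e "B x"]
      by (simp add: bilinear_ladd[OF V] bilinear_radd[OF V] bilinear_lmul[OF V] bilinear_rmul[OF V] algebra_simps power2_eq_square)
    moreover have "h\<^sup>2 * V (B x) (B x) \<le> h\<^sup>2 * (v1 * b\<^sup>2 * n\<^sup>2)"
    proof (intro mult_left_mono)
      have "\<bar>V (B x) (B x)\<bar> \<le> v1 * ((b * n) * (b * n))"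
        using b by (intro order.trans[OF v1(2)] mult_left_mono mult_mono) (auto simp: n_def v1 less_imp_le)
      thus "V (B x) (B x) \<le> v1 * b\<^sup>2 * n\<^sup>2" by (simp add: power2_eq_square mult_ac)
    qed auto
    moreover have "V (x + h *\<^sub>R B x) e \<le> h\<^sup>2 * (v1 * ((1 + b) * \<kappa>') * n\<^sup>2)"
    proof -
      have "norm (x + h *\<^sub>R B x) \<le> n + h * (b * n)"
        using b h by (intro norm_triangle_le add_mono) (auto simp: n_def)
      also have "\<dots> \<le> (1 + b) * n"
        using h1 h b n0 mult_right_mono[of h 1 "b * n"] by (simp add: algebra_simps)
      finally have "\<bar>V (x + h *\<^sub>R B x) e\<bar> \<le> v1 * (((1 + b) * n) * (\<kappa>' * h\<^sup>2 * n))"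
        using e v1 by (intro order.trans[OF v1(2)] mult_left_mono mult_mono) (auto simp: less_imp_le b k0 n0)
      thus ?thesis by (simp add: power2_eq_square mult_ac)
    qed
    moreover have "V e e \<le> h\<^sup>2 * (v1 * \<kappa>'\<^sup>2 * n\<^sup>2)"
    proof -
      have "\<kappa>' * h\<^sup>2 * n \<le> \<kappa>' * h * n" using h h1 k0 n0
        by (intro mult_right_mono mult_left_mono) (auto simp: power2_eq_square mult_le_cancel_left1)
      hence "\<bar>V e e\<bar> \<le> v1 * ((\<kappa>' * h * n) * (\<kappa>' * h * n))"
        using e v1 h by (intro order.trans[OF v1(2)] mult_left_mono mult_mono) (auto simp: less_imp_le k0 n0)
      thus ?thesis by (simp add: power2_eq_square mult_ac)
    qed
    moreover have "2 * h * V x (B x) \<le> - (2 * h * lam * V x x)"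
      using mult_left_mono[OF dissipative[of x], of "2 * h"] h by simp
    ultimately have "V (R x) (R x) \<le> V x x - 2 * h * lam * V x x + h\<^sup>2 * (v1 * (b\<^sup>2 + 2 * (1 + b) * \<kappa>' + \<kappa>'\<^sup>2) * n\<^sup>2)"
      by (simp add: algebra_simps)
    also have "v1 * (b\<^sup>2 + 2 * (1 + b) * \<kappa>' + \<kappa>'\<^sup>2) * n\<^sup>2 = c * (v0 * n\<^sup>2)" unfolding c_def using v0 by simp
    also have "h\<^sup>2 * (c * (v0 * n\<^sup>2)) \<le> h\<^sup>2 * (c * V x x)"
      unfolding n_def by (intro mult_left_mono V_coercive c) auto
    also have "\<dots> \<le> h * (lam * V x x)"
    proof -
      have "h * c \<le> lam" using h0 h c by (meson mult_right_mono order_trans)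
      thus ?thesis unfolding power2_eq_square mult.assoc using h V_nonneg
        by (intro mult_left_mono) (auto simp: mult.assoc[symmetric] intro!: mult_right_mono)
    qed
    also have "V x x - 2 * h * lam * V x x + h * (lam * V x x) = (1 - lam * h) * V x x"
      by (simp add: algebra_simps)
    also have "\<dots> \<le> (1 - lam / 2 * h)\<^sup>2 * V x x"
      using V_nonneg h lam by (intro mult_right_mono) (simp_all add: power2_eq_square algebra_simps)
    finally have "V (R x) (R x) \<le> ((1 - lam / 2 * h) * N x)\<^sup>2" by (simp add: power_mult_distrib N_sq)
    moreover have "lam * h \<le> 1" using h0(3) mult_left_mono[OF h(2), of lam] lam by linarith
    hence "0 \<le> (1 - lam / 2 * h) * N x" by (intro mult_nonneg_nonneg) auto
    ultimately show "N (R x) \<le> (1 - lam / 2 * h) * N x"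
      unfolding N_def[of "R x"] by (rule real_le_lsqrt[rotated])
  qed
qed

text \<open>The last clause is the weak form of B K + K B^T + (noise covariance) = 0, with
  \<open>C\<close> in the role of K. Linearity is demanded on bilinear forms only, since the series
  that produces \<open>C\<close> is controlled only there.\<close>

definition stationary_cov :: "(('e \<Rightarrow> 'e \<Rightarrow> real) \<Rightarrow> real) \<Rightarrow> real \<Rightarrow> 'e list \<Rightarrow> bool" where
  "stationary_cov C k0 ss \<longleftrightarrow>
    (\<forall>\<beta> \<gamma> c. bilinear \<beta> \<longrightarrow> bilinear \<gamma> \<longrightarrow> C (\<lambda>x y. \<beta> x y + c * \<gamma> x y) = C \<beta> + c * C \<gamma>) \<and> k0 \<ge> 0 \<and>
    (\<forall>\<beta> k. bilinear \<beta> \<longrightarrow> k \<ge> 0 \<longrightarrow> bnd \<beta> k \<longrightarrow> \<bar>C \<beta>\<bar> \<le> k0 * k) \<and>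
    (\<forall>\<beta>. bilinear \<beta> \<longrightarrow> C (lyap B \<beta>) = - cov ss \<beta>)"

text \<open>Instead of integrating over the flow of \<open>B\<close>, a Neumann series is summed:
  with \<open>T\<close> equal to 1 + \<tau> times the Lyapunov operator, C = \<tau> times the sum of
  the covariances of the iterates of \<open>T\<close>. Shifting the summation index gives C(T
  \<beta>) - C(\<beta>) = - \<tau> cov(\<beta>), which is the equation.\<close>

lemma stationary_cov_exists: "\<exists>C k0. stationary_cov C k0 ss"
proof -
  obtain h0 where h0: "h0 > 0" "lam * h0 \<le> 1" and contr:
    "\<forall>h R. 0 < h \<longrightarrow> h \<le> h0 \<longrightarrow> (\<forall>x. norm (R x - x - h *\<^sub>R B x) \<le> 0 * h\<^sup>2 * norm x) \<longrightarrow>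
        (\<forall>x. N (R x) \<le> (1 - lam / 2 * h) * N x)"
    using N_contraction[of 0] by blast
  obtain b where b: "b > 0" "\<And>x. N (B x) \<le> b * N x"
  proof -
    obtain n1 where n1: "n1 > 0" "\<And>x. N x \<le> n1 * norm x" using N_le_norm by metis
    obtain b where b: "b > 0" "\<And>x. norm (B x) \<le> b * norm x" using norm_B by metis
    have "N (B x) \<le> (n1 * b / sqrt v0) * N x" for x
    proof -
      have "N (B x) \<le> n1 * (b * norm x)" using n1 b by (meson mult_left_mono less_imp_le order_trans)
      also have "\<dots> \<le> n1 * (b * (N x / sqrt v0))"
        using n1 b norm_le_N by (intro mult_left_mono) auto
      finally show ?thesis by simp
    qed
    thus thesis using n1 b v0 by (intro that[of "n1 * b / sqrt v0"]) auto
  qed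
  \<comment> \<open>Here \<open>b\<close> bounds \<open>B\<close> in the norm \<open>N\<close>. The
    second entry limits the correction \<tau>^2 b^2 to \<tau> \<open>lam\<close> / 4, half of the
    decay \<open>lam\<close> \<tau> / 2 of the Euler step; what is left is the rate in
    \<open>\<rho>\<close>.\<close>
  define \<tau> where "\<tau> = min h0 (lam / (4 * b\<^sup>2))"
  have \<tau>: "\<tau> > 0" "\<tau> \<le> h0" "\<tau> * b\<^sup>2 \<le> lam / 4"
  proof -
    show "\<tau> > 0" "\<tau> \<le> h0" unfolding \<tau>_def using h0 lam b by auto
    have "\<tau> \<le> lam / (4 * b\<^sup>2)" unfolding \<tau>_def by simp
    thus "\<tau> * b\<^sup>2 \<le> lam / 4" using b by (simp add: field_simps)
  qed
  have lt: "lam * \<tau> \<le> 1" using \<tau> h0 lam by (meson mult_left_mono less_imp_le order_trans)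
  define \<rho> where "\<rho> = 1 - lam / 4 * \<tau>"
  have \<rho>: "0 \<le> \<rho>" "\<rho> < 1" unfolding \<rho>_def using lt lam \<tau> by auto
  define T where "T = (\<lambda>\<beta> x y. \<beta> x y + \<tau> * lyap B \<beta> x y)"
  have T_bil: "bilinear (T \<beta>)" if "bilinear \<beta>" for \<beta>
    unfolding T_def using that by (intro bilinear_lin_comb bilinear_lyap B)
  have T_bnd: "bnd (T \<beta>) (\<rho> * k)" if \<beta>: "bilinear \<beta>" "bnd \<beta> k" "k \<ge> 0" for \<beta> k
    unfolding bnd_def
  proof (intro allI)
    fix x y
    have Nx: "N (x + \<tau> *\<^sub>R B x) \<le> (1 - lam / 2 * \<tau>) * N x" for x
      using contr[rule_format, OF \<tau>(1,2), of "\<lambda>x. x + \<tau> *\<^sub>R B x"] by simp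
    \<comment> \<open>Completing the product: \<open>T\<close> is substitution of the Euler step
      into both arguments minus a term of order \<tau>^2, so the contraction of the Euler step
      carries over.\<close>
    have "T \<beta> x y = \<beta> (x + \<tau> *\<^sub>R B x) (y + \<tau> *\<^sub>R B y) - \<tau>\<^sup>2 * \<beta> (B x) (B y)"
      using \<beta>(1) by (simp add: T_def lyap_def bilinear_ladd bilinear_radd bilinear_lmul bilinear_rmul algebra_simps power2_eq_square)
    also have "\<bar>\<dots>\<bar> \<le> \<bar>\<beta> (x + \<tau> *\<^sub>R B x) (y + \<tau> *\<^sub>R B y)\<bar> + \<tau>\<^sup>2 * \<bar>\<beta> (B x) (B y)\<bar>"
      using abs_triangle_ineq4[of "\<beta> (x + \<tau> *\<^sub>R B x) (y + \<tau> *\<^sub>R B y)" "\<tau>\<^sup>2 * \<beta> (B x) (B y)"] by (simp add: abs_mult)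
    also have "\<dots> \<le> k * (N (x + \<tau> *\<^sub>R B x) * N (y + \<tau> *\<^sub>R B y)) + \<tau>\<^sup>2 * (k * (N (B x) * N (B y)))"
      using \<beta>(2) unfolding bnd_def by (intro add_mono mult_left_mono) auto
    also have "\<dots> \<le> k * (((1 - lam / 2 * \<tau>) * N x) * ((1 - lam / 2 * \<tau>) * N y)) + \<tau>\<^sup>2 * (k * ((b * N x) * (b * N y)))"
      using b Nx \<beta>(3) lt by (intro add_mono mult_left_mono mult_mono) auto
    also have "\<dots> = ((1 - lam / 2 * \<tau>)\<^sup>2 + \<tau> * (\<tau> * b\<^sup>2)) * (k * (N x * N y))"
      by (simp add: algebra_simps power2_eq_square)
    also have "\<dots> \<le> \<rho> * (k * (N x * N y))"
    proof (intro mult_right_mono)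
      have "(1 - lam / 2 * \<tau>)\<^sup>2 \<le> 1 - lam / 2 * \<tau>"
        using lt lam \<tau> mult_left_le[of "1 - lam / 2 * \<tau>" "1 - lam / 2 * \<tau>"] by (simp add: power2_eq_square)
      moreover have "\<tau> * (\<tau> * b\<^sup>2) \<le> \<tau> * (lam / 4)" using \<tau> by (intro mult_left_mono) auto
      ultimately show "(1 - lam / 2 * \<tau>)\<^sup>2 + \<tau> * (\<tau> * b\<^sup>2) \<le> \<rho>"
        unfolding \<rho>_def by (simp add: algebra_simps)
    qed (use \<beta>(3) in auto)
    finally show "\<bar>T \<beta> x y\<bar> \<le> \<rho> * k * (N x * N y)" by (simp add: mult.assoc)
  qed
  have pow_bil: "bilinear ((T ^^ n) \<beta>)" if "bilinear \<beta>" for \<beta> n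
    using that by (induction n) (auto intro: T_bil)
  have pow_bnd: "bnd ((T ^^ n) \<beta>) (\<rho> ^ n * k)" if "bilinear \<beta>" "bnd \<beta> k" "k \<ge> 0" for \<beta> n k
  proof (induction n)
    case (Suc n)
    from T_bnd[OF pow_bil[OF that(1)] Suc.IH] \<rho> that show ?case by (simp add: mult.assoc)
  qed (use that in simp)
  have pow_lin: "(T ^^ n) (\<lambda>x y. \<beta> x y + c * \<gamma> x y) = (\<lambda>x y. (T ^^ n) \<beta> x y + c * (T ^^ n) \<gamma> x y)" for n \<beta> \<gamma> c
    by (induction n) (simp_all add: T_def lyap_def algebra_simps fun_eq_iff)
  define d where "d = sum_list (map (\<lambda>a. N a * N a) ss)"
  have d: "d \<ge> 0" unfolding d_def by (intro sum_list_nonneg) auto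
  have cov_pow: "\<bar>cov ss ((T ^^ n) \<beta>)\<bar> \<le> d * k * \<rho> ^ n" if "bilinear \<beta>" "bnd \<beta> k" "k \<ge> 0" for \<beta> n k
  proof -
    have "\<bar>cov ss ((T ^^ n) \<beta>)\<bar> \<le> (\<rho> ^ n * k) * d"
      unfolding d_def using pow_bnd[OF that, of n] by (intro cov_bound) (auto simp: bnd_def)
    thus ?thesis by (simp add: mult_ac)
  qed
  have geo: "summable (\<lambda>n. c * \<rho> ^ n)" for c :: real
    using \<rho> by (intro summable_mult summable_geometric) auto
  have summ: "summable (\<lambda>n. cov ss ((T ^^ n) \<beta>))" if \<beta>: "bilinear \<beta>" for \<beta>
  proof -
    obtain k where k: "k \<ge> 0" "bnd \<beta> k" using bnd_bilinear[OF \<beta>] by metis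
    thus ?thesis using cov_pow[OF \<beta> k(2,1)]
      by (intro summable_comparison_test'[OF geo[of "d * k"], of 0]) auto
  qed
  define C where "C = (\<lambda>\<beta>. \<tau> * (\<Sum>n. cov ss ((T ^^ n) \<beta>)))"
  have C_lin: "C (\<lambda>x y. \<beta> x y + c * \<gamma> x y) = C \<beta> + c * C \<gamma>" if "bilinear \<beta>" "bilinear \<gamma>" for \<beta> \<gamma> c
    unfolding C_def pow_lin cov_lin_comb
    by (subst suminf_add[symmetric], rule summ[OF that(1)], rule summable_mult[OF summ[OF that(2)]],
        subst suminf_mult, rule summ[OF that(2)]) (simp add: algebra_simps)
  have C_bnd: "\<bar>C \<beta>\<bar> \<le> (\<tau> * d / (1 - \<rho>)) * k" if \<beta>: "bilinear \<beta>" "k \<ge> 0" "bnd \<beta> k" for \<beta> k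
  proof -
    have s: "summable (\<lambda>n. \<bar>cov ss ((T ^^ n) \<beta>)\<bar>)"
      using cov_pow[OF \<beta>(1,3,2)] by (intro summable_comparison_test'[OF geo[of "d * k"], of 0]) auto
    have "\<bar>\<Sum>n. cov ss ((T ^^ n) \<beta>)\<bar> \<le> (\<Sum>n. \<bar>cov ss ((T ^^ n) \<beta>)\<bar>)" by (rule summable_rabs[OF s])
    also have "\<dots> \<le> (\<Sum>n. d * k * \<rho> ^ n)" by (intro suminf_le cov_pow \<beta> s geo)
    also have "\<dots> = d * k / (1 - \<rho>)" using \<rho> by (subst suminf_mult) (auto simp: suminf_geometric)
    finally have "\<tau> * \<bar>\<Sum>n. cov ss ((T ^^ n) \<beta>)\<bar> \<le> \<tau> * (d * k / (1 - \<rho>))" using \<tau> by (intro mult_left_mono) auto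
    thus ?thesis unfolding C_def using \<tau> by (simp add: abs_mult mult_ac)
  qed
  have C_lyap: "C (lyap B \<beta>) = - cov ss \<beta>" if \<beta>: "bilinear \<beta>" for \<beta>
  proof -
    have "C (T \<beta>) = C \<beta> - \<tau> * cov ss \<beta>"
    proof -
      have "(\<Sum>n. cov ss ((T ^^ n) (T \<beta>))) = (\<Sum>n. cov ss ((T ^^ n) \<beta>)) - cov ss \<beta>"
        using suminf_split_head[OF summ[OF \<beta>]] by (simp add: funpow_swap1)
      thus ?thesis unfolding C_def by (simp add: right_diff_distrib)
    qed
    moreover have "C (T \<beta>) = C \<beta> + \<tau> * C (lyap B \<beta>)"
      unfolding T_def by (rule C_lin[OF \<beta> bilinear_lyap[OF B \<beta>]])
    ultimately have "\<tau> * C (lyap B \<beta>) = \<tau> * (- cov ss \<beta>)" by simp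
    thus ?thesis using \<tau>(1) by (simp only: mult_cancel_left) simp
  qed
  show ?thesis unfolding stationary_cov_def
    by (intro exI[of _ C] exI[of _ "\<tau> * d / (1 - \<rho>)"]) (use C_lin C_bnd C_lyap \<tau> d \<rho> in auto)
qed

section \<open>Covariance recursion and local defects\<close>

definition cov_close :: "(('e \<Rightarrow> 'e \<Rightarrow> real) \<Rightarrow> real) \<Rightarrow> real \<Rightarrow> 'e list \<Rightarrow> bool" where
  "cov_close C \<delta> as \<longleftrightarrow> (\<forall>\<beta> k. bilinear \<beta> \<longrightarrow> k \<ge> 0 \<longrightarrow> bnd \<beta> k \<longrightarrow> \<bar>cov as \<beta> - C \<beta>\<bar> \<le> \<delta> * k)"

text \<open>The residual left when the covariance of the continuous equation is inserted into one
  step of the discrete recursion, tested against forms.\<close>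

definition local_defect :: "(('e \<Rightarrow> 'e \<Rightarrow> real) \<Rightarrow> real) \<Rightarrow> real \<Rightarrow> ('e \<Rightarrow> 'e) \<Rightarrow> 'e list \<Rightarrow> bool" where
  "local_defect C l R ss \<longleftrightarrow> (\<forall>\<beta> k. bilinear \<beta> \<longrightarrow> k \<ge> 0 \<longrightarrow> bnd \<beta> k \<longrightarrow>
     \<bar>C (\<lambda>x y. \<beta> (R x) (R y)) + cov ss \<beta> - C \<beta>\<bar> \<le> l * k)"

text \<open>The distance to \<open>C\<close> obeys d' \<le> \<rho> d + l, with d \<le>
  \<open>k0\<close> at the start because the initial covariance is zero; summing the geometric
  series gives the claim.\<close>

lemma cov_chain_close:
  assumes C: "stationary_cov C k0 ss0" and R: "linear R" "\<And>x. N (R x) \<le> \<rho> * N x"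
    and \<rho>: "0 \<le> \<rho>" "\<rho> < 1" and loc: "local_defect C l R ss"
  shows "cov_close C (\<rho> ^ n * k0 + l / (1 - \<rho>)) (cov_chain R ss n)"
  unfolding cov_close_def
proof (induction n)
  case 0
  have "\<bar>C \<beta>\<bar> \<le> (k0 + l / (1 - \<rho>)) * k" if \<beta>: "bilinear \<beta>" "k \<ge> 0" "bnd \<beta> k" for \<beta> k
  proof -
    have "0 \<le> l * k" using loc \<beta> unfolding local_defect_def by (meson abs_ge_zero order_trans)
    hence "0 \<le> l * k / (1 - \<rho>)" using \<rho> by simp
    moreover have "\<bar>C \<beta>\<bar> \<le> k0 * k" using C \<beta> by (simp add: stationary_cov_def)
    ultimately show ?thesis by (simp add: algebra_simps)
  qed
  thus ?case by simp
next
  case (Suc n)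
  show ?case
  proof (intro allI impI)
    fix \<beta> k assume \<beta>: "bilinear \<beta>" "k \<ge> 0" "bnd \<beta> k"
    let ?\<beta>R = "\<lambda>x y. \<beta> (R x) (R y)"
    have "bnd ?\<beta>R (\<rho> * k)" unfolding bnd_def
    proof (intro allI)
      fix x y
      have "\<bar>\<beta> (R x) (R y)\<bar> \<le> k * (N (R x) * N (R y))" using \<beta> by (simp add: bnd_def)
      also have "\<dots> \<le> k * ((\<rho> * N x) * (\<rho> * N y))"
        using R \<rho> \<beta> by (intro mult_left_mono mult_mono) auto
      also have "\<dots> = \<rho> * (\<rho> * (k * (N x * N y)))" by (simp add: mult_ac)
      \<comment> \<open>Substitution into both arguments contracts by \<rho>^2; keeping a single
        factor is enough and makes the accumulated defect exactly l / (1 - \<rho>).\<close>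
      also have "\<dots> \<le> \<rho> * (1 * (k * (N x * N y)))"
        using \<rho> \<beta> by (intro mult_left_mono mult_right_mono) auto
      finally show "\<bar>\<beta> (R x) (R y)\<bar> \<le> \<rho> * k * (N x * N y)" by (simp add: mult.assoc)
    qed
    hence 1: "\<bar>cov (cov_chain R ss n) ?\<beta>R - C ?\<beta>R\<bar> \<le> (\<rho> ^ n * k0 + l / (1 - \<rho>)) * (\<rho> * k)"
      using Suc.IH \<beta> \<rho> R by (simp add: bilinear_comp)
    have 2: "\<bar>C ?\<beta>R + cov ss \<beta> - C \<beta>\<bar> \<le> l * k" using loc \<beta> by (simp add: local_defect_def)
    have "\<bar>cov (cov_chain R ss (Suc n)) \<beta> - C \<beta>\<bar> \<le> (\<rho> ^ n * k0 + l / (1 - \<rho>)) * (\<rho> * k) + l * k"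
      using 1 2 by (simp add: cov_map)
    also have "\<dots> = (\<rho> ^ Suc n * k0 + l / (1 - \<rho>)) * k"
      using \<rho> by (simp add: field_simps)
    finally show "\<bar>cov (cov_chain R ss (Suc n)) \<beta> - C \<beta>\<bar> \<le> (\<rho> ^ Suc n * k0 + l / (1 - \<rho>)) * k" .
  qed
qed

text \<open>Substituting 1 + \<tau> B into \<open>\<beta>\<close> gives \<open>\<beta>\<close>, the
  Lyapunov term and \<tau>^2 \<open>\<beta> (B x) (B y)\<close>, without further remainder. The
  terms of order \<tau> cancel against the noise by the equation for \<open>C\<close>.\<close>

lemma euler_local_defect:
  assumes C: "stationary_cov C k0 (map S0 xs)"
  shows "\<exists>c\<ge>0. \<forall>\<tau>>0. local_defect C (c * \<tau>\<^sup>2) (\<lambda>x. x + \<tau> *\<^sub>R B x) (map (\<lambda>b. sqrt \<tau> *\<^sub>R S0 b) xs)"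
proof -
  obtain cN where cN: "cN > 0"
    "\<And>\<beta> K. K \<ge> 0 \<Longrightarrow> (\<forall>x y. \<bar>\<beta> x y\<bar> \<le> K * (norm x * norm y)) \<Longrightarrow> bnd \<beta> (cN * K)"
    "\<And>\<beta> k x y. k \<ge> 0 \<Longrightarrow> bnd \<beta> k \<Longrightarrow> \<bar>\<beta> x y\<bar> \<le> cN * k * (norm x * norm y)"
    using bnd_norm by metis
  obtain b where b: "b > 0" "\<And>x. norm (B x) \<le> b * norm x" using norm_B by metis
  have k0: "k0 \<ge> 0" using C by (simp add: stationary_cov_def)
  define c where "c = k0 * (cN * (cN * b\<^sup>2))"
  show ?thesis
  proof (intro exI[of _ c] conjI allI impI)
    show "c \<ge> 0" unfolding c_def using k0 cN b by simp
    fix \<tau> :: real assume \<tau>: "\<tau> > 0"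
    show "local_defect C (c * \<tau>\<^sup>2) (\<lambda>x. x + \<tau> *\<^sub>R B x) (map (\<lambda>b. sqrt \<tau> *\<^sub>R S0 b) xs)"
      unfolding local_defect_def
    proof (intro allI impI)
      fix \<beta> k assume \<beta>: "bilinear \<beta>" "k \<ge> 0" "bnd \<beta> k"
      note bl = bilinear_ladd[OF \<beta>(1)] bilinear_radd[OF \<beta>(1)] bilinear_lmul[OF \<beta>(1)] bilinear_rmul[OF \<beta>(1)]
      let ?BB = "\<lambda>x y. \<beta> (B x) (B y)"
      have bb: "bilinear ?BB" by (rule bilinear_comp[OF \<beta>(1) B B])
      have bl1: "bilinear (lyap B \<beta>)" by (intro bilinear_lyap \<beta> B)
      have "bnd ?BB (cN * (cN * k * b\<^sup>2))"
      proof (rule cN(2))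
        show "\<forall>x y. \<bar>\<beta> (B x) (B y)\<bar> \<le> cN * k * b\<^sup>2 * (norm x * norm y)"
        proof (intro allI)
          fix x y
          have "\<bar>\<beta> (B x) (B y)\<bar> \<le> cN * k * (norm (B x) * norm (B y))" using cN \<beta> by auto
          also have "\<dots> \<le> cN * k * ((b * norm x) * (b * norm y))"
            using cN \<beta> b by (intro mult_left_mono mult_mono) auto
          finally show "\<bar>\<beta> (B x) (B y)\<bar> \<le> cN * k * b\<^sup>2 * (norm x * norm y)"
            by (simp add: power2_eq_square mult_ac)
        qed
      qed (use cN \<beta> in auto)
      hence "\<bar>C ?BB\<bar> \<le> k0 * (cN * (cN * k * b\<^sup>2))"
        using C bb cN \<beta> by (simp add: stationary_cov_def)
      from mult_left_mono[OF this, of "\<tau>\<^sup>2"] have 1: "\<bar>\<tau>\<^sup>2 * C ?BB\<bar> \<le> c * \<tau>\<^sup>2 * k"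
        unfolding abs_mult c_def by (simp add: mult_ac)
      have "(\<lambda>x y. \<beta> (x + \<tau> *\<^sub>R B x) (y + \<tau> *\<^sub>R B y)) = (\<lambda>x y. (\<beta> x y + \<tau> * lyap B \<beta> x y) + \<tau>\<^sup>2 * ?BB x y)"
        by (simp add: bl lyap_def fun_eq_iff algebra_simps power2_eq_square)
      hence "C (\<lambda>x y. \<beta> (x + \<tau> *\<^sub>R B x) (y + \<tau> *\<^sub>R B y)) = C \<beta> + \<tau> * C (lyap B \<beta>) + \<tau>\<^sup>2 * C ?BB"
        using C bilinear_lin_comb[OF \<beta>(1) bl1, of \<tau>] \<beta> bb bl1 by (simp add: stationary_cov_def)
      moreover have "C (lyap B \<beta>) = - cov (map S0 xs) \<beta>" using C \<beta> by (simp add: stationary_cov_def)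
      moreover have "cov (map (\<lambda>b. sqrt \<tau> *\<^sub>R S0 b) xs) \<beta> = \<tau> * cov (map S0 xs) \<beta>"
      proof -
        have "sqrt \<tau> * (sqrt \<tau> * z) = \<tau> * z" for z using \<tau> by (simp flip: mult.assoc)
        thus ?thesis by (induction xs) (simp_all add: bl distrib_left)
      qed
      ultimately show "\<bar>C (\<lambda>x y. \<beta> (x + \<tau> *\<^sub>R B x) (y + \<tau> *\<^sub>R B y)) + cov (map (\<lambda>b. sqrt \<tau> *\<^sub>R S0 b) xs) \<beta> - C \<beta>\<bar> \<le> c * \<tau>\<^sup>2 * k"
        using 1 by simp
    qed
  qed
qed

text \<open>Write L for the Lyapunov operator. Substituting \<open>R\<close> gives 1 + h L + (h^2/2)
  L^2 up to h^3, and the equation for \<open>C\<close> applied to \<beta> and to L \<beta> turns the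
  two corrections into noise covariances. The noise map 1 + (h/2) B produces exactly these terms, h
  cov(\<beta>) + (h^2/2) cov(L \<beta>), up to h^3: the first two terms of the covariance that the
  equation accumulates over one step.\<close>

lemma second_order_local_defect:
  assumes C: "stationary_cov C k0 (map S0 xs)" and \<kappa>: "\<kappa> \<ge> 0"
  shows "\<exists>c\<ge>0. \<forall>h R S. 0 < h \<longrightarrow> h \<le> 1 \<longrightarrow> linear R \<longrightarrow>
    (\<forall>x. norm (R x - (x + h *\<^sub>R B x + (h\<^sup>2 / 2) *\<^sub>R B (B x))) \<le> \<kappa> * h ^ 3 * norm x) \<longrightarrow>
    (\<forall>b\<in>set xs. norm (S b - (S0 b + (h / 2) *\<^sub>R B (S0 b))) \<le> \<kappa> * h\<^sup>2) \<longrightarrow>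
    local_defect C (c * h ^ 3) R (map (\<lambda>b. sqrt h *\<^sub>R S b) xs)"
proof -
  obtain cN where cN: "cN > 0"
    "\<And>\<beta> K. K \<ge> 0 \<Longrightarrow> (\<forall>x y. \<bar>\<beta> x y\<bar> \<le> K * (norm x * norm y)) \<Longrightarrow> bnd \<beta> (cN * K)"
    "\<And>\<beta> k x y. k \<ge> 0 \<Longrightarrow> bnd \<beta> k \<Longrightarrow> \<bar>\<beta> x y\<bar> \<le> cN * k * (norm x * norm y)"
    using bnd_norm by metis
  obtain b where b: "b > 0" "\<And>x. norm (B x) \<le> b * norm x" using norm_B by metis
  have k0: "k0 \<ge> 0" using C by (simp add: stationary_cov_def)
  define t where "t = 1 + b + b * b"
  have t: "t \<ge> 0" unfolding t_def using b by simp
  define c1 where "c1 = \<kappa> * (t + \<kappa>) + t * \<kappa> + b * (b * b) + (b * b) * (b * b)"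
  have c1: "c1 \<ge> 0" unfolding c1_def using \<kappa> t b by simp
  \<comment> \<open>Bound, up to the factor \<open>K\<close> h^2, for what a noise vector of length
    \<open>s\<close> leaves over after its terms of order 0 and 1 in h are removed.\<close>
  define q where "q s = \<kappa> * ((1 + b) * s + \<kappa>) + (1 + b) * s * \<kappa> + (b * s) * (b * s)" for s
  define c2 where "c2 = (\<Sum>b\<leftarrow>xs. q (norm (S0 b)))"
  have q: "q s \<ge> 0" if "s \<ge> 0" for s unfolding q_def using \<kappa> b that by simp
  have c2: "c2 \<ge> 0" unfolding c2_def by (intro sum_list_nonneg) (auto intro!: q)
  define c where "c = k0 * (cN * (cN * c1)) + cN * c2"
  show ?thesis
  proof (intro exI[of _ c] conjI allI impI)
    show "c \<ge> 0" unfolding c_def using k0 cN c1 c2 by simp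
    fix h :: real and R :: "'e \<Rightarrow> 'e" and S
    assume h: "0 < h" "h \<le> 1" and R: "linear R"
      and R2: "\<forall>x. norm (R x - (x + h *\<^sub>R B x + (h\<^sup>2 / 2) *\<^sub>R B (B x))) \<le> \<kappa> * h ^ 3 * norm x"
      and S: "\<forall>b\<in>set xs. norm (S b - (S0 b + (h / 2) *\<^sub>R B (S0 b))) \<le> \<kappa> * h\<^sup>2"
    have hp: "h\<^sup>2 \<le> 1" "h ^ 3 \<le> 1" "h ^ 4 \<le> h ^ 3" using h by (auto intro: power_le_one power_decreasing)
    have h4: "\<bar>h ^ 4\<bar> / \<bar>4\<bar> \<le> h ^ 3"
    proof -
      have "\<bar>h ^ 4\<bar> = h ^ 4" "0 \<le> h ^ 4" using h by auto
      thus ?thesis using hp(3) by linarith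
    qed
    show "local_defect C (c * h ^ 3) R (map (\<lambda>b. sqrt h *\<^sub>R S b) xs)"
      unfolding local_defect_def
    proof (intro allI impI)
      fix \<beta> k assume \<beta>: "bilinear \<beta>" "k \<ge> 0" "bnd \<beta> k"
      note bl = bilinear_ladd[OF \<beta>(1)] bilinear_radd[OF \<beta>(1)] bilinear_lmul[OF \<beta>(1)] bilinear_rmul[OF \<beta>(1)]
      note Bl = linear_add[OF B] linear_cmul[OF B]
      define K where "K = cN * k"
      have K: "K \<ge> 0" "\<bar>\<beta> x y\<bar> \<le> K * (norm x * norm y)" for x y
        unfolding K_def using cN \<beta> by auto
      have K': "\<bar>\<beta> x y\<bar> \<le> K * (a * a')" if "norm x \<le> a" "norm y \<le> a'" for x y a a'
      proof -
        have "norm x * norm y \<le> a * a'" using that by (intro mult_mono) (auto intro: order_trans[OF norm_ge_zero])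
        thus ?thesis using K by (meson mult_left_mono order_trans)
      qed
      define T where "T x = x + h *\<^sub>R B x + (h\<^sup>2 / 2) *\<^sub>R B (B x)" for x
      define e where "e x = R x - T x" for x
      have RT: "R x = T x + e x" for x by (simp add: e_def)
      have nBB: "norm (B (B x)) \<le> (b * b) * norm x" for x
        using order_trans[OF b(2)[of "B x"] mult_left_mono[OF b(2)[of x], of b]] b(1) by (simp add: mult.assoc)
      have nT: "norm (T x) \<le> t * norm x" for x
      proof -
        have "norm (T x) \<le> norm x + h * norm (B x) + (h\<^sup>2 / 2) * norm (B (B x))"
          unfolding T_def using h by (intro norm_triangle_le add_mono) auto
        also have "\<dots> \<le> norm x + 1 * (b * norm x) + 1 * ((b * b) * norm x)"
          using h hp b nBB by (intro add_mono mult_mono) auto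
        finally show ?thesis by (simp add: t_def algebra_simps)
      qed
      have ne: "norm (e x) \<le> h ^ 3 * (\<kappa> * norm x)" for x
        using R2 unfolding e_def T_def by (simp add: mult_ac)
      have nR: "norm (R x) \<le> (t + \<kappa>) * norm x" for x
      proof -
        have "norm (R x) \<le> t * norm x + h ^ 3 * (\<kappa> * norm x)"
          unfolding RT by (intro norm_triangle_le add_mono nT ne)
        also have "\<dots> \<le> t * norm x + 1 * (\<kappa> * norm x)"
          using hp \<kappa> by (intro add_mono mult_right_mono) auto
        finally show ?thesis by (simp add: algebra_simps)
      qed
      define rem where "rem = (\<lambda>x y. ((\<beta> (R x) (R y) + (-1) * \<beta> x y) + (-h) * lyap B \<beta> x y) + (-(h\<^sup>2/2)) * lyap B (lyap B \<beta>) x y)"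
      have bl1: "bilinear (lyap B \<beta>)" "bilinear (lyap B (lyap B \<beta>))" by (intro bilinear_lyap \<beta> B)+
      have blr: "bilinear rem" unfolding rem_def
        by (intro bilinear_lin_comb bl1 bilinear_comp[OF \<beta>(1) R R] \<beta>(1))
      \<comment> \<open>The product of two second-order polynomials in h B matches 1 + h L + (h^2/2)
        L^2 through order h^2; left over are the mixed terms of orders h^3 and h^4 and the errors
        \<open>e\<close> of \<open>R\<close>.\<close>
      have rem_eq: "rem x y = \<beta> (e x) (R y) + \<beta> (T x) (e y) + h ^ 3 / 2 * (\<beta> (B x) (B (B y)) + \<beta> (B (B x)) (B y))
          + h ^ 4 / 4 * \<beta> (B (B x)) (B (B y))" for x y
      proof -
        have "\<beta> (R x) (R y) = \<beta> (e x) (R y) + \<beta> (T x) (e y) + \<beta> (T x) (T y)"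
          unfolding RT by (simp add: bl)
        thus ?thesis unfolding rem_def lyap_def T_def
          by (simp add: bl Bl algebra_simps power2_eq_square power3_eq_cube power4_eq_xxxx)
      qed
      have rem_le: "\<bar>rem x y\<bar> \<le> (K * c1 * h ^ 3) * (norm x * norm y)" for x y
      proof -
        have "\<bar>\<beta> (e x) (R y)\<bar> \<le> K * ((h ^ 3 * (\<kappa> * norm x)) * ((t + \<kappa>) * norm y))" by (intro K' ne nR)
        moreover have "\<bar>\<beta> (T x) (e y)\<bar> \<le> K * ((t * norm x) * (h ^ 3 * (\<kappa> * norm y)))" by (intro K' ne nT)
        moreover have "\<bar>h ^ 3 / 2 * (\<beta> (B x) (B (B y)) + \<beta> (B (B x)) (B y))\<bar>
            \<le> h ^ 3 / 2 * (K * ((b * norm x) * ((b * b) * norm y)) + K * (((b * b) * norm x) * (b * norm y)))"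
          unfolding abs_mult using h
          by (intro mult_mono order_trans[OF abs_triangle_ineq] add_mono K' b nBB) auto
        moreover have "\<bar>h ^ 4 / 4 * \<beta> (B (B x)) (B (B y))\<bar> \<le> h ^ 3 * (K * (((b * b) * norm x) * ((b * b) * norm y)))"
          unfolding abs_mult abs_divide using h h4 by (intro mult_mono K' nBB) auto
        ultimately have "\<bar>rem x y\<bar> \<le> K * ((h ^ 3 * (\<kappa> * norm x)) * ((t + \<kappa>) * norm y)) + K * ((t * norm x) * (h ^ 3 * (\<kappa> * norm y)))
           + h ^ 3 / 2 * (K * ((b * norm x) * ((b * b) * norm y)) + K * (((b * b) * norm x) * (b * norm y)))
           + h ^ 3 * (K * (((b * b) * norm x) * ((b * b) * norm y)))"
          unfolding rem_eq by linarith
        also have "\<dots> = (K * c1 * h ^ 3) * (norm x * norm y)"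
          unfolding c1_def by (simp add: algebra_simps)
        finally show ?thesis .
      qed
      have "bnd rem (cN * (K * c1 * h ^ 3))"
        using rem_le K c1 h by (intro cN(2)) auto
      hence Crem: "\<bar>C rem\<bar> \<le> k0 * (cN * (K * c1 * h ^ 3))"
        using C blr cN K c1 h by (simp add: stationary_cov_def)
      have CR: "C (\<lambda>x y. \<beta> (R x) (R y)) = C \<beta> + h * C (lyap B \<beta>) + (h\<^sup>2/2) * C (lyap B (lyap B \<beta>)) + C rem"
      proof -
        have Clin: "C (\<lambda>x y. \<beta> x y + c * \<gamma> x y) = C \<beta> + c * C \<gamma>" if "bilinear \<beta>" "bilinear \<gamma>" for \<beta> \<gamma> c
          using C that by (simp add: stationary_cov_def)
        note b1 = bilinear_lin_comb[OF \<beta>(1) bl1(1), of h]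
        note b2 = bilinear_lin_comb[OF b1 bl1(2), of "h\<^sup>2/2"]
        have "(\<lambda>x y. \<beta> (R x) (R y)) = (\<lambda>x y. ((\<beta> x y + h * lyap B \<beta> x y) + (h\<^sup>2/2) * lyap B (lyap B \<beta>) x y) + 1 * rem x y)"
          by (simp add: rem_def)
        thus ?thesis
          by (simp only: Clin[OF b2 blr] Clin[OF b1 bl1(2)] Clin[OF \<beta>(1) bl1(1)])
      qed
      have CL: "C (lyap B \<beta>) = - cov (map S0 xs) \<beta>" "C (lyap B (lyap B \<beta>)) = - cov (map S0 xs) (lyap B \<beta>)"
        using C \<beta> bl1 by (simp_all add: stationary_cov_def)
      \<comment> \<open>The covariance is additive over the noise directions, so one direction at a
        time is expanded. The scale \<open>sqrt h\<close> contributes the factor h that lifts the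
        error h^2 of a direction to h^3.\<close>
      have noise: "\<bar>cov (map (\<lambda>b. sqrt h *\<^sub>R S b) xs) \<beta> - h * cov (map S0 xs) \<beta> - (h\<^sup>2/2) * cov (map S0 xs) (lyap B \<beta>)\<bar>
          \<le> (K * h ^ 3) * c2"
        unfolding c2_def using S
      proof (induction xs)
        case (Cons a xs)
        define s where "s = S0 a"
        define f where "f = S a - (s + (h / 2) *\<^sub>R B s)"
        have f: "norm f \<le> \<kappa> * h\<^sup>2" and f': "norm f \<le> \<kappa>" using Cons.prems hp \<kappa> mult_left_mono[OF hp(1) \<kappa>]
          unfolding f_def s_def by auto
        have Sa: "S a = (s + (h / 2) *\<^sub>R B s) + f" by (simp add: f_def)
        have n1: "norm (s + (h / 2) *\<^sub>R B s) \<le> (1 + b) * norm s"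
        proof -
          have "norm (s + (h / 2) *\<^sub>R B s) \<le> norm s + (h / 2) * norm (B s)"
            using h by (intro norm_triangle_le add_mono) auto
          also have "\<dots> \<le> norm s + 1 * (b * norm s)" using h b by (intro add_mono mult_mono) auto
          finally show ?thesis by (simp add: algebra_simps)
        qed
        have n2: "norm (S a) \<le> (1 + b) * norm s + \<kappa>" unfolding Sa by (intro norm_triangle_le add_mono n1 f')
        have "\<beta> (S a) (S a) - \<beta> s s - (h / 2) * lyap B \<beta> s s
           = \<beta> f (S a) + \<beta> (s + (h / 2) *\<^sub>R B s) f + h\<^sup>2 / 4 * \<beta> (B s) (B s)"
          unfolding Sa lyap_def by (simp add: bl algebra_simps power2_eq_square)
        moreover have "\<bar>\<beta> f (S a)\<bar> \<le> K * ((\<kappa> * h\<^sup>2) * ((1 + b) * norm s + \<kappa>))" by (intro K' f n2)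
        moreover have "\<bar>\<beta> (s + (h / 2) *\<^sub>R B s) f\<bar> \<le> K * (((1 + b) * norm s) * (\<kappa> * h\<^sup>2))" by (intro K' f n1)
        moreover have "\<bar>h\<^sup>2 / 4 * \<beta> (B s) (B s)\<bar> \<le> h\<^sup>2 * (K * ((b * norm s) * (b * norm s)))"
          unfolding abs_mult by (intro mult_mono K' b) auto
        ultimately have "\<bar>\<beta> (S a) (S a) - \<beta> s s - (h / 2) * lyap B \<beta> s s\<bar> \<le>
           K * ((\<kappa> * h\<^sup>2) * ((1 + b) * norm s + \<kappa>)) + K * (((1 + b) * norm s) * (\<kappa> * h\<^sup>2)) + h\<^sup>2 * (K * ((b * norm s) * (b * norm s)))"
          by linarith
        also have "\<dots> = K * h\<^sup>2 * q (norm s)" unfolding q_def by (simp add: algebra_simps)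
        finally have "\<bar>h * (\<beta> (S a) (S a) - \<beta> s s - (h / 2) * lyap B \<beta> s s)\<bar> \<le> h * (K * h\<^sup>2 * q (norm s))"
          unfolding abs_mult using h by (intro mult_mono) auto
        also have "\<dots> = K * h ^ 3 * q (norm s)" by (simp add: power2_eq_square power3_eq_cube mult_ac)
        finally have step: "\<bar>h * (\<beta> (S a) (S a) - \<beta> s s - (h / 2) * lyap B \<beta> s s)\<bar> \<le> K * h ^ 3 * q (norm s)" .
        have IH: "\<bar>cov (map (\<lambda>b. sqrt h *\<^sub>R S b) xs) \<beta> - h * cov (map S0 xs) \<beta> - (h\<^sup>2/2) * cov (map S0 xs) (lyap B \<beta>)\<bar>
          \<le> (K * h ^ 3) * (\<Sum>b\<leftarrow>xs. q (norm (S0 b)))"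
          using Cons by simp
        have sq: "sqrt h * (sqrt h * z) = h * z" for z using h by (simp flip: mult.assoc)
        have "cov (map (\<lambda>b. sqrt h *\<^sub>R S b) (a # xs)) \<beta> - h * cov (map S0 (a # xs)) \<beta> - (h\<^sup>2/2) * cov (map S0 (a # xs)) (lyap B \<beta>)
          = h * (\<beta> (S a) (S a) - \<beta> s s - (h / 2) * lyap B \<beta> s s) +
            (cov (map (\<lambda>b. sqrt h *\<^sub>R S b) xs) \<beta> - h * cov (map S0 xs) \<beta> - (h\<^sup>2/2) * cov (map S0 xs) (lyap B \<beta>))"
          by (simp add: bl sq s_def algebra_simps power2_eq_square)
        also have "\<bar>\<dots>\<bar> \<le> K * h ^ 3 * q (norm s) + (K * h ^ 3) * (\<Sum>b\<leftarrow>xs. q (norm (S0 b)))"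
          using step IH by linarith
        finally show ?case by (simp add: s_def algebra_simps)
      qed simp
      have "C (\<lambda>x y. \<beta> (R x) (R y)) + cov (map (\<lambda>b. sqrt h *\<^sub>R S b) xs) \<beta> - C \<beta> =
        C rem + (cov (map (\<lambda>b. sqrt h *\<^sub>R S b) xs) \<beta> - h * cov (map S0 xs) \<beta> - (h\<^sup>2/2) * cov (map S0 xs) (lyap B \<beta>))"
        unfolding CR CL by simp
      also have "\<bar>\<dots>\<bar> \<le> k0 * (cN * (K * c1 * h ^ 3)) + (K * h ^ 3) * c2"
        using Crem noise by linarith
      also have "\<dots> = c * h ^ 3 * k" unfolding c_def K_def by (simp add: algebra_simps)
      finally show "\<bar>C (\<lambda>x y. \<beta> (R x) (R y)) + cov (map (\<lambda>b. sqrt h *\<^sub>R S b) xs) \<beta> - C \<beta>\<bar> \<le> c * h ^ 3 * k" .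
    qed
  qed
qed

end

section \<open>Linear integral equations and the Euler method\<close>

lemma integral_exp_scaled:
  fixes c t :: real
  assumes "c > 0" "t \<ge> 0"
  shows "((\<lambda>s. exp (c * s)) has_integral (exp (c * t) - 1) / c) {0..t}"
proof -
  have "((\<lambda>s. exp (c * s)) has_integral (exp (c * t) / c - exp (c * 0) / c)) {0..t}"
    using assms by (intro fundamental_theorem_of_calculus)
      (auto intro!: derivative_eq_intros simp flip: has_real_derivative_iff_has_vector_derivative)
  thus ?thesis by (simp add: diff_divide_distrib)
qed

text \<open>With additive noise the equation is solved path by path for a forcing \<open>g\<close>
  that is merely continuous; the solution is the Picard series of iterated integrals of
  \<open>g\<close>.\<close>

lemma linear_ivp_exists:
  fixes B :: "'e::euclidean_space \<Rightarrow> 'e" and g :: "real \<Rightarrow> 'e"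
  assumes B: "linear B" and g: "continuous_on {0..} g"
  shows "\<exists>x. continuous_on {0..} x \<and> (\<forall>t\<ge>0. x t = g t + integral {0..t} (\<lambda>s. B (x s)))"
proof -
  obtain b where b: "b > 0" "\<And>x. norm (B x) \<le> b * norm x" using linear_bounded_pos[OF B] by blast
  have bl: "bounded_linear B" using B by (simp add: linear_conv_bounded_linear)
  define Y where "Y = rec_nat g (\<lambda>_ y t. integral {0..t} (\<lambda>s. B (y s)))"
  have Y0: "Y 0 = g" and YS: "Y (Suc k) = (\<lambda>t. integral {0..t} (\<lambda>s. B (Y k s)))" for k
    by (simp_all add: Y_def)
  have cont: "continuous_on {0..T} (Y k)" for k T
  proof (induction k arbitrary: T)
    case 0
    show ?case unfolding Y0 by (rule continuous_on_subset[OF g]) auto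
  next
    case (Suc k)
    show ?case unfolding YS
      by (rule indefinite_integral_continuous_1[OF integrable_continuous_real[OF bounded_linear.continuous_on[OF bl Suc]]])
  qed
  have BY: "continuous_on {0..t} (\<lambda>s. B (Y k s))" for k t
    by (rule bounded_linear.continuous_on[OF bl cont])
  define S where "S n t = (\<Sum>k<n. Y k t)" for n t
  have cS: "continuous_on {0..T} (S n)" for n T
    unfolding S_def by (intro continuous_on_sum cont)
  have S_rec: "S (Suc n) t = g t + integral {0..t} (\<lambda>s. B (S n s))" for n t
  proof -
    have "S (Suc n) t = g t + (\<Sum>k<n. integral {0..t} (\<lambda>s. B (Y k s)))"
      unfolding S_def sum.lessThan_Suc_shift by (simp add: Y0 YS)
    also have "(\<Sum>k<n. integral {0..t} (\<lambda>s. B (Y k s))) = integral {0..t} (\<lambda>s. \<Sum>k<n. B (Y k s))"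
      by (intro integral_sum[symmetric] integrable_continuous_real BY) auto
    finally show ?thesis by (simp add: S_def linear_sum[OF B])
  qed
  define x where "x t = (\<Sum>k. Y k t)" for t
  have unif: "uniform_limit {0..T} S x sequentially" for T
  proof -
    have "compact (g ` {0..T})" using g by (intro compact_continuous_image) (auto intro: continuous_on_subset)
    then obtain M0 where "\<forall>y\<in>g ` {0..T}. norm y \<le> M0" using compact_imp_bounded bounded_iff by metis
    hence M0: "\<And>t. t \<in> {0..T} \<Longrightarrow> norm (g t) \<le> M0" by auto
    define M where "M = max M0 0"
    \<comment> \<open>The exponential weight makes every integration gain a factor 1/2, because
      \<open>b\<close> times the integral of \<open>exp (2 * b * s)\<close> is at most
      \<open>exp (2 * b * t) / 2\<close>. The series thus converges on every bounded interval at
      once, with no smallness of \<open>T\<close>.\<close>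
    have bd: "norm (Y k t) \<le> M * (1/2) ^ k * exp (2 * b * t)" if "t \<in> {0..T}" for k t
      using that
    proof (induction k arbitrary: t)
      case 0
      have "norm (g t) \<le> M * 1" using M0[OF 0] by (simp add: M_def)
      also have "\<dots> \<le> M * exp (2 * b * t)" using 0 b by (intro mult_left_mono) (auto simp: M_def)
      finally show ?case by (simp add: Y0)
    next
      case (Suc k)
      let ?e = "\<lambda>s. (b * M * (1/2) ^ k) * exp (2 * b * s)"
      have I: "(?e has_integral (b * M * (1/2) ^ k) * ((exp (2 * b * t) - 1) / (2 * b))) {0..t}"
        using b Suc.prems by (intro has_integral_mult_right integral_exp_scaled) auto
      have "norm (Y (Suc k) t) \<le> integral {0..t} ?e"
        unfolding YS
      proof (rule integral_norm_bound_integral)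
        fix s assume s: "s \<in> {0..t}"
        have "norm (B (Y k s)) \<le> b * norm (Y k s)" by (rule b)
        also have "\<dots> \<le> b * (M * (1/2) ^ k * exp (2 * b * s))"
          using s Suc b by (intro mult_left_mono) auto
        finally show "norm (B (Y k s)) \<le> ?e s" by (simp add: mult_ac)
      qed (use I in \<open>auto intro!: integrable_continuous_real BY simp: has_integral_integrable\<close>)
      also have "\<dots> = M * (1/2) ^ Suc k * (exp (2 * b * t) - 1)"
        unfolding integral_unique[OF I] using b by simp
      also have "\<dots> \<le> M * (1/2) ^ Suc k * exp (2 * b * t)"
        by (intro mult_left_mono) (auto simp: M_def)
      finally show ?case .
    qed
    have "norm (Y k t) \<le> (M * exp (2 * b * T)) * (1/2) ^ k" if "t \<in> {0..T}" for k t
    proof -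
      have "M * (1/2) ^ k * exp (2 * b * t) \<le> M * (1/2) ^ k * exp (2 * b * T)"
        using that b by (intro mult_left_mono) (auto simp: M_def)
      thus ?thesis using bd[OF that, of k] by (simp add: mult_ac)
    qed
    moreover have "summable (\<lambda>k. (M * exp (2 * b * T)) * (1/2::real) ^ k)"
      by (intro summable_mult summable_geometric) auto
    ultimately show ?thesis unfolding S_def x_def
      by (intro Weierstrass_m_test) auto
  qed
  have cx: "continuous_on {0..T} x" for T
    by (rule uniform_limit_theorem[OF _ unif]) (simp_all add: cS)
  have eq: "x t = g t + integral {0..t} (\<lambda>s. B (x s))" if "t \<ge> 0" for t
  proof -
    have "uniform_limit {0..t} (\<lambda>n s. B (S n s)) (\<lambda>s. B (x s)) sequentially"
      by (rule bounded_linear.uniform_limit[OF bl unif])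
    then obtain I J where IJ: "\<And>n. ((\<lambda>s. B (S n s)) has_integral I n) {0..t}" "((\<lambda>s. B (x s)) has_integral J) {0..t}" "I \<longlonglongrightarrow> J"
      by (rule uniform_limit_integral) (auto intro!: bounded_linear.continuous_on[OF bl cS])
    have "(\<lambda>n. S (Suc n) t) \<longlonglongrightarrow> g t + J"
      unfolding S_rec using IJ by (auto intro!: tendsto_intros simp: integral_unique[OF IJ(1)])
    moreover have "(\<lambda>n. S n t) \<longlonglongrightarrow> x t" using tendsto_uniform_limitI[OF unif[of t], of t] that by auto
    ultimately have "x t = g t + J" using LIMSEQ_unique[OF LIMSEQ_Suc] by blast
    thus ?thesis using integral_unique[OF IJ(2)] by simp
  qed
  have "continuous_on {0..} x"
    unfolding continuous_on_eq_continuous_within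
  proof
    fix t :: real assume t: "t \<in> {0..}"
    have "continuous (at t within {0..t + 1}) x" using cx[of "t + 1"] t by (auto simp: continuous_on_eq_continuous_within)
    moreover have "at t within {0..t + 1} = at t within {0..}"
      using t by (intro at_within_nhd[of t "{..<t + 1}"]) auto
    ultimately show "continuous (at t within {0..}) x" by (simp add: continuous_within)
  qed
  thus ?thesis using eq by blast
qed

text \<open>The increments of \<open>g\<close> enter exactly. With a shifted Wiener path as
  \<open>g\<close> this is the Euler-Maruyama method, hence a linear Gaussian chain to which
  \<open>wiener_chain_expectation\<close> applies.\<close>

primrec euler :: "('e::real_vector \<Rightarrow> 'e) \<Rightarrow> (real \<Rightarrow> 'e) \<Rightarrow> real \<Rightarrow> nat \<Rightarrow> 'e" where
  "euler B g \<tau> 0 = g 0"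
| "euler B g \<tau> (Suc k) = euler B g \<tau> k + \<tau> *\<^sub>R B (euler B g \<tau> k) + (g (real (Suc k) * \<tau>) - g (real k * \<tau>))"

lemma euler_error:
  fixes B :: "'e::euclidean_space \<Rightarrow> 'e" and g :: "real \<Rightarrow> 'e"
  assumes B: "linear B" and b: "b \<ge> 0" "\<And>x. norm (B x) \<le> b * norm x" and \<tau>: "\<tau> \<ge> 0" and \<epsilon>: "\<epsilon> \<ge> 0"
    and cx: "continuous_on {0..} x" and x: "\<And>t. t \<ge> 0 \<Longrightarrow> x t = g t + integral {0..t} (\<lambda>s. B (x s))"
    and osc: "\<And>k s. k < n \<Longrightarrow> s \<in> {real k * \<tau>..real (Suc k) * \<tau>} \<Longrightarrow> norm (x s - x (real k * \<tau>)) \<le> \<epsilon>"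
  shows "k \<le> n \<Longrightarrow> norm (x (real k * \<tau>) - euler B g \<tau> k) \<le> real k * \<tau> * b * \<epsilon> * (1 + \<tau> * b) ^ k"
proof (induction k)
  case 0
  show ?case using x[of 0] by simp
next
  case (Suc k)
  have bl: "bounded_linear B" using B by (simp add: linear_conv_bounded_linear)
  define s0 s1 where "s0 = real k * \<tau>" and "s1 = real (Suc k) * \<tau>"
  have s: "0 \<le> s0" "s0 \<le> s1" "s1 - s0 = \<tau>" unfolding s0_def s1_def using \<tau> by (auto simp: algebra_simps)
  have cBx: "continuous_on {a..c} (\<lambda>s. B (x s))" if "a \<ge> 0" for a c
    using that by (intro bounded_linear.continuous_on[OF bl] continuous_on_subset[OF cx]) auto
  have "integral {0..s0} (\<lambda>s. B (x s)) + integral {s0..s1} (\<lambda>s. B (x s)) = integral {0..s1} (\<lambda>s. B (x s))"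
    using s by (intro Henstock_Kurzweil_Integration.integral_combine integrable_continuous_real cBx) auto
  hence "x s1 - x s0 = g s1 - g s0 + integral {s0..s1} (\<lambda>s. B (x s))"
    using x[of s0] x[of s1] s by (simp add: algebra_simps)
  moreover have "integral {s0..s1} (\<lambda>s. B (x s)) = integral {s0..s1} (\<lambda>s. B (x s) - B (x s0)) + \<tau> *\<^sub>R B (x s0)"
    using s by (subst integral_diff) (auto intro!: integrable_continuous_real cBx)
  ultimately have "x s1 - euler B g \<tau> (Suc k) = (x s0 - euler B g \<tau> k) + \<tau> *\<^sub>R B (x s0 - euler B g \<tau> k)
      + integral {s0..s1} (\<lambda>s. B (x s) - B (x s0))"
    unfolding linear_diff[OF B] by (simp add: s0_def s1_def algebra_simps)
  also have "norm \<dots> \<le> norm (x s0 - euler B g \<tau> k) + \<tau> * (b * norm (x s0 - euler B g \<tau> k)) + b * \<epsilon> * \<tau>"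
  proof (intro norm_triangle_le add_mono order_refl)
    show "norm (\<tau> *\<^sub>R B (x s0 - euler B g \<tau> k)) \<le> \<tau> * (b * norm (x s0 - euler B g \<tau> k))"
      using \<tau> b by (auto intro: mult_left_mono)
    have "norm (integral {s0..s1} (\<lambda>s. B (x s) - B (x s0))) \<le> (b * \<epsilon>) * (s1 - s0)"
    proof (rule integral_bound)
      fix t assume "t \<in> {s0..s1}"
      hence "norm (x t - x s0) \<le> \<epsilon>" using osc[of k t] Suc.prems by (auto simp: s0_def s1_def)
      thus "norm (B (x t) - B (x s0)) \<le> b * \<epsilon>"
        unfolding linear_diff[OF B, symmetric] using b by (meson mult_left_mono order_trans)
    qed (use s in \<open>auto intro!: continuous_intros cBx\<close>)
    thus "norm (integral {s0..s1} (\<lambda>s. B (x s) - B (x s0))) \<le> b * \<epsilon> * \<tau>" using s by simp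
  qed
  also have "\<dots> = (1 + \<tau> * b) * norm (x s0 - euler B g \<tau> k) + \<tau> * b * \<epsilon>" by (simp add: algebra_simps)
  also have "\<dots> \<le> (1 + \<tau> * b) * (real k * \<tau> * b * \<epsilon> * (1 + \<tau> * b) ^ k) + \<tau> * b * \<epsilon> * (1 + \<tau> * b) ^ Suc k"
  proof (intro add_mono mult_left_mono)
    have "1 \<le> (1 + \<tau> * b) ^ Suc k" using \<tau> b by (intro one_le_power) auto
    from mult_left_mono[OF this, of "\<tau> * b * \<epsilon>"] show "\<tau> * b * \<epsilon> \<le> \<tau> * b * \<epsilon> * (1 + \<tau> * b) ^ Suc k" using \<tau> b \<epsilon> by simp
  qed (use Suc \<tau> b in \<open>auto simp: s0_def\<close>)
  also have "\<dots> = real (Suc k) * \<tau> * b * \<epsilon> * (1 + \<tau> * b) ^ Suc k" by (simp add: algebra_simps)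
  finally show ?case by (simp add: s1_def)
qed

text \<open>Uniform continuity of the path on the compact interval makes the oscillation in
  \<open>euler_error\<close> small, and the amplification stays below \<open>exp (b * t)\<close>.
  Convergence without a rate is enough for the limit of bounded expectations.\<close>

lemma euler_converges:
  fixes B :: "'e::euclidean_space \<Rightarrow> 'e" and g :: "real \<Rightarrow> 'e"
  assumes B: "linear B" and cx: "continuous_on {0..} x"
    and x: "\<And>t. t \<ge> 0 \<Longrightarrow> x t = g t + integral {0..t} (\<lambda>s. B (x s))" and t: "t \<ge> 0"
  shows "(\<lambda>n. euler B g (t / real (Suc n)) (Suc n)) \<longlonglongrightarrow> x t"
  unfolding tendsto_iff
proof (intro allI impI)
  fix e :: real assume e: "e > 0"
  obtain b where b: "b > 0" "\<And>x. norm (B x) \<le> b * norm x" using linear_bounded_pos[OF B] by blast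
  define c where "c = t * b * exp (b * t)"
  have c: "c \<ge> 0" unfolding c_def using t b by simp
  \<comment> \<open>The summand 1 guards against \<open>c\<close> being zero, which happens at
    \<open>t = 0\<close>.\<close>
  define \<epsilon> where "\<epsilon> = e / (c + 1)"
  have \<epsilon>: "\<epsilon> > 0" "c * \<epsilon> < e" unfolding \<epsilon>_def using e c by (auto simp: field_simps)
  have "uniformly_continuous_on {0..t} x"
    by (intro compact_uniformly_continuous continuous_on_subset[OF cx]) auto
  then obtain d where d: "d > 0" "\<And>s s'. s \<in> {0..t} \<Longrightarrow> s' \<in> {0..t} \<Longrightarrow> dist s' s < d \<Longrightarrow> dist (x s') (x s) < \<epsilon>"
    using \<epsilon>(1) unfolding uniformly_continuous_on_def by metis
  have "(\<lambda>n. t / real (Suc n)) \<longlonglongrightarrow> 0" by (rule LIMSEQ_Suc[OF lim_const_over_n])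
  hence "\<forall>\<^sub>F n in sequentially. t / real (Suc n) < d" using d(1) order_tendstoD(2) by blast
  thus "\<forall>\<^sub>F n in sequentially. dist (euler B g (t / real (Suc n)) (Suc n)) (x t) < e"
  proof eventually_elim
    case (elim n)
    define \<tau> where "\<tau> = t / real (Suc n)"
    have \<tau>: "\<tau> \<ge> 0" "real (Suc n) * \<tau> = t" "\<tau> < d" unfolding \<tau>_def using t elim by auto
    have "norm (x (real (Suc n) * \<tau>) - euler B g \<tau> (Suc n)) \<le> real (Suc n) * \<tau> * b * \<epsilon> * (1 + \<tau> * b) ^ Suc n"
    proof (rule euler_error[OF B _ b(2) \<tau>(1) _ cx x, of \<epsilon> "Suc n"])
      fix k s assume k: "k < Suc n" "s \<in> {real k * \<tau>..real (Suc k) * \<tau>}"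
      have "real (Suc k) * \<tau> \<le> real (Suc n) * \<tau>" using k \<tau> by (intro mult_right_mono) auto
      hence "s \<in> {0..t}" "real k * \<tau> \<in> {0..t}" using k \<tau> by (auto intro: order_trans[of 0 "real k * \<tau>"])
      moreover have "dist s (real k * \<tau>) < d" using k \<tau> by (auto simp: dist_real_def algebra_simps)
      ultimately show "norm (x s - x (real k * \<tau>)) \<le> \<epsilon>" using d(2) by (force simp: dist_norm)
    qed (use b \<epsilon> in auto)
    also have "\<dots> \<le> t * b * \<epsilon> * exp (b * t)"
    proof -
      have "(1 + \<tau> * b) ^ Suc n \<le> exp (\<tau> * b) ^ Suc n" using \<tau> b by (intro power_mono) auto
      also have "\<dots> = exp (b * t)" unfolding exp_of_nat_mult[symmetric] using \<tau>(2) by (simp add: mult_ac)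
      finally show ?thesis unfolding \<tau>(2) using t b \<epsilon> by (intro mult_left_mono) auto
    qed
    also have "\<dots> = c * \<epsilon>" by (simp add: c_def)
    finally have "norm (x t - euler B g \<tau> (Suc n)) < e" using \<epsilon> \<tau>(2) by simp
    thus ?case by (simp add: \<tau>_def dist_norm norm_minus_commute)
  qed
qed

section \<open>Linear stochastic differential equations\<close>

lemma bilinear_coord2: "bilinear (coord2 u w)"
  unfolding bilinear_def linear_iff by (simp add: inner_add_left algebra_simps)

context lyapunov
begin

text \<open>Only the finitely many coordinate forms enter \<open>gauss_comparison\<close>, and each
  of them is bounded relative to \<open>N\<close>. The means are compared by the Lipschitz bound.
  The constant does not depend on the lists, so it survives every later limit.\<close>

lemma cov_close_gops:
  assumes \<phi>: "tclass Bd L \<phi>" "L \<ge> 0" "Bd \<ge> 0" and K: "K \<ge> 0" "\<And>x y. \<bar>\<phi> (x + y) - \<phi> x\<bar> \<le> K * norm y"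
  shows "\<exists>c\<ge>0. \<forall>as bs x y \<delta> \<eta>. cov_close C \<delta> as \<longrightarrow> cov_close C \<eta> bs \<longrightarrow>
     \<bar>gops as \<phi> x - gops bs \<phi> y\<bar> \<le> c * (norm x + norm y + \<delta> + \<eta>)"
proof -
  obtain cN where cN: "cN > 0"
    "\<And>\<beta> K. K \<ge> 0 \<Longrightarrow> (\<forall>x y. \<bar>\<beta> x y\<bar> \<le> K * (norm x * norm y)) \<Longrightarrow> bnd \<beta> (cN * K)"
    using bnd_norm by metis
  define n where "n = real DIM('e)"
  define c1 where "c1 = (Bd / 2) * (n * (n * cN))"
  define c where "c = K + c1"
  have c1: "c1 \<ge> 0" unfolding c1_def n_def using \<phi> cN by simp
  show ?thesis
  proof (intro exI[of _ c] conjI allI impI)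
    show "c \<ge> 0" using c1 K by (simp add: c_def)
    fix as bs x y \<delta> \<eta> assume cl: "cov_close C \<delta> as" "cov_close C \<eta> bs"
    have uw: "\<bar>cov as (coord2 u w) - cov bs (coord2 u w)\<bar> \<le> (\<delta> + \<eta>) * cN" if "u \<in> Basis" "w \<in> Basis" for u w :: 'e
    proof -
      have "\<forall>x y. \<bar>coord2 u w x y\<bar> \<le> 1 * (norm x * norm y)"
        using Basis_le_norm[OF that(1)] Basis_le_norm[OF that(2)] by (auto simp: abs_mult intro!: mult_mono)
      hence "bnd (coord2 u w) cN" using cN(2)[of 1 "coord2 u w"] by simp
      hence "\<bar>cov as (coord2 u w) - C (coord2 u w)\<bar> \<le> \<delta> * cN" "\<bar>cov bs (coord2 u w) - C (coord2 u w)\<bar> \<le> \<eta> * cN"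
        using cl bilinear_coord2[of u w] cN(1) by (auto simp: cov_close_def)
      thus ?thesis unfolding distrib_right by linarith
    qed
    obtain u0 :: 'e where u0: "u0 \<in> Basis" using nonempty_Basis by blast
    \<comment> \<open>No sign is imposed on the two tolerances; their sum is nonnegative because it
      bounds an absolute value.\<close>
    have \<delta>\<eta>: "\<delta> + \<eta> \<ge> 0"
      using order_trans[OF abs_ge_zero uw[OF u0 u0]] cN(1) by (simp add: zero_le_mult_iff)
    have "\<bar>gops as \<phi> x - gops bs \<phi> x\<bar> \<le> (Bd / 2) * (\<Sum>u\<in>Basis. \<Sum>w\<in>Basis. \<bar>cov as (coord2 u w) - cov bs (coord2 u w)\<bar>)"
      by (rule gauss_comparison[OF \<phi>(1,2)])
    also have "\<dots> \<le> (Bd / 2) * (\<Sum>u\<in>(Basis::'e set). \<Sum>w\<in>(Basis::'e set). (\<delta> + \<eta>) * cN)"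
      using uw \<phi> by (intro mult_left_mono sum_mono) auto
    also have "\<dots> = c1 * (\<delta> + \<eta>)" by (simp add: c1_def n_def)
    finally have 1: "\<bar>gops as \<phi> x - gops bs \<phi> x\<bar> \<le> c1 * (\<delta> + \<eta>)" .
    have "\<bar>gops bs \<phi> (y + (x - y)) - gops bs \<phi> y\<bar> \<le> K * norm (x - y)"
      by (rule gops_lipschitz[OF tclass_BC[OF \<phi>(1)] K(2)])
    also have "\<dots> \<le> K * (norm x + norm y)" using K by (intro mult_left_mono norm_triangle_ineq4)
    finally have 2: "\<bar>gops bs \<phi> x - gops bs \<phi> y\<bar> \<le> K * (norm x + norm y)" by simp
    have "c1 * (\<delta> + \<eta>) + K * (norm x + norm y) \<le> c * (norm x + norm y + \<delta> + \<eta>)"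
    proof -
      have "0 \<le> c1 * norm x" "0 \<le> c1 * norm y" "0 \<le> K * (\<delta> + \<eta>)" using c1 K \<delta>\<eta> by auto
      thus ?thesis unfolding c_def distrib_left distrib_right by linarith
    qed
    thus "\<bar>gops as \<phi> x - gops bs \<phi> y\<bar> \<le> c * (norm x + norm y + \<delta> + \<eta>)" using 1 2 by linarith
  qed
qed

lemma N_funpow:
  assumes "\<And>x. N (R x) \<le> \<rho> * N x" "\<rho> \<ge> 0"
  shows "norm ((R ^^ n) x) \<le> \<rho> ^ n * N x / sqrt v0"
proof -
  have "N ((R ^^ n) x) \<le> \<rho> ^ n * N x"
  proof (induction n)
    case (Suc n)
    have "N ((R ^^ Suc n) x) \<le> \<rho> * N ((R ^^ n) x)" using assms by simp
    also have "\<dots> \<le> \<rho> * (\<rho> ^ n * N x)" using Suc assms by (intro mult_left_mono)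
    finally show ?case by simp
  qed simp
  hence "N ((R ^^ n) x) / sqrt v0 \<le> \<rho> ^ n * N x / sqrt v0" using v0 by (intro divide_right_mono) auto
  thus ?thesis using norm_le_N order_trans by blast
qed

end

lemma bounded_linear_measurable: "linear S \<Longrightarrow> S \<in> borel_measurable borel"
  for S :: "'a::euclidean_space \<Rightarrow> 'b::euclidean_space"
  by (intro borel_measurable_continuous_onI linear_continuous_on) (simp add: linear_conv_bounded_linear)

lemma std_wiener_increments:
  fixes W :: "real \<Rightarrow> 'a \<Rightarrow> real^'m"
  assumes W: "std_wiener \<Omega> W" and h: "h > 0"
  defines "\<delta> \<equiv> \<lambda>n \<omega>. W (real (Suc n) * h) \<omega> - W (real n * h) \<omega>"
  shows "prob_space.indep_vars \<Omega> (\<lambda>_. borel) \<delta> {..<n}"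
    and "distributed \<Omega> lborel (\<delta> k) (\<lambda>x. ennreal (\<Prod>i\<in>UNIV. normal_density 0 (sqrt h) (x $ i)))"
proof -
  have "mono (\<lambda>n. real n * h)" using h by (intro monoI mult_right_mono) auto
  hence ts: "0 \<le> (\<lambda>n. real n * h) 0 \<and> mono (\<lambda>n. real n * h)" by simp
  have "\<forall>(n::nat) (ts::nat \<Rightarrow> real). 0 \<le> ts 0 \<and> mono ts \<longrightarrow>
        prob_space.indep_vars \<Omega> (\<lambda>_. borel) (\<lambda>i \<omega>. W (ts (Suc i)) \<omega> - W (ts i) \<omega>) {..<n}"
    using W unfolding std_wiener_def by blast
  from this[rule_format, OF ts] show "prob_space.indep_vars \<Omega> (\<lambda>_. borel) \<delta> {..<n}"
    unfolding \<delta>_def .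
  have k: "0 \<le> real k * h \<and> real k * h < real (Suc k) * h" "real (Suc k) * h - real k * h = h"
    using h by (auto simp: algebra_simps)
  have "\<forall>s t. 0 \<le> s \<and> s < t \<longrightarrow> distributed \<Omega> lborel (\<lambda>\<omega>. W t \<omega> - W s \<omega>)
          (\<lambda>x. ennreal (\<Prod>i\<in>UNIV. normal_density 0 (sqrt (t - s)) (x $ i)))"
    using W unfolding std_wiener_def by blast
  from this[rule_format, OF k(1)]
  show "distributed \<Omega> lborel (\<delta> k) (\<lambda>x. ennreal (\<Prod>i\<in>UNIV. normal_density 0 (sqrt h) (x $ i)))"
    unfolding \<delta>_def k(2) .
qed

lemma wiener_chain_expectation:
  fixes W :: "real \<Rightarrow> 'a \<Rightarrow> real^'m" and X :: "nat \<Rightarrow> 'a \<Rightarrow> 'e::euclidean_space"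
  assumes W: "std_wiener \<Omega> W" and h: "h > 0"
    and R: "linear R" and S: "linear S" and xs: "set xs = Basis" "distinct xs"
    and X0: "\<And>\<omega>. X 0 \<omega> = x0"
    and X_Suc: "\<And>n \<omega>. X (Suc n) \<omega> = R (X n \<omega>) + S (W (real (Suc n) * h) \<omega> - W (real n * h) \<omega>)"
    and \<phi>: "BC \<phi>"
  shows "(\<integral>\<omega>. \<phi> (X n \<omega>) \<partial>\<Omega>) = gops (cov_chain R (map (\<lambda>b. sqrt h *\<^sub>R S b) xs) n) \<phi> ((R ^^ n) x0)"
proof -
  interpret prob_space \<Omega> using W by (simp add: std_wiener_def)
  show ?thesis
    by (rule linear_chain_expectation[where \<delta> = "\<lambda>n \<omega>. W (real (Suc n) * h) \<omega> - W (real n * h) \<omega>",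
          OF std_wiener_increments[OF W h] _ R S xs X0 X_Suc \<phi>]) (use h in simp)
qed

text \<open>On the null set where the Wiener path is not continuous the solution is set to \<open>0\<close>, so that
  it becomes measurable as an everywhere limit of Euler schemes, jointly in the initial value.\<close>

lemma linear_sde_solution_exists:
  fixes W :: "real \<Rightarrow> 'a \<Rightarrow> real^'m" and B :: "'e::euclidean_space \<Rightarrow> 'e" and Sig :: "real^'m \<Rightarrow> 'e"
  assumes W: "std_wiener \<Omega> W" and B: "linear B" and Sig: "linear Sig"
  defines "g \<equiv> \<lambda>x \<omega> t. x + Sig (W t \<omega> - W 0 \<omega>)"
  obtains X :: "'e \<Rightarrow> real \<Rightarrow> 'a \<Rightarrow> 'e" where
    "\<And>t. t \<ge> 0 \<Longrightarrow> (\<lambda>(x, \<omega>). X x t \<omega>) \<in> borel_measurable (borel \<Otimes>\<^sub>M \<Omega>)"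
    "AE \<omega> in \<Omega>. \<forall>x. continuous_on {0..} (\<lambda>t. X x t \<omega>) \<and>
       (\<forall>t\<ge>0. X x t \<omega> = g x \<omega> t + integral {0..t} (\<lambda>s. B (X x s \<omega>)))"
    "\<And>x t. t \<ge> 0 \<Longrightarrow> AE \<omega> in \<Omega>. (\<lambda>n. euler B (g x \<omega>) (t / real (Suc n)) (Suc n)) \<longlonglongrightarrow> X x t \<omega>"
    "\<And>x \<tau> k. \<tau> \<ge> 0 \<Longrightarrow> (\<lambda>\<omega>. euler B (g x \<omega>) \<tau> k) \<in> borel_measurable \<Omega>"
proof -
  have "AE \<omega> in \<Omega>. continuous_on {0..} (\<lambda>t. W t \<omega>)" using W by (simp add: std_wiener_def)
  then obtain Z where Z: "{\<omega> \<in> space \<Omega>. \<not> continuous_on {0..} (\<lambda>t. W t \<omega>)} \<subseteq> Z" "emeasure \<Omega> Z = 0" "Z \<in> sets \<Omega>"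
    by (rule AE_E)
  have Wm [measurable]: "W t \<in> borel_measurable \<Omega>" if "t \<ge> 0" for t using W that by (simp add: std_wiener_def)
  note [measurable] = bounded_linear_measurable[OF B] bounded_linear_measurable[OF Sig] Z(3)
  have bS: "bounded_linear Sig" using Sig by (simp add: linear_conv_bounded_linear)
  define P where "P x \<omega> y \<longleftrightarrow> continuous_on {0..} y \<and> (\<forall>t\<ge>0. y t = g x \<omega> t + integral {0..t} (\<lambda>s. B (y s)))" for x \<omega> and y :: "real \<Rightarrow> 'e"
  define X where "X x t \<omega> = (if \<omega> \<in> Z then 0 else (SOME y. P x \<omega> y) t)" for x t \<omega>
  \<comment> \<open>Existence holds for every continuous path and every starting point, so the
    exceptional set \<open>Z\<close> is the same for all initial values. This uniformity is what
    allows integration over the initial value later.\<close>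
  have PX: "P x \<omega> (\<lambda>t. X x t \<omega>)" if "\<omega> \<in> space \<Omega>" "\<omega> \<notin> Z" for x \<omega>
  proof -
    have "continuous_on {0..} (\<lambda>t. W t \<omega>)" using Z that by blast
    hence "continuous_on {0..} (\<lambda>t. W t \<omega> - W 0 \<omega>)" by (intro continuous_intros)
    hence "continuous_on {0..} (g x \<omega>)" unfolding g_def
      by (intro continuous_on_add continuous_on_const bounded_linear.continuous_on[OF bS])
    from linear_ivp_exists[OF B this] have "P x \<omega> (SOME y. P x \<omega> y)"
      unfolding P_def by (rule someI_ex)
    thus ?thesis using that by (simp add: X_def)
  qed
  have lim: "(\<lambda>n. euler B (g x \<omega>) (t / real (Suc n)) (Suc n)) \<longlonglongrightarrow> X x t \<omega>" if "\<omega> \<in> space \<Omega>" "\<omega> \<notin> Z" "t \<ge> 0" for x \<omega> t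
    using PX[OF that(1,2), of x] that(3) unfolding P_def by (intro euler_converges[OF B]) auto
  have em: "(\<lambda>p. euler B (g (fst p) (snd p)) \<tau> k) \<in> borel_measurable (borel \<Otimes>\<^sub>M \<Omega>)" if \<tau>: "\<tau> \<ge> 0" for \<tau> k
  proof (induction k)
    case 0
    show ?case unfolding euler.simps g_def by simp
  next
    case (Suc k)
    note [measurable] = Suc Wm[of "real k * \<tau>"] Wm[of "real (Suc k) * \<tau>"]
    have "0 \<le> real k * \<tau>" "0 \<le> real (Suc k) * \<tau>" using \<tau> by auto
    thus ?case unfolding euler.simps g_def using \<tau> Wm[of 0]
      by (intro borel_measurable_add borel_measurable_diff borel_measurable_scaleR borel_measurable_const
           measurable_compose[OF Suc[unfolded g_def] bounded_linear_measurable[OF B]]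
           measurable_compose[OF _ bounded_linear_measurable[OF Sig]] Suc[unfolded g_def]
           measurable_compose[OF measurable_snd Wm] measurable_fst) auto
  qed
  show thesis
  proof (rule that[of X])
    fix t :: real assume t: "t \<ge> 0"
    have "(\<lambda>p. X (fst p) t (snd p)) \<in> borel_measurable (borel \<Otimes>\<^sub>M \<Omega>)"
    proof (rule borel_measurable_LIMSEQ_metric)
      fix n
      show "(\<lambda>p. if snd p \<in> Z then 0 else euler B (g (fst p) (snd p)) (t / real (Suc n)) (Suc n)) \<in> borel_measurable (borel \<Otimes>\<^sub>M \<Omega>)"
        using em[of "t / real (Suc n)" "Suc n"] t by (intro measurable_If) (auto simp del: euler.simps)
    next
      fix p assume p: "p \<in> space (borel \<Otimes>\<^sub>M \<Omega> :: ('e \<times> 'a) measure)"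
      thus "(\<lambda>n. if snd p \<in> Z then 0 else euler B (g (fst p) (snd p)) (t / real (Suc n)) (Suc n)) \<longlonglongrightarrow> X (fst p) t (snd p)"
        using lim[of "snd p" t "fst p"] t by (auto simp: space_pair_measure X_def simp del: euler.simps)
    qed
    thus "(\<lambda>(x, \<omega>). X x t \<omega>) \<in> borel_measurable (borel \<Otimes>\<^sub>M \<Omega>)" by (simp add: case_prod_beta')
  next
    show "AE \<omega> in \<Omega>. \<forall>x. continuous_on {0..} (\<lambda>t. X x t \<omega>) \<and>
       (\<forall>t\<ge>0. X x t \<omega> = g x \<omega> t + integral {0..t} (\<lambda>s. B (X x s \<omega>)))"
      by (rule AE_I[of _ _ Z]) (use PX Z in \<open>auto simp: P_def\<close>)
  next
    fix x and t :: real assume "t \<ge> 0"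
    thus "AE \<omega> in \<Omega>. (\<lambda>n. euler B (g x \<omega>) (t / real (Suc n)) (Suc n)) \<longlonglongrightarrow> X x t \<omega>"
      by (intro AE_I[of _ _ Z]) (use lim Z in \<open>auto simp del: euler.simps\<close>)
  next
    fix x and \<tau> :: real and k assume "\<tau> \<ge> 0"
    from measurable_compose[OF measurable_Pair1' em[OF this], of x k] show "(\<lambda>\<omega>. euler B (g x \<omega>) \<tau> k) \<in> borel_measurable \<Omega>"
      by simp
  qed
qed

section \<open>The law of the solution as a limit of Euler chains\<close>

context lyapunov
begin

text \<open>At a fixed time the law of the solution is approached by Euler chains, whose Gaussian
  laws are explicit. Their distance to \<open>C\<close> splits into memory of the initial data,
  which decays exponentially in \<open>t\<close>, and an accumulated defect proportional to the
  step, which disappears in the limit.\<close>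

lemma solution_close_to_stationary:
  fixes W :: "real \<Rightarrow> 'a \<Rightarrow> real^'m" and Sig :: "real^'m \<Rightarrow> 'e"
  assumes W: "std_wiener \<Omega> W" and Sig: "linear Sig" and xs: "set xs = Basis" "distinct xs"
    and C: "stationary_cov C k0 (map Sig xs)" and BC\<phi>: "BC \<phi>" and c: "c \<ge> 0"
    and comp: "\<And>as bs x y \<delta> \<eta>. cov_close C \<delta> as \<Longrightarrow> cov_close C \<eta> bs \<Longrightarrow>
       \<bar>gops as \<phi> x - gops bs \<phi> y\<bar> \<le> c * (norm x + norm y + \<delta> + \<eta>)"
    and X: "X \<in> borel_measurable \<Omega>"
      "AE \<omega> in \<Omega>. (\<lambda>n. euler B (\<lambda>t. x + Sig (W t \<omega> - W 0 \<omega>)) (t / real (Suc n)) (Suc n)) \<longlonglongrightarrow> X \<omega>"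
      "\<And>\<tau> k. \<tau> \<ge> 0 \<Longrightarrow> (\<lambda>\<omega>. euler B (\<lambda>t. x + Sig (W t \<omega> - W 0 \<omega>)) \<tau> k) \<in> borel_measurable \<Omega>"
    and t: "t > 0" and as: "cov_close C \<delta> as"
  shows "\<bar>gops as \<phi> y - (\<integral>\<omega>. \<phi> (X \<omega>) \<partial>\<Omega>)\<bar>
     \<le> c * (norm y + \<delta> + exp (- (lam / 2 * t)) * (N x / sqrt v0 + k0))"
proof -
  interpret prob_space \<Omega> using W by (simp add: std_wiener_def)
  obtain ce where ce: "ce \<ge> 0" "\<And>\<tau>. \<tau> > 0 \<Longrightarrow> local_defect C (ce * \<tau>\<^sup>2) (\<lambda>x. x + \<tau> *\<^sub>R B x) (map (\<lambda>b. sqrt \<tau> *\<^sub>R Sig b) xs)"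
    using euler_local_defect[OF C] by blast
  obtain h0 where h0: "h0 > 0" "lam * h0 \<le> 1" and contr:
    "\<forall>h R. 0 < h \<longrightarrow> h \<le> h0 \<longrightarrow> (\<forall>x. norm (R x - x - h *\<^sub>R B x) \<le> 0 * h\<^sup>2 * norm x) \<longrightarrow>
        (\<forall>x. N (R x) \<le> (1 - lam / 2 * h) * N x)"
    using N_contraction[of 0] by blast
  have k0: "k0 \<ge> 0" using C by (simp add: stationary_cov_def)
  let ?\<tau> = "\<lambda>n. t / real (Suc n)"
  let ?E = "\<lambda>n \<omega>. euler B (\<lambda>t. x + Sig (W t \<omega> - W 0 \<omega>)) (?\<tau> n) (Suc n)"
  have \<tau>_lim: "?\<tau> \<longlonglongrightarrow> 0" by (rule LIMSEQ_Suc[OF lim_const_over_n])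
  have "(\<lambda>n. \<integral>\<omega>. \<phi> (?E n \<omega>) \<partial>\<Omega>) \<longlonglongrightarrow> (\<integral>\<omega>. \<phi> (X \<omega>) \<partial>\<Omega>)"
  proof -
    obtain Bd where Bd: "\<forall>x. \<bar>\<phi> x\<bar> \<le> Bd" using BC_bound[OF BC\<phi>] by blast
    show ?thesis
    proof (rule integral_dominated_convergence[where w = "\<lambda>_. Bd"])
      show "AE \<omega> in \<Omega>. (\<lambda>n. \<phi> (?E n \<omega>)) \<longlonglongrightarrow> \<phi> (X \<omega>)"
        using X(2) by eventually_elim (rule isCont_tendsto_compose[OF BC_isCont[OF BC\<phi>]])
    qed (use Bd X(1) X(3)[of "?\<tau> _" "Suc _"] t in
      \<open>auto intro!: measurable_compose[OF _ BC_measurable[OF BC\<phi>]] simp del: euler.simps\<close>)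
  qed
  hence lim: "(\<lambda>n. \<bar>gops as \<phi> y - (\<integral>\<omega>. \<phi> (?E n \<omega>) \<partial>\<Omega>)\<bar>) \<longlonglongrightarrow> \<bar>gops as \<phi> y - (\<integral>\<omega>. \<phi> (X \<omega>) \<partial>\<Omega>)\<bar>"
    by (intro tendsto_intros)
  let ?r = "exp (- (lam / 2 * t))"
  have lim': "(\<lambda>n. c * (norm y + ?r * N x / sqrt v0 + \<delta> + (?r * k0 + 2 * ce / lam * ?\<tau> n)))
      \<longlonglongrightarrow> c * (norm y + ?r * N x / sqrt v0 + \<delta> + (?r * k0 + 2 * ce / lam * 0))"
    by (intro tendsto_intros \<tau>_lim)
  have "\<forall>\<^sub>F n in sequentially. ?\<tau> n < h0" using \<tau>_lim h0(1) order_tendstoD(2) by blast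
  hence "\<forall>\<^sub>F n in sequentially. \<bar>gops as \<phi> y - (\<integral>\<omega>. \<phi> (?E n \<omega>) \<partial>\<Omega>)\<bar>
      \<le> c * (norm y + ?r * N x / sqrt v0 + \<delta> + (?r * k0 + 2 * ce / lam * ?\<tau> n))"
  proof eventually_elim
    case (elim n)
    define \<tau> where "\<tau> = ?\<tau> n"
    have \<tau>: "\<tau> > 0" "\<tau> \<le> h0" "real (Suc n) * \<tau> = t" unfolding \<tau>_def using t elim by auto
    define R where "R = (\<lambda>x. x + \<tau> *\<^sub>R B x)"
    have R: "linear R" unfolding R_def using B by (intro linear_compose_add linear_ident linear_compose_scale_right)
    define \<rho> where "\<rho> = 1 - lam / 2 * \<tau>"
    have lt: "lam * \<tau> \<le> 1" using \<tau> h0 lam by (meson mult_left_mono less_imp_le order_trans)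
    have \<rho>: "0 \<le> \<rho>" "\<rho> < 1" "1 - \<rho> = lam / 2 * \<tau>" unfolding \<rho>_def using lt lam \<tau> by auto
    have NR: "N (R x) \<le> \<rho> * N x" for x
      unfolding \<rho>_def using contr[rule_format, OF \<tau>(1,2), of R x] by (simp add: R_def)
    have pow: "\<rho> ^ Suc n \<le> ?r"
    proof -
      have "\<rho> \<le> exp (- (lam / 2 * \<tau>))" unfolding \<rho>_def using exp_ge_add_one_self[of "- (lam / 2 * \<tau>)"] by simp
      hence "\<rho> ^ Suc n \<le> exp (- (lam / 2 * \<tau>)) ^ Suc n" using \<rho> by (intro power_mono)
      also have "\<dots> = exp (real (Suc n) * (- (lam / 2 * \<tau>)))" by (rule exp_of_nat_mult[symmetric])
      also have "real (Suc n) * (- (lam / 2 * \<tau>)) = - (lam / 2 * (real (Suc n) * \<tau>))" by (simp add: algebra_simps)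
      finally show ?thesis unfolding \<tau>(3) .
    qed
    let ?bs = "cov_chain R (map (\<lambda>b. sqrt \<tau> *\<^sub>R Sig b) xs) (Suc n)"
    have cl: "cov_close C (\<rho> ^ Suc n * k0 + ce * \<tau>\<^sup>2 / (1 - \<rho>)) ?bs"
      using ce(2)[OF \<tau>(1)] by (intro cov_chain_close[OF C R NR \<rho>(1,2)]) (simp add: R_def)
    have "(\<integral>\<omega>. \<phi> (?E n \<omega>) \<partial>\<Omega>) = gops ?bs \<phi> ((R ^^ Suc n) x)"
      unfolding \<tau>_def[symmetric]
      by (rule wiener_chain_expectation[OF W \<tau>(1) R Sig xs _ _ BC\<phi>, where X = "\<lambda>k \<omega>. euler B (\<lambda>t. x + Sig (W t \<omega> - W 0 \<omega>)) \<tau> k"])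
         (simp_all add: R_def linear_0[OF Sig] linear_diff[OF Sig])
    hence "\<bar>gops as \<phi> y - (\<integral>\<omega>. \<phi> (?E n \<omega>) \<partial>\<Omega>)\<bar>
       \<le> c * (norm y + norm ((R ^^ Suc n) x) + \<delta> + (\<rho> ^ Suc n * k0 + ce * \<tau>\<^sup>2 / (1 - \<rho>)))"
      using comp[OF as cl, of y "(R ^^ Suc n) x"] by simp
    also have "\<dots> \<le> c * (norm y + ?r * N x / sqrt v0 + \<delta> + (?r * k0 + 2 * ce / lam * \<tau>))"
    proof (intro mult_left_mono add_mono order_refl c)
      have "norm ((R ^^ Suc n) x) \<le> \<rho> ^ Suc n * N x / sqrt v0" by (rule N_funpow[OF NR \<rho>(1)])
      also have "\<dots> \<le> ?r * N x / sqrt v0" using pow v0 by (intro divide_right_mono mult_right_mono) auto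
      finally show "norm ((R ^^ Suc n) x) \<le> ?r * N x / sqrt v0" .
      show "\<rho> ^ Suc n * k0 \<le> ?r * k0" by (intro mult_right_mono pow k0)
      \<comment> \<open>Accumulation divides the defect \<tau>^2 by 1 - \<rho> = \<open>lam\<close>
        \<tau> / 2; the single power of \<tau> that remains tends to zero.\<close>
      show "ce * \<tau>\<^sup>2 / (1 - \<rho>) \<le> 2 * ce / lam * \<tau>"
        unfolding \<rho>(3) using \<tau>(1) lam by (simp add: power2_eq_square field_simps)
    qed
    finally show ?case by (simp add: \<tau>_def)
  qed
  from tendsto_le[OF _ lim' lim this]
  show ?thesis by (simp add: algebra_simps)
qed

end

section \<open>Ergodic averages of second-order linear schemes\<close>

context lyapunov
begin

lemma N_measurable: "N \<in> borel_measurable borel"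
proof -
  have "bounded_bilinear V" using V by (simp add: bilinear_conv_bounded_bilinear)
  hence "continuous_on UNIV (\<lambda>x. V x x)"
    by (rule bounded_bilinear.continuous_on) (auto intro: continuous_on_id)
  hence "continuous_on UNIV N" unfolding N_def[abs_def] by (intro continuous_on_real_sqrt)
  thus ?thesis by (rule borel_measurable_continuous_onI)
qed

text \<open>Invariance is used only as constancy in time of the averaged expectation, with value
  \<open>I\<close>. The map \<open>f\<close> carries the initial law into the state space, so a
  shifted measure need not be formed. All constants precede the step size and the scheme in the
  quantifiers, which gives uniformity in h.\<close>

lemma linear_scheme_ergodic_rate:
  fixes W :: "real \<Rightarrow> 'a \<Rightarrow> real^'m" and Sig :: "real^'m \<Rightarrow> 'e" and \<mu> :: "'b measure"
    and X :: "'e \<Rightarrow> real \<Rightarrow> 'a \<Rightarrow> 'e" and f :: "'b \<Rightarrow> 'e"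
  assumes W: "std_wiener \<Omega> W" and Sig: "linear Sig"
    and \<phi>: "tclass Bd L \<phi>" "L \<ge> 0" "Bd \<ge> 0" and K: "K \<ge> 0" "\<And>x y. \<bar>\<phi> (x + y) - \<phi> x\<bar> \<le> K * norm y"
    and \<kappa>: "\<kappa> \<ge> 0"
    and Xm: "\<And>t. t \<ge> 0 \<Longrightarrow> (\<lambda>(x, \<omega>). X x t \<omega>) \<in> borel_measurable (borel \<Otimes>\<^sub>M \<Omega>)"
    and Xlim: "\<And>x t. t \<ge> 0 \<Longrightarrow> AE \<omega> in \<Omega>. (\<lambda>n. euler B (\<lambda>t. x + Sig (W t \<omega> - W 0 \<omega>)) (t / real (Suc n)) (Suc n)) \<longlonglongrightarrow> X x t \<omega>"
    and em: "\<And>x \<tau> k. \<tau> \<ge> 0 \<Longrightarrow> (\<lambda>\<omega>. euler B (\<lambda>t. x + Sig (W t \<omega> - W 0 \<omega>)) \<tau> k) \<in> borel_measurable \<Omega>"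
    and \<mu>: "prob_space \<mu>" and f: "f \<in> borel_measurable \<mu>"
    and I: "\<And>t. t \<ge> 0 \<Longrightarrow> (\<integral>x. (\<integral>\<omega>. \<phi> (X (f x) t \<omega>) \<partial>\<Omega>) \<partial>\<mu>) = I"
  shows "\<exists>h0>0. \<exists>C>0. \<forall>h R S Y. 0 < h \<longrightarrow> h \<le> h0 \<longrightarrow> linear R \<longrightarrow> linear S \<longrightarrow>
    (\<forall>x. norm (R x - (x + h *\<^sub>R B x + (h\<^sup>2 / 2) *\<^sub>R B (B x))) \<le> \<kappa> * h ^ 3 * norm x) \<longrightarrow>
    (\<forall>b\<in>Basis. norm (S b - (Sig b + (h / 2) *\<^sub>R B (Sig b))) \<le> \<kappa> * h\<^sup>2) \<longrightarrow>
    (\<forall>\<omega>. Y 0 \<omega> = y0) \<longrightarrow>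
    (\<forall>n \<omega>. Y (Suc n) \<omega> = R (Y n \<omega>) + S (W (real (Suc n) * h) \<omega> - W (real n * h) \<omega>)) \<longrightarrow>
    (\<forall>N. N \<ge> 1 \<longrightarrow> \<bar>(1 / real N) * (\<Sum>n=1..N. (\<integral>\<omega>. \<phi> (Y n \<omega>) \<partial>\<Omega>)) - I\<bar> \<le> C * (h\<^sup>2 + 1 / (real N * h)))"
proof -
  interpret prob_space \<Omega> using W by (simp add: std_wiener_def)
  interpret \<mu>: prob_space \<mu> by fact
  have BC\<phi>: "BC \<phi>" using tclass_BC[OF \<phi>(1)] .
  obtain xs :: "(real^'m) list" where xs: "set xs = Basis" "distinct xs"
    using finite_distinct_list[OF finite_Basis] by blast
  obtain C k0 where C: "stationary_cov C k0 (map Sig xs)"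
    using stationary_cov_exists by blast
  have k0: "k0 \<ge> 0" using C by (simp add: stationary_cov_def)
  obtain c where c: "c \<ge> 0" and comp: "\<And>as bs x y \<delta> \<eta>. cov_close C \<delta> as \<Longrightarrow> cov_close C \<eta> bs \<Longrightarrow>
       \<bar>gops as \<phi> x - gops bs \<phi> y\<bar> \<le> c * (norm x + norm y + \<delta> + \<eta>)"
    using cov_close_gops[OF \<phi> K, of C] by blast
  obtain c2 where c2: "c2 \<ge> 0" and loc: "\<forall>h R S. 0 < h \<longrightarrow> h \<le> 1 \<longrightarrow> linear R \<longrightarrow>
    (\<forall>x. norm (R x - (x + h *\<^sub>R B x + (h\<^sup>2 / 2) *\<^sub>R B (B x))) \<le> \<kappa> * h ^ 3 * norm x) \<longrightarrow>
    (\<forall>b\<in>set xs. norm (S b - (Sig b + (h / 2) *\<^sub>R B (Sig b))) \<le> \<kappa> * h\<^sup>2) \<longrightarrow>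
    local_defect C (c2 * h ^ 3) R (map (\<lambda>b. sqrt h *\<^sub>R S b) xs)"
    using second_order_local_defect[OF C \<kappa>] by blast
  obtain b where b: "b > 0" "\<And>x. norm (B x) \<le> b * norm x" using norm_B by metis
  \<comment> \<open>The contraction lemma compares with 1 + h B, so the second-order term of the
    step counts as error there; it contributes the summand \<open>b * b\<close>.\<close>
  obtain h1 where h1: "h1 > 0" "lam * h1 \<le> 1" and contr:
    "\<forall>h R. 0 < h \<longrightarrow> h \<le> h1 \<longrightarrow> (\<forall>x. norm (R x - x - h *\<^sub>R B x) \<le> (\<kappa> + b * b) * h\<^sup>2 * norm x) \<longrightarrow>
        (\<forall>x. N (R x) \<le> (1 - lam / 2 * h) * N x)"
    using N_contraction[of "\<kappa> + b * b"] by blast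
  define h0 where "h0 = min h1 1"
  define G where "G = c * (N y0 / sqrt v0 + k0)"
  define H where "H = c * (2 * c2 / lam)"
  have G: "G \<ge> 0" and H: "H \<ge> 0" unfolding G_def H_def using c k0 c2 lam v0 by auto
  \<comment> \<open>\<open>H\<close> is the coefficient of h^2 and \<open>2 * G / lam\<close> that
    of 1/T; the summand 1 makes the constant strictly positive.\<close>
  define Cf where "Cf = H + 2 * G / lam + 1"
  obtain Bp where Bp: "Bp \<ge> 0" "\<forall>x. \<bar>\<phi> x\<bar> \<le> Bp" using BC_bound[OF BC\<phi>] by blast
  define u where "u t x = (\<integral>\<omega>. \<phi> (X (f x) t \<omega>) \<partial>\<Omega>)" for t x
  have Xm1: "X x t \<in> borel_measurable \<Omega>" if "t \<ge> 0" for x t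
    using measurable_compose[OF measurable_Pair1' Xm[OF that], of x] by simp
  have u_meas: "u t \<in> borel_measurable \<mu>" if t: "t \<ge> 0" for t
  proof -
    have "(\<lambda>p. (f (fst p), snd p)) \<in> \<mu> \<Otimes>\<^sub>M \<Omega> \<rightarrow>\<^sub>M borel \<Otimes>\<^sub>M \<Omega>"
      using f by measurable
    from measurable_compose[OF this Xm[OF t]]
    have "(\<lambda>p. X (f (fst p)) t (snd p)) \<in> borel_measurable (\<mu> \<Otimes>\<^sub>M \<Omega>)" by simp
    hence "(\<lambda>p. \<phi> (X (f (fst p)) t (snd p))) \<in> borel_measurable (\<mu> \<Otimes>\<^sub>M \<Omega>)"
      by (rule measurable_compose[OF _ BC_measurable[OF BC\<phi>]])
    thus ?thesis unfolding u_def[abs_def]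
      by (intro borel_measurable_lebesgue_integral) (simp add: case_prod_beta')
  qed
  have u_bd: "\<bar>u t x\<bar> \<le> Bp" if "t \<ge> 0" for t x
    unfolding u_def using Bp Xm1[OF that] by (intro abs_integral_le_const measurable_compose[OF _ BC_measurable[OF BC\<phi>]]) auto
  have u_int: "integrable \<mu> (u t)" if "t \<ge> 0" for t
    using u_meas[OF that] u_bd[OF that] by (intro \<mu>.integrable_const_bound[of _ Bp]) auto
  \<comment> \<open>Identification of \<open>I\<close> as the limiting Gaussian expectation: the
    initial value is distributed by \<open>\<mu>\<close> and time tends to infinity.\<close>
  have stat: "\<bar>gops as \<phi> y - I\<bar> \<le> c * (norm y + \<delta>)" if as: "cov_close C \<delta> as" for as y \<delta>
  proof -
    define a where "a = gops as \<phi> y"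
    define A0 where "A0 = c * (norm y + \<delta>)"
    define D where "D x = c * (N (f x) / sqrt v0 + k0)" for x
    \<comment> \<open>The bound grows with \<open>N (f x)\<close>, whose integrability under
      \<open>\<mu>\<close> is not known. Capping it by the trivial bound \<open>2 * Bp\<close> gives
      a constant majorant, so dominated convergence applies.\<close>
    let ?w = "\<lambda>k x. min (2 * Bp) (A0 + exp (- (lam / 2 * real (Suc k))) * D x)"
    have a: "\<bar>a\<bar> \<le> Bp" unfolding a_def using Bp by (intro gops_abs_le BC\<phi>) auto
    have Dm: "D \<in> borel_measurable \<mu>" unfolding D_def[abs_def]
      using measurable_compose[OF f N_measurable] by simp
    have D0: "D x \<ge> 0" for x unfolding D_def using c k0 v0 by simp
    have A0: "A0 \<ge> 0" unfolding A0_def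
      using comp[OF as as, of y y] order_trans[OF abs_ge_zero comp[OF as as, of y y]] by (simp add: algebra_simps)
    have bound: "\<bar>a - I\<bar> \<le> (\<integral>x. ?w k x \<partial>\<mu>)" for k
    proof -
      let ?t = "real (Suc k)"
      have pt: "\<bar>a - u ?t x\<bar> \<le> ?w k x" for x
      proof -
        have "\<bar>a - u ?t x\<bar> \<le> c * (norm y + \<delta> + exp (- (lam / 2 * ?t)) * (N (f x) / sqrt v0 + k0))"
          unfolding a_def u_def
          by (rule solution_close_to_stationary[OF W Sig xs C BC\<phi> c comp Xm1 Xlim em _ as]) auto
        also have "\<dots> = A0 + exp (- (lam / 2 * ?t)) * D x"
          unfolding A0_def D_def by (simp add: algebra_simps)
        finally show ?thesis using a u_bd[of ?t x] by simp
      qed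
      have "(\<integral>x. u ?t x \<partial>\<mu>) = I" using I[of ?t] by (simp add: u_def)
      hence "a - I = (\<integral>x. a - u ?t x \<partial>\<mu>)"
        using u_int[of ?t] by (simp add: \<mu>.prob_space)
      also have "\<bar>\<dots>\<bar> \<le> (\<integral>x. \<bar>a - u ?t x\<bar> \<partial>\<mu>)" by (rule integral_abs_bound)
      also have "\<dots> \<le> (\<integral>x. ?w k x \<partial>\<mu>)"
      proof (rule integral_mono)
        show "integrable \<mu> (\<lambda>x. \<bar>a - u ?t x\<bar>)" using u_int[of ?t] by auto
        show "integrable \<mu> (?w k)"
          using A0 D0 Bp Dm by (intro \<mu>.integrable_const_bound[of _ "2 * Bp"]) (auto simp: abs_le_iff min_def)
      qed (rule pt)
      finally show ?thesis .
    qed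
    have "(\<lambda>k. \<integral>x. ?w k x \<partial>\<mu>) \<longlonglongrightarrow> (\<integral>x. min (2 * Bp) A0 \<partial>\<mu>)"
    proof (rule integral_dominated_convergence[where w = "\<lambda>_. 2 * Bp"])
      show "AE x in \<mu>. (\<lambda>k. ?w k x) \<longlonglongrightarrow> min (2 * Bp) A0"
      proof (rule AE_I2)
        fix x
        have "(\<lambda>k. exp (- (lam / 2 * real (Suc k)))) \<longlonglongrightarrow> 0" using lam by real_asymp
        hence "(\<lambda>k. ?w k x) \<longlonglongrightarrow> min (2 * Bp) (A0 + 0 * D x)" by (intro tendsto_intros)
        thus "(\<lambda>k. ?w k x) \<longlonglongrightarrow> min (2 * Bp) A0" by simp
      qed
      show "AE x in \<mu>. norm (?w k x) \<le> 2 * Bp" for k using A0 D0 Bp by (intro AE_I2) (auto simp: abs_le_iff min_def)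
    qed (use Dm in auto)
    hence "\<bar>a - I\<bar> \<le> (\<integral>x. min (2 * Bp) A0 \<partial>\<mu>)" using bound by (intro LIMSEQ_le_const) auto
    thus ?thesis unfolding a_def A0_def by (simp add: \<mu>.prob_space)
  qed
  show ?thesis
  proof (rule exI[of _ h0], rule conjI, goal_cases)
    case 1
    show ?case unfolding h0_def using h1 by simp
  next
    case 2
    show ?case
    proof (rule exI[of _ Cf], intro conjI allI impI)
      have "0 \<le> 2 * G / lam" using G lam by simp
      thus "Cf > 0" unfolding Cf_def using H by linarith
      fix h :: real and R :: "'e \<Rightarrow> 'e" and S :: "real^'m \<Rightarrow> 'e" and Y :: "nat \<Rightarrow> 'a \<Rightarrow> 'e" and M :: nat
      assume h: "0 < h" "h \<le> h0" and R: "linear R" and S: "linear S"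
        and R2: "\<forall>x. norm (R x - (x + h *\<^sub>R B x + (h\<^sup>2 / 2) *\<^sub>R B (B x))) \<le> \<kappa> * h ^ 3 * norm x"
        and S2: "\<forall>b\<in>Basis. norm (S b - (Sig b + (h / 2) *\<^sub>R B (Sig b))) \<le> \<kappa> * h\<^sup>2"
        and Y0: "\<forall>\<omega>. Y 0 \<omega> = y0"
        and YS: "\<forall>n \<omega>. Y (Suc n) \<omega> = R (Y n \<omega>) + S (W (real (Suc n) * h) \<omega> - W (real n * h) \<omega>)"
        and M: "M \<ge> 1"
      have hh: "h \<le> 1" "h \<le> h1" using h by (auto simp: h0_def)
      define \<rho> where "\<rho> = 1 - lam / 2 * h"
      have lt: "lam * h \<le> 1" using hh h1 lam by (meson mult_left_mono less_imp_le order_trans)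
      have \<rho>: "0 \<le> \<rho>" "\<rho> < 1" "1 - \<rho> = lam / 2 * h" unfolding \<rho>_def using lt lam h by auto
      have "norm (R x - x - h *\<^sub>R B x) \<le> (\<kappa> + b * b) * h\<^sup>2 * norm x" for x
      proof -
        have "norm (B (B x)) \<le> b * (b * norm x)"
          using order_trans[OF b(2)[of "B x"] mult_left_mono[OF b(2)[of x], of b]] b(1) by simp
        hence 1: "norm ((h\<^sup>2 / 2) *\<^sub>R B (B x)) \<le> h\<^sup>2 * (b * (b * norm x))"
          by (simp only: norm_scaleR) (intro mult_mono, auto)
        have "h ^ 3 \<le> h\<^sup>2" using h hh by (intro power_decreasing) auto
        hence 2: "\<kappa> * h ^ 3 * norm x \<le> \<kappa> * h\<^sup>2 * norm x" using \<kappa> by (intro mult_right_mono mult_left_mono) auto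
        have "R x - x - h *\<^sub>R B x = (R x - (x + h *\<^sub>R B x + (h\<^sup>2 / 2) *\<^sub>R B (B x))) + (h\<^sup>2 / 2) *\<^sub>R B (B x)" by simp
        also have "norm \<dots> \<le> \<kappa> * h\<^sup>2 * norm x + h\<^sup>2 * (b * (b * norm x))"
          using R2[rule_format, of x] 1 2 by (intro norm_triangle_le add_mono) auto
        finally show ?thesis by (simp add: algebra_simps)
      qed
      hence NR: "N (R x) \<le> \<rho> * N x" for x unfolding \<rho>_def using contr h(1) hh(2) by blast
      let ?ss = "map (\<lambda>b. sqrt h *\<^sub>R S b) xs"
      have ld: "local_defect C (c2 * h ^ 3) R ?ss" using loc h(1) hh(1) R R2 S2 xs by blast
      have err: "\<bar>(\<integral>\<omega>. \<phi> (Y n \<omega>) \<partial>\<Omega>) - I\<bar> \<le> G * \<rho> ^ n + H * h\<^sup>2" for n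
      proof -
        have "(\<integral>\<omega>. \<phi> (Y n \<omega>) \<partial>\<Omega>) = gops (cov_chain R ?ss n) \<phi> ((R ^^ n) y0)"
          by (rule wiener_chain_expectation[OF W h(1) R S xs Y0[rule_format] YS[rule_format] BC\<phi>])
        hence "\<bar>(\<integral>\<omega>. \<phi> (Y n \<omega>) \<partial>\<Omega>) - I\<bar> \<le> c * (norm ((R ^^ n) y0) + (\<rho> ^ n * k0 + c2 * h ^ 3 / (1 - \<rho>)))"
          using stat[OF cov_chain_close[OF C R NR \<rho>(1,2) ld]] by simp
        also have "\<dots> \<le> c * (\<rho> ^ n * N y0 / sqrt v0 + (\<rho> ^ n * k0 + (2 * c2 / lam) * h\<^sup>2))"
        proof (intro mult_left_mono[OF _ c] add_mono order_refl)
          show "norm ((R ^^ n) y0) \<le> \<rho> ^ n * N y0 / sqrt v0" by (rule N_funpow[OF NR \<rho>(1)])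
          show "c2 * h ^ 3 / (1 - \<rho>) \<le> (2 * c2 / lam) * h\<^sup>2"
            unfolding \<rho>(3) using h(1) lam by (simp add: power2_eq_square power3_eq_cube field_simps)
        qed
        also have "\<dots> = G * \<rho> ^ n + H * h\<^sup>2" unfolding G_def H_def by (simp add: algebra_simps)
        finally show ?thesis .
      qed
      \<comment> \<open>The transient part sums to a multiple of 1/h whatever the number of steps;
        division by that number turns it into a multiple of 1/T.\<close>
      have geo: "(\<Sum>n=1..M. \<rho> ^ n) \<le> 2 / (lam * h)"
      proof -
        have "(\<Sum>n=1..M. \<rho> ^ n) \<le> (\<Sum>n. \<rho> ^ n)"
          using \<rho> by (intro sum_le_suminf summable_geometric) auto
        also have "\<dots> = 2 / (lam * h)" using \<rho> by (subst suminf_geometric) (auto simp: \<rho>(3))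
        finally show ?thesis .
      qed
      have "(1 / real M) * (\<Sum>n=1..M. (\<integral>\<omega>. \<phi> (Y n \<omega>) \<partial>\<Omega>)) - I = (1 / real M) * (\<Sum>n=1..M. (\<integral>\<omega>. \<phi> (Y n \<omega>) \<partial>\<Omega>) - I)"
        using M by (simp add: sum_subtractf field_simps)
      also have "\<bar>\<dots>\<bar> \<le> (1 / real M) * (\<Sum>n=1..M. G * \<rho> ^ n + H * h\<^sup>2)"
        unfolding abs_mult using err by (intro mult_mono order_trans[OF sum_abs] sum_mono) auto
      also have "\<dots> = (1 / real M) * (G * (\<Sum>n=1..M. \<rho> ^ n)) + H * h\<^sup>2"
        using M by (simp add: sum.distrib sum_distrib_left[symmetric] distrib_left)
      also have "\<dots> \<le> (1 / real M) * (G * (2 / (lam * h))) + H * h\<^sup>2"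
        using geo G by (intro add_right_mono mult_left_mono) auto
      also have "\<dots> = (2 * G / lam) * (1 / (real M * h)) + H * h\<^sup>2" by (simp add: mult_ac)
      also have "\<dots> \<le> Cf * (1 / (real M * h)) + Cf * h\<^sup>2"
      proof (intro add_mono mult_right_mono)
        show "2 * G / lam \<le> Cf" "H \<le> Cf" unfolding Cf_def using G H lam by auto
      qed (use h in auto)
      finally show "\<bar>(1 / real M) * (\<Sum>n=1..M. (\<integral>\<omega>. \<phi> (Y n \<omega>) \<partial>\<Omega>)) - I\<bar> \<le> Cf * (h\<^sup>2 + 1 / (real M * h))"
        by (simp add: algebra_simps)
    qed
  qed
qed

end

section \<open>Expansion of the scheme\<close>

text \<open>In the variable t = v h these are one-variable expansions. The orders match the place of
  each factor: \<open>exp (- v * h)\<close> multiplies the momentum directly and is needed up to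
  h^3, while the other two come with a further factor h in the step, or act on the noise, where h^2
  suffices.\<close>

lemma scheme_scalars:
  assumes "(v::real) > 0"
  shows "\<exists>k\<ge>1. \<exists>h1>0. \<forall>h. 0 < h \<longrightarrow> h \<le> h1 \<longrightarrow>
     \<bar>exp (- v * h) - (1 - v * h + v\<^sup>2 * h\<^sup>2 / 2)\<bar> \<le> k * h ^ 3 \<and>
     \<bar>(1 + v * h / 2) * exp (- v * h) - (1 - v * h / 2)\<bar> \<le> k * h\<^sup>2 \<and>
     \<bar>(1 - v * h / 2) * exp (v * h) - (1 + v * h / 2)\<bar> \<le> k * h\<^sup>2"
proof -
  have O: "\<exists>c>0. \<exists>b>0. \<forall>h. 0 < h \<longrightarrow> h < b \<longrightarrow> \<bar>f h\<bar> \<le> c * h ^ n"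
    if "f \<in> O[at_right 0](\<lambda>h. h ^ n)" for f :: "real \<Rightarrow> real" and n
  proof -
    from that obtain c where c: "c > 0" "eventually (\<lambda>h. norm (f h) \<le> c * norm (h ^ n)) (at_right 0)"
      by (rule landau_o.bigE)
    then obtain b where "b > 0" "\<forall>h>0. h < b \<longrightarrow> norm (f h) \<le> c * norm (h ^ n)"
      unfolding eventually_at_right_field by auto
    thus ?thesis using c(1) by (intro exI[of _ c] exI[of _ b]) auto
  qed
  have "(\<lambda>t::real. exp (- t) - (1 - t + t\<^sup>2 / 2)) \<in> O[at_right 0](\<lambda>t. t ^ 3)" by real_asymp
  from O[OF this] obtain c1 b1 where 1: "b1 > 0" "\<And>t::real. 0 < t \<Longrightarrow> t < b1 \<Longrightarrow> \<bar>exp (- t) - (1 - t + t\<^sup>2 / 2)\<bar> \<le> c1 * t ^ 3"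
    by blast
  have "(\<lambda>t::real. (1 + t / 2) * exp (- t) - (1 - t / 2)) \<in> O[at_right 0](\<lambda>t. t ^ 2)" by real_asymp
  from O[OF this] obtain c2 b2 where 2: "b2 > 0" "\<And>t::real. 0 < t \<Longrightarrow> t < b2 \<Longrightarrow> \<bar>(1 + t / 2) * exp (- t) - (1 - t / 2)\<bar> \<le> c2 * t\<^sup>2"
    by blast
  have "(\<lambda>t::real. (1 - t / 2) * exp t - (1 + t / 2)) \<in> O[at_right 0](\<lambda>t. t ^ 2)" by real_asymp
  from O[OF this] obtain c3 b3 where 3: "b3 > 0" "\<And>t::real. 0 < t \<Longrightarrow> t < b3 \<Longrightarrow> \<bar>(1 - t / 2) * exp t - (1 + t / 2)\<bar> \<le> c3 * t\<^sup>2"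
    by blast
  define k where "k = max 1 (max (c1 * v ^ 3) (max (c2 * v\<^sup>2) (c3 * v\<^sup>2)))"
  \<comment> \<open>The factor 2 turns the strict bounds \<open>b1\<close>, \<open>b2\<close>,
    \<open>b3\<close> into a closed range of step sizes.\<close>
  define h1 where "h1 = min b1 (min b2 b3) / (2 * v)"
  have k: "k \<ge> 1" "c1 * v ^ 3 \<le> k" "c2 * v\<^sup>2 \<le> k" "c3 * v\<^sup>2 \<le> k" by (auto simp: k_def)
  have h1: "h1 > 0" "v * h1 < b1" "v * h1 < b2" "v * h1 < b3"
    using 1(1) 2(1) 3(1) assms by (auto simp: h1_def min_def field_simps)
  show ?thesis
  proof (rule exI[of _ k], rule conjI[OF k(1)], rule exI[of _ h1], rule conjI[OF h1(1)], intro allI impI)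
    fix h :: real assume h: "0 < h" "h \<le> h1"
    have vh: "0 < v * h" "v * h \<le> v * h1" using h assms by auto
    hence b: "v * h < b1" "v * h < b2" "v * h < b3" using h1 by auto
    have m: "c1 * (v * h) ^ 3 \<le> k * h ^ 3" "c2 * (v * h)\<^sup>2 \<le> k * h\<^sup>2" "c3 * (v * h)\<^sup>2 \<le> k * h\<^sup>2"
      using mult_right_mono[OF k(2), of "h ^ 3"] mult_right_mono[OF k(3), of "h\<^sup>2"] mult_right_mono[OF k(4), of "h\<^sup>2"] h
      by (simp_all add: power_mult_distrib mult.assoc)
    show "\<bar>exp (- v * h) - (1 - v * h + v\<^sup>2 * h\<^sup>2 / 2)\<bar> \<le> k * h ^ 3 \<and>
      \<bar>(1 + v * h / 2) * exp (- v * h) - (1 - v * h / 2)\<bar> \<le> k * h\<^sup>2 \<and>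
      \<bar>(1 - v * h / 2) * exp (v * h) - (1 + v * h / 2)\<bar> \<le> k * h\<^sup>2"
      using order_trans[OF 1(2)[OF vh(1) b(1)] m(1)] order_trans[OF 2(2)[OF vh(1) b(2)] m(2)]
        order_trans[OF 3(2)[OF vh(1) b(3)] m(3)] by (simp add: power_mult_distrib)
  qed
qed

text \<open>The implicit equation is (1 + (h^2/2) A M) P = w with a perturbation of norm at most
  1/2; injectivity gives invertibility in finite dimension. The equivalence forces every sequence
  satisfying the scheme to follow \<open>G\<close>, and the last bound is the Neumann expansion of
  \<open>G\<close> up to h^4.\<close>

lemma implicit_solver:
  fixes A M :: "'p::euclidean_space \<Rightarrow> 'p" and h k :: real
  assumes A: "linear A" "\<And>x. norm (A x) \<le> k * norm x" and M: "linear M" "\<And>x. norm (M x) \<le> k * norm x"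
    and k: "k \<ge> 0" and h: "h\<^sup>2 * k\<^sup>2 \<le> 1"
  shows "\<exists>G. linear G \<and> (\<forall>P w. P + (h\<^sup>2 / 2) *\<^sub>R A (M P) = w \<longleftrightarrow> P = G w) \<and>
    (\<forall>w. norm (G w) \<le> 2 * norm w) \<and> (\<forall>w. norm (G w - w) \<le> h\<^sup>2 * k\<^sup>2 * norm w) \<and>
    (\<forall>w. norm (G w - w + (h\<^sup>2 / 2) *\<^sub>R A (M w)) \<le> h ^ 4 * k ^ 4 * norm w)"
proof -
  define T where "T = (\<lambda>P. P + (h\<^sup>2 / 2) *\<^sub>R A (M P))"
  have T: "linear T" unfolding T_def
    using linear_compose[OF M(1) A(1)] by (intro linear_compose_add linear_ident linear_compose_scale_right) (simp add: comp_def)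
  have AM: "norm ((h\<^sup>2 / 2) *\<^sub>R A (M x)) \<le> (h\<^sup>2 * k\<^sup>2 / 2) * norm x" for x
  proof -
    have "norm (A (M x)) \<le> k * (k * norm x)" using A(2)[of "M x"] mult_left_mono[OF M(2)[of x] k] by linarith
    hence "(h\<^sup>2 / 2) * norm (A (M x)) \<le> (h\<^sup>2 / 2) * (k * (k * norm x))" by (intro mult_left_mono) auto
    thus ?thesis by (simp add: power2_eq_square mult_ac)
  qed
  have lower: "norm x \<le> 2 * norm (T x)" for x
  proof -
    have "norm ((h\<^sup>2 / 2) *\<^sub>R A (M x)) \<le> (1 / 2) * norm x"
      using h by (intro order_trans[OF AM] mult_right_mono) auto
    moreover have "norm x \<le> norm (T x) + norm ((h\<^sup>2 / 2) *\<^sub>R A (M x))"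
      unfolding T_def using norm_triangle_ineq4[of "x + (h\<^sup>2 / 2) *\<^sub>R A (M x)" "(h\<^sup>2 / 2) *\<^sub>R A (M x)"] by simp
    ultimately show ?thesis by linarith
  qed
  have "inj T" unfolding linear_injective_0[OF T] using lower by (metis mult_zero_right norm_le_zero_iff norm_zero)
  from linear_injective_isomorphism[OF T this]
  obtain G where G: "linear G" "\<And>x. G (T x) = x" "\<And>x. T (G x) = x" by blast
  have n2: "norm (G w) \<le> 2 * norm w" for w using lower[of "G w"] G(3) by simp
  have Gw: "G w - w = - ((h\<^sup>2 / 2) *\<^sub>R A (M (G w)))" for w
    using G(3)[of w] unfolding T_def by (simp add: algebra_simps eq_neg_iff_add_eq_0)
  have n1: "norm (G w - w) \<le> h\<^sup>2 * k\<^sup>2 * norm w" for w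
  proof -
    have "norm (G w - w) \<le> (h\<^sup>2 * k\<^sup>2 / 2) * norm (G w)" unfolding Gw norm_minus_cancel by (rule AM)
    also have "\<dots> \<le> (h\<^sup>2 * k\<^sup>2 / 2) * (2 * norm w)" by (intro mult_left_mono n2) auto
    finally show ?thesis by simp
  qed
  have "norm (G w - w + (h\<^sup>2 / 2) *\<^sub>R A (M w)) \<le> h ^ 4 * k ^ 4 * norm w" for w
  proof -
    \<comment> \<open>The identity \<open>Gw\<close> is inserted into itself once, which produces a
      second factor h^2.\<close>
    have "G w - w + (h\<^sup>2 / 2) *\<^sub>R A (M w) = - ((h\<^sup>2 / 2) *\<^sub>R A (M (G w - w)))"
      unfolding Gw[of w] by (subst (2) Gw[of w, symmetric]) (simp add: linear_diff[OF M(1)] linear_diff[OF A(1)] scaleR_diff_right)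
    hence "norm (G w - w + (h\<^sup>2 / 2) *\<^sub>R A (M w)) \<le> (h\<^sup>2 * k\<^sup>2 / 2) * norm (G w - w)"
      using AM by simp
    also have "\<dots> \<le> (h\<^sup>2 * k\<^sup>2 / 2) * (h\<^sup>2 * k\<^sup>2 * norm w)" by (intro mult_left_mono n1) auto
    also have "\<dots> = (h ^ 4 * k ^ 4 * norm w) / 2" by (simp add: power2_eq_square power4_eq_xxxx)
    also have "\<dots> \<le> h ^ 4 * k ^ 4 * norm w" using k by simp
    finally show ?thesis .
  qed
  moreover have "P + (h\<^sup>2 / 2) *\<^sub>R A (M P) = w \<longleftrightarrow> P = G w" for P w
    using G(2)[of P] G(3)[of w] unfolding T_def by metis
  ultimately show ?thesis using G(1) n1 n2 by blast
qed

definition langevin_drift :: "('p::real_vector \<Rightarrow> 'p) \<Rightarrow> ('p \<Rightarrow> 'p) \<Rightarrow> real \<Rightarrow> 'p \<times> 'p \<Rightarrow> 'p \<times> 'p" where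
  "langevin_drift A M v = (\<lambda>(p, q). (- (v *\<^sub>R p) - A q, M p))"

text \<open>The noise-free part of the scheme after the shift, with \<open>G\<close> for the
  resolvent of the implicit equation. Since that equation is linear, drift and noise can be resolved
  separately.\<close>

definition scheme_step :: "('p::real_vector \<Rightarrow> 'p) \<Rightarrow> ('p \<Rightarrow> 'p) \<Rightarrow> real \<Rightarrow> ('p \<Rightarrow> 'p) \<Rightarrow> real \<Rightarrow> 'p \<times> 'p \<Rightarrow> 'p \<times> 'p" where
  "scheme_step A M v G h = (\<lambda>(p, q).
     let p' = G (exp (- v * h) *\<^sub>R p - (h * (1 + v * h / 2) * exp (- v * h)) *\<^sub>R A q)
     in (p', q + (h * (1 - v * h / 2) * exp (v * h)) *\<^sub>R M p' + (h\<^sup>2 / 2) *\<^sub>R M (A q)))"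

definition scheme_noise :: "('p::real_vector \<Rightarrow> 'p) \<Rightarrow> real \<Rightarrow> ('p \<Rightarrow> 'p) \<Rightarrow> real \<Rightarrow> 'p \<Rightarrow> 'p \<times> 'p" where
  "scheme_noise M v G h s =
     (let p' = - (((1 + v * h / 2) * exp (- v * h)) *\<^sub>R G s)
      in (p', (h * (1 - v * h / 2) * exp (v * h)) *\<^sub>R M p' + (h / 2) *\<^sub>R M s))"

lemma norm_scaleR_le: "\<bar>c\<bar> \<le> C \<Longrightarrow> norm y \<le> Y \<Longrightarrow> norm (c *\<^sub>R y) \<le> C * Y"
  by (simp only: norm_scaleR) (intro mult_mono, auto intro: order_trans[OF abs_ge_zero])

text \<open>Where the coefficients of the scheme come from: the implicit term supplies the A M part
  of B^2 in the momentum row, and 1 - v h/2 supplies its v A part. In the position row the momentum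
  is already updated, which puts in -(v h^2) M P and -(h^2) M A Q; the factor near 1 + v h/2 and the
  explicit (h^2/2) M A Q halve these, as B^2/2 requires.\<close>

lemma scheme_expansion:
  fixes A M :: "'p::euclidean_space \<Rightarrow> 'p"
  assumes A: "linear A" and M: "linear M" and v: "v > 0"
  defines "B \<equiv> langevin_drift A M v"
  shows "\<exists>\<kappa>\<ge>0. \<exists>h1>0. \<forall>h. 0 < h \<longrightarrow> h \<le> h1 \<longrightarrow> (\<exists>G. linear G \<and>
    (\<forall>P w. P + (h\<^sup>2 / 2) *\<^sub>R A (M P) = w \<longleftrightarrow> P = G w) \<and>
    (\<forall>x. norm (scheme_step A M v G h x - (x + h *\<^sub>R B x + (h\<^sup>2 / 2) *\<^sub>R B (B x))) \<le> \<kappa> * h ^ 3 * norm x) \<and>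
    (\<forall>s. norm (scheme_noise M v G h s - ((- s, 0) + (h / 2) *\<^sub>R B (- s, 0))) \<le> \<kappa> * h\<^sup>2 * norm s))"
proof -
  obtain kA where kA: "\<And>x. norm (A x) \<le> kA * norm x" using linear_bounded[OF A] by blast
  obtain kM where kM: "\<And>x. norm (M x) \<le> kM * norm x" using linear_bounded[OF M] by blast
  obtain ks hs where ks: "hs > 0" "\<And>h. 0 < h \<Longrightarrow> h \<le> hs \<Longrightarrow>
     \<bar>exp (- v * h) - (1 - v * h + v\<^sup>2 * h\<^sup>2 / 2)\<bar> \<le> ks * h ^ 3 \<and>
     \<bar>(1 + v * h / 2) * exp (- v * h) - (1 - v * h / 2)\<bar> \<le> ks * h\<^sup>2 \<and>
     \<bar>(1 - v * h / 2) * exp (v * h) - (1 + v * h / 2)\<bar> \<le> ks * h\<^sup>2"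
    using scheme_scalars[OF v] by blast
  define k where "k = Max {1, v, kA, kM, ks}"
  have k: "1 \<le> k" "v \<le> k" "kA \<le> k" "kM \<le> k" "ks \<le> k" unfolding k_def by (auto intro: Max_ge)
  have k0: "k \<ge> 0" "k > 0" using k by auto
  have nA: "norm (A x) \<le> k * norm x" and nM: "norm (M x) \<le> k * norm x" for x
    using kA[of x] kM[of x] mult_right_mono[OF k(3) norm_ge_zero[of x]] mult_right_mono[OF k(4) norm_ge_zero[of x]]
    by linarith+
  have kk: "k \<le> k * k" using k by (simp add: mult_le_cancel_left1)
  have k3: "1 \<le> 3 * k * k" "k \<le> 3 * k * k" using k kk by linarith+
  define c1 where "c1 = k + k * k + (k * k) * (3 * k * k) + k ^ 4 * (3 * k * k)"
  define c2 where "c2 = k * k + (1 + k) * (c1 + k * k) + k * (6 * k * k)"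
  define c3 where "c3 = 3 * k * (k * k) + k + k * (9 * k * k * (k * k) + k * k)"
  \<comment> \<open>The first entry serves the step, with a factor 2 because |P| + |Q| is at most
    twice the norm of the pair; \<open>c3\<close> serves the noise.\<close>
  define \<kappa> where "\<kappa> = max (2 * (c1 + k * c2)) c3"
  define h1 where "h1 = min hs (min 1 (1 / k))"
  have c0: "c1 \<ge> 0" "c2 \<ge> 0" unfolding c1_def c2_def using k0 by auto
  have \<kappa>0: "\<kappa> \<ge> 0" "2 * (c1 + k * c2) \<le> \<kappa>" "c3 \<le> \<kappa>"
    unfolding \<kappa>_def using c0 k0 by (auto simp: le_max_iff_disj)
  have h1: "h1 > 0" unfolding h1_def using ks k0 by simp
  show ?thesis
  proof (rule exI[of _ \<kappa>], rule conjI[OF \<kappa>0(1)], rule exI[of _ h1], rule conjI[OF h1], intro allI impI)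
    fix h :: real assume h: "0 < h" "h \<le> h1"
    have hle: "h \<le> 1" "h \<le> hs" "h * k \<le> 1"
    proof -
      show "h \<le> 1" "h \<le> hs" using h by (auto simp: h1_def)
      have "h \<le> 1 / k" using h by (auto simp: h1_def)
      thus "h * k \<le> 1" using k0 by (simp add: field_simps)
    qed
    have hk: "h\<^sup>2 * k\<^sup>2 \<le> 1"
    proof -
      have "(h * k)\<^sup>2 \<le> 1" using hle h k0 by (intro power_le_one) auto
      thus ?thesis by (simp add: power_mult_distrib)
    qed
    have hp: "h ^ 4 \<le> h ^ 3" "h ^ 3 \<le> h\<^sup>2" "h\<^sup>2 \<le> h" "0 \<le> h ^ 3"
      using h hle power_decreasing[of 3 4 h] power_decreasing[of 2 3 h] power_decreasing[of 1 2 h] by auto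
    obtain G where G: "linear G" and Geq: "\<forall>P w. P + (h\<^sup>2 / 2) *\<^sub>R A (M P) = w \<longleftrightarrow> P = G w"
      and G2: "\<And>w. norm (G w) \<le> 2 * norm w" and G1: "\<And>w. norm (G w - w) \<le> h\<^sup>2 * k\<^sup>2 * norm w"
      and Gr: "\<And>w. norm (G w - w + (h\<^sup>2 / 2) *\<^sub>R A (M w)) \<le> h ^ 4 * k ^ 4 * norm w"
      using implicit_solver[OF A nA M nM k0(1) hk] by blast
    define \<alpha> \<gamma> \<theta> where "\<alpha> = exp (- v * h)" and "\<gamma> = (1 + v * h / 2) * exp (- v * h)" and "\<theta> = (1 - v * h / 2) * exp (v * h)"
    define ea eg et where "ea = \<alpha> - (1 - v * h + v\<^sup>2 * h\<^sup>2 / 2)" and "eg = \<gamma> - (1 - v * h / 2)" and "et = \<theta> - (1 + v * h / 2)"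
    have e: "\<bar>ea\<bar> \<le> k * h ^ 3" "\<bar>eg\<bar> \<le> k * h\<^sup>2" "\<bar>et\<bar> \<le> k * h\<^sup>2"
    proof -
      have "ks * h ^ 3 \<le> k * h ^ 3" "ks * h\<^sup>2 \<le> k * h\<^sup>2" using k hp by (auto intro!: mult_right_mono)
      thus "\<bar>ea\<bar> \<le> k * h ^ 3" "\<bar>eg\<bar> \<le> k * h\<^sup>2" "\<bar>et\<bar> \<le> k * h\<^sup>2"
        using ks(2)[OF h(1) hle(2)] unfolding ea_def eg_def et_def \<alpha>_def \<gamma>_def \<theta>_def by linarith+
    qed
    have vh: "0 \<le> v * h" "v * h \<le> k * h" "v * h \<le> k" "k * h\<^sup>2 \<le> k"
    proof -
      show "0 \<le> v * h" "v * h \<le> k * h" using v h k by (auto intro: mult_right_mono)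
      show "v * h \<le> k" using mult_mono[of v k h 1] v h k hle by simp
      show "k * h\<^sup>2 \<le> k" using k0 hp hle by (simp add: mult_le_cancel_left1)
    qed
    have \<gamma>: "\<bar>\<gamma>\<bar> \<le> 3 * k" and \<theta>: "\<bar>\<theta>\<bar> \<le> 3 * k"
      using e vh k(1) unfolding eg_def et_def by linarith+
    have \<alpha>: "\<bar>\<alpha>\<bar> \<le> 1" "\<bar>\<alpha> - 1\<bar> \<le> k * h"
      using vh exp_ge_add_one_self[of "- v * h"] by (auto simp: \<alpha>_def)
    \<comment> \<open>The exponentials cancel, so the noise reaching the position through the
      momentum has size h up to order h^3; the explicit term h/2 of opposite sign leaves the
      required half.\<close>
    have \<theta>\<gamma>: "\<theta> * \<gamma> = 1 - v\<^sup>2 * h\<^sup>2 / 4"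
      unfolding \<theta>_def \<gamma>_def by (simp add: exp_minus field_simps power2_eq_square)
    show "\<exists>G. linear G \<and>
      (\<forall>P w. P + (h\<^sup>2 / 2) *\<^sub>R A (M P) = w \<longleftrightarrow> P = G w) \<and>
      (\<forall>x. norm (scheme_step A M v G h x - (x + h *\<^sub>R B x + (h\<^sup>2 / 2) *\<^sub>R B (B x))) \<le> \<kappa> * h ^ 3 * norm x) \<and>
      (\<forall>s. norm (scheme_noise M v G h s - ((- s, 0) + (h / 2) *\<^sub>R B (- s, 0))) \<le> \<kappa> * h\<^sup>2 * norm s)"
    proof (intro exI[of _ G] conjI allI G)
      show "(P + (h\<^sup>2 / 2) *\<^sub>R A (M P) = w) = (P = G w)" for P w using Geq by blast
    next
      fix x :: "'p \<times> 'p"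
      obtain P Q where x: "x = (P, Q)" by (cases x)
      define n where "n = norm P + norm Q"
      have n: "norm P \<le> n" "norm Q \<le> n" "n \<ge> 0" "n \<le> 2 * norm x"
        unfolding n_def x using norm_fst_le[of P Q] norm_snd_le[of Q P] by auto
      define w where "w = \<alpha> *\<^sub>R P - (h * \<gamma>) *\<^sub>R A Q"
      define P' where "P' = G w"
      define r where "r = G w - w + (h\<^sup>2 / 2) *\<^sub>R A (M w)"
      have hAQ: "norm (A Q) \<le> k * norm Q" by (rule nA)
      have gAQ: "norm ((h * \<gamma>) *\<^sub>R A Q) \<le> h * ((3 * k) * (k * norm Q))"
      proof -
        have "norm ((h * \<gamma>) *\<^sub>R A Q) = h * (\<bar>\<gamma>\<bar> * norm (A Q))" using h by (simp add: abs_mult)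
        also have "\<dots> \<le> h * ((3 * k) * (k * norm Q))"
          using h k0 by (intro mult_left_mono[OF mult_mono] \<gamma> nA) auto
        finally show ?thesis .
      qed
      have nw: "norm w \<le> (3 * k * k) * n"
      proof -
        have "norm w \<le> 1 * norm P + 1 * ((3 * k) * (k * norm Q))"
          unfolding w_def
        proof (intro order_trans[OF norm_triangle_ineq4] add_mono order_trans[OF gAQ])
          show "norm (\<alpha> *\<^sub>R P) \<le> 1 * norm P" using mult_right_mono[OF \<alpha>(1), of "norm P"] by simp
          show "h * ((3 * k) * (k * norm Q)) \<le> 1 * ((3 * k) * (k * norm Q))"
            using hle k0 by (intro mult_right_mono) auto
        qed
        also have "\<dots> \<le> (3 * k * k) * norm P + (3 * k * k) * norm Q"
          using k3 by (intro add_mono mult_right_mono) auto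
        finally show ?thesis by (simp add: n_def algebra_simps)
      qed
      have nwP: "norm (w - P) \<le> h * ((3 * k * k) * n)"
      proof -
        have "w - P = (\<alpha> - 1) *\<^sub>R P - (h * \<gamma>) *\<^sub>R A Q" unfolding w_def by (simp add: algebra_simps)
        also have "norm \<dots> \<le> (k * h) * norm P + h * ((3 * k) * (k * norm Q))"
          using \<alpha> by (intro order_trans[OF norm_triangle_ineq4] add_mono gAQ) (auto intro: mult_right_mono)
        also have "\<dots> \<le> ((3 * k * k) * h) * norm P + h * ((3 * k) * (k * norm Q))"
          using k3 h by (intro add_mono mult_right_mono order_refl) auto
        finally show ?thesis by (simp add: n_def algebra_simps)
      qed
      have nAM: "norm (A (M y)) \<le> (k * k) * norm y" for y
        using nA[of "M y"] mult_left_mono[OF nM[of y] k0(1)] by (simp add: mult.assoc)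
      define D1 where "D1 = P' - (P + h *\<^sub>R (- (v *\<^sub>R P) - A Q) + (h\<^sup>2 / 2) *\<^sub>R (v\<^sup>2 *\<^sub>R P + v *\<^sub>R A Q - A (M P)))"
      have D1_eq: "D1 = ea *\<^sub>R P - (h * eg) *\<^sub>R A Q - (h\<^sup>2 / 2) *\<^sub>R A (M (w - P)) + r"
      proof -
        define z where "z = A (M (w - P))"
        have 1: "w = (1 - v * h + v\<^sup>2 * h\<^sup>2 / 2) *\<^sub>R P + ea *\<^sub>R P - (h * (1 - v * h / 2)) *\<^sub>R A Q - (h * eg) *\<^sub>R A Q"
          unfolding w_def ea_def eg_def by (simp add: algebra_simps)
        have 2: "P' = r + w - (h\<^sup>2 / 2) *\<^sub>R A (M w)" unfolding P'_def r_def by simp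
        have 3: "A (M w) = A (M P) + z" unfolding z_def by (simp add: linear_diff[OF M] linear_diff[OF A])
        have "D1 = r + w - (h\<^sup>2 / 2) *\<^sub>R (A (M P) + z) - (P + h *\<^sub>R (- (v *\<^sub>R P) - A Q) + (h\<^sup>2 / 2) *\<^sub>R (v\<^sup>2 *\<^sub>R P + v *\<^sub>R A Q - A (M P)))"
          unfolding D1_def 2 3 ..
        also have "\<dots> = ea *\<^sub>R P - (h * eg) *\<^sub>R A Q - (h\<^sup>2 / 2) *\<^sub>R z + r"
          unfolding 1 by (simp add: algebra_simps power2_eq_square)
        finally show ?thesis unfolding z_def .
      qed
      have nD1: "norm D1 \<le> c1 * h ^ 3 * n"
      proof -
        have "norm (ea *\<^sub>R P) \<le> (k * h ^ 3) * n" by (intro norm_scaleR_le e n)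
        moreover have "norm ((h * eg) *\<^sub>R A Q) \<le> (h * (k * h\<^sup>2)) * (k * n)"
        proof (rule norm_scaleR_le)
          show "\<bar>h * eg\<bar> \<le> h * (k * h\<^sup>2)" using e h by (simp add: abs_mult)
          show "norm (A Q) \<le> k * n" using hAQ mult_left_mono[OF n(2) k0(1)] by linarith
        qed
        moreover have "norm ((h\<^sup>2 / 2) *\<^sub>R A (M (w - P))) \<le> h\<^sup>2 * ((k * k) * (h * ((3 * k * k) * n)))"
          using order_trans[OF nAM[of "w - P"] mult_left_mono[OF nwP, of "k * k"]] k0 by (intro norm_scaleR_le) auto
        moreover have "norm r \<le> h ^ 3 * k ^ 4 * ((3 * k * k) * n)"
          unfolding r_def using nw hp k0 h by (intro order_trans[OF Gr] mult_mono) auto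
        ultimately have "norm D1 \<le> (k * h ^ 3) * n + (h * (k * h\<^sup>2)) * (k * n) + h\<^sup>2 * ((k * k) * (h * ((3 * k * k) * n))) + h ^ 3 * k ^ 4 * ((3 * k * k) * n)"
          unfolding D1_eq by (intro norm_triangle_le order_trans[OF norm_triangle_ineq4] add_mono) auto
        also have "\<dots> = c1 * h ^ 3 * n" unfolding c1_def by (simp add: algebra_simps power2_eq_square power3_eq_cube)
        finally show ?thesis .
      qed
      \<comment> \<open>The new momentum to first order only. This precision suffices in the
        position row, where the momentum is multiplied by h.\<close>
      define d where "d = P' - (P - (v * h) *\<^sub>R P - h *\<^sub>R A Q)"
      have nd: "norm d \<le> h\<^sup>2 * ((c1 + k * k) * n)"
      proof -
        have vv: "v\<^sup>2 \<le> k * k" using v k by (auto simp: power2_eq_square intro!: mult_mono)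
        have "norm (v\<^sup>2 *\<^sub>R P + v *\<^sub>R A Q - A (M P)) \<le> ((k * k) * norm P + k * (k * norm Q)) + (k * k) * norm P"
          using vv v k
          by (intro order_trans[OF norm_triangle_ineq4] norm_triangle_le add_mono norm_scaleR_le hAQ nAM order_refl) auto
        also have "\<dots> \<le> 2 * (k * k * n)" unfolding n_def using k0 by (simp add: algebra_simps)
        finally have b: "norm ((h\<^sup>2 / 2) *\<^sub>R (v\<^sup>2 *\<^sub>R P + v *\<^sub>R A Q - A (M P))) \<le> (h\<^sup>2 / 2) * (2 * (k * k * n))"
          by (intro norm_scaleR_le) auto
        have "d = D1 + (h\<^sup>2 / 2) *\<^sub>R (v\<^sup>2 *\<^sub>R P + v *\<^sub>R A Q - A (M P))"
          unfolding d_def D1_def by (simp add: algebra_simps)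
        also have "norm \<dots> \<le> c1 * h\<^sup>2 * n + (h\<^sup>2 / 2) * (2 * (k * k * n))"
          using hp c0 n by (intro norm_triangle_le add_mono order_trans[OF nD1] b mult_right_mono mult_left_mono) auto
        finally show ?thesis by (simp add: algebra_simps)
      qed
      have nP': "norm P' \<le> (6 * k * k) * n" unfolding P'_def using G2[of w] nw by linarith
      \<comment> \<open>Chosen so that the defect of the position row is exactly
        \<open>h *\<^sub>R M E\<close>. The terms of order 1 and h cancel because (1 + v h/2)(1 - v
        h) equals 1 - v h/2 up to h^2.\<close>
      define E where "E = \<theta> *\<^sub>R P' - P + (v * h / 2) *\<^sub>R P + h *\<^sub>R A Q"
      have E_eq: "E = - ((v\<^sup>2 * h\<^sup>2 / 2) *\<^sub>R P) - (v * h\<^sup>2 / 2) *\<^sub>R A Q + (1 + v * h / 2) *\<^sub>R d + et *\<^sub>R P'"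
      proof -
        define s where "s = v * h / 2"
        have s: "v * h = s + s" "v\<^sup>2 * h\<^sup>2 / 2 = s * s + s * s" "v * h\<^sup>2 / 2 = s * h"
          by (simp_all add: s_def power2_eq_square)
        have "\<theta> *\<^sub>R P' = (1 + s) *\<^sub>R P' + et *\<^sub>R P'" unfolding et_def s_def by (simp add: algebra_simps)
        moreover have "P' = d + (P - (s *\<^sub>R P + s *\<^sub>R P) - h *\<^sub>R A Q)" unfolding d_def s(1) scaleR_left_distrib by simp
        hence "(1 + s) *\<^sub>R P' = (1 + s) *\<^sub>R (d + (P - (s *\<^sub>R P + s *\<^sub>R P) - h *\<^sub>R A Q))" by simp
        ultimately have "E = (1 + s) *\<^sub>R (d + (P - (s *\<^sub>R P + s *\<^sub>R P) - h *\<^sub>R A Q)) + et *\<^sub>R P' - P + s *\<^sub>R P + h *\<^sub>R A Q"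
          unfolding E_def s_def by simp
        thus ?thesis unfolding s s_def[symmetric] scaleR_left_distrib by (simp add: algebra_simps)
      qed
      have nE: "norm E \<le> h\<^sup>2 * (c2 * n)"
      proof -
        have vv: "v\<^sup>2 / 2 \<le> k * k" using mult_mono[OF k(2) k(2) k0(1) less_imp_le[OF v]] zero_le_square[of k] unfolding power2_eq_square by linarith
        have "norm ((v\<^sup>2 * h\<^sup>2 / 2) *\<^sub>R P) \<le> (h\<^sup>2 * (k * k)) * norm P"
          using mult_left_mono[OF vv, of "h\<^sup>2"] by (intro norm_scaleR_le) (auto simp: mult_ac abs_mult)
        moreover have "norm ((v * h\<^sup>2 / 2) *\<^sub>R A Q) \<le> (h\<^sup>2 * k) * (k * norm Q)"
        proof -
          have "\<bar>v * h\<^sup>2 / 2\<bar> \<le> h\<^sup>2 * k" using v k mult_left_mono[of "v / 2" k "h\<^sup>2"] by (simp add: mult_ac abs_mult)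
          thus ?thesis using hAQ by (rule norm_scaleR_le)
        qed
        moreover have "norm ((1 + v * h / 2) *\<^sub>R d) \<le> (1 + k) * (h\<^sup>2 * ((c1 + k * k) * n))"
          using nd vh by (intro norm_scaleR_le) auto
        moreover have "norm (et *\<^sub>R P') \<le> (k * h\<^sup>2) * ((6 * k * k) * n)"
          by (intro norm_scaleR_le nP' e)
        ultimately have "norm E \<le> (h\<^sup>2 * (k * k)) * norm P + (h\<^sup>2 * k) * (k * norm Q) + (1 + k) * (h\<^sup>2 * ((c1 + k * k) * n)) + (k * h\<^sup>2) * ((6 * k * k) * n)"
          unfolding E_eq by (intro norm_triangle_le order_trans[OF norm_triangle_ineq4] add_mono) auto
        also have "\<dots> = h\<^sup>2 * (c2 * n)" unfolding c2_def n_def by (simp add: algebra_simps)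
        finally show ?thesis .
      qed
      have D2: "Q + (h * \<theta>) *\<^sub>R M P' + (h\<^sup>2 / 2) *\<^sub>R M (A Q)
          - (Q + h *\<^sub>R M P + (h\<^sup>2 / 2) *\<^sub>R M (- (v *\<^sub>R P) - A Q)) = h *\<^sub>R M E"
        unfolding E_def linear_add[OF M] linear_diff[OF M] linear_cmul[OF M] linear_neg[OF M]
        by (simp add: algebra_simps power2_eq_square) (simp flip: scaleR_left_distrib)
      have "scheme_step A M v G h x - (x + h *\<^sub>R B x + (h\<^sup>2 / 2) *\<^sub>R B (B x)) = (D1, h *\<^sub>R M E)"
      proof -
        have "scheme_step A M v G h x = (P', Q + (h * \<theta>) *\<^sub>R M P' + (h\<^sup>2 / 2) *\<^sub>R M (A Q))"
          unfolding scheme_step_def x P'_def w_def \<alpha>_def \<gamma>_def \<theta>_def by (simp add: Let_def mult.assoc)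
        moreover have "B x = (- (v *\<^sub>R P) - A Q, M P)" unfolding B_def langevin_drift_def x by simp
        moreover have "B (- (v *\<^sub>R P) - A Q, M P) = (v\<^sup>2 *\<^sub>R P + v *\<^sub>R A Q - A (M P), M (- (v *\<^sub>R P) - A Q))"
          unfolding B_def langevin_drift_def by (simp add: algebra_simps power2_eq_square)
        ultimately show ?thesis using D2 unfolding D1_def x by simp
      qed
      also have "norm \<dots> \<le> norm D1 + norm (h *\<^sub>R M E)" by (rule norm_Pair_le)
      also have "\<dots> \<le> c1 * h ^ 3 * n + h * (k * (h\<^sup>2 * (c2 * n)))"
        using nD1 h order_trans[OF nM[of E] mult_left_mono[OF nE k0(1)]] by (intro add_mono norm_scaleR_le) auto
      also have "\<dots> = ((c1 + k * c2) * h ^ 3) * n" by (simp add: algebra_simps power2_eq_square power3_eq_cube)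
      also have "\<dots> \<le> ((c1 + k * c2) * h ^ 3) * (2 * norm x)" using n c0 k0 hp by (intro mult_left_mono) auto
      also have "\<dots> = (2 * (c1 + k * c2)) * (h ^ 3 * norm x)" by simp
      also have "\<dots> \<le> \<kappa> * (h ^ 3 * norm x)" using \<kappa>0 hp by (intro mult_right_mono) auto
      finally show "norm (scheme_step A M v G h x - (x + h *\<^sub>R B x + (h\<^sup>2 / 2) *\<^sub>R B (B x))) \<le> \<kappa> * h ^ 3 * norm x"
        by (simp add: mult.assoc)
    next
      fix s :: 'p
      define P' where "P' = - (\<gamma> *\<^sub>R G s)"
      define D1 where "D1 = - (\<gamma> *\<^sub>R (G s - s)) - eg *\<^sub>R s"
      define E where "E = - ((\<theta> * \<gamma>) *\<^sub>R (G s - s)) + (1 - \<theta> * \<gamma>) *\<^sub>R s"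
      have Gs: "norm (G s - s) \<le> h\<^sup>2 * (k * k) * norm s" using G1[of s] by (simp add: power2_eq_square)
      have nD1: "norm D1 \<le> h\<^sup>2 * ((3 * k * (k * k) + k) * norm s)"
      proof -
        have "norm (\<gamma> *\<^sub>R (G s - s)) \<le> (3 * k) * (h\<^sup>2 * (k * k) * norm s)"
          by (intro norm_scaleR_le Gs \<gamma>)
        moreover have "norm (eg *\<^sub>R s) \<le> (k * h\<^sup>2) * norm s" by (intro norm_scaleR_le e order_refl)
        ultimately have "norm D1 \<le> (3 * k) * (h\<^sup>2 * (k * k) * norm s) + (k * h\<^sup>2) * norm s"
          unfolding D1_def by (intro order_trans[OF norm_triangle_ineq4] add_mono) auto
        thus ?thesis by (simp add: algebra_simps)
      qed
      have nE: "norm E \<le> h\<^sup>2 * ((9 * k * k * (k * k) + k * k) * norm s)"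
      proof -
        have "\<bar>\<theta> * \<gamma>\<bar> \<le> (3 * k) * (3 * k)" unfolding abs_mult using \<theta> \<gamma> k0 by (intro mult_mono) auto
        hence "norm ((\<theta> * \<gamma>) *\<^sub>R (G s - s)) \<le> ((3 * k) * (3 * k)) * (h\<^sup>2 * (k * k) * norm s)"
          using Gs by (rule norm_scaleR_le)
        moreover have "norm ((1 - \<theta> * \<gamma>) *\<^sub>R s) \<le> (k * k * h\<^sup>2) * norm s"
        proof -
          have "v\<^sup>2 / 4 \<le> k * k" using mult_mono[OF k(2) k(2) k0(1) less_imp_le[OF v]] zero_le_square[of k] unfolding power2_eq_square by linarith
          hence "v\<^sup>2 / 4 * h\<^sup>2 \<le> k * k * h\<^sup>2" by (intro mult_right_mono) auto
          thus ?thesis unfolding \<theta>\<gamma> by (intro norm_scaleR_le) auto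
        qed
        ultimately have "norm E \<le> ((3 * k) * (3 * k)) * (h\<^sup>2 * (k * k) * norm s) + (k * k * h\<^sup>2) * norm s"
          unfolding E_def by (intro norm_triangle_le add_mono) auto
        thus ?thesis by (simp add: algebra_simps)
      qed
      have "scheme_noise M v G h s - ((- s, 0) + (h / 2) *\<^sub>R B (- s, 0)) = (D1, h *\<^sub>R M E)"
      proof -
        have "scheme_noise M v G h s = (P', (h * \<theta>) *\<^sub>R M P' + (h / 2) *\<^sub>R M s)"
          unfolding scheme_noise_def P'_def \<gamma>_def \<theta>_def by (simp add: Let_def mult.assoc)
        moreover have "B (- s, 0) = (v *\<^sub>R s, - M s)"
          unfolding B_def langevin_drift_def by (simp add: linear_0[OF A] linear_neg[OF M])
        moreover have "P' - (- s + (h / 2) *\<^sub>R v *\<^sub>R s) = D1" unfolding P'_def D1_def eg_def by (simp add: algebra_simps)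
        moreover have "(h * \<theta>) *\<^sub>R M P' + (h / 2) *\<^sub>R M s - (h / 2) *\<^sub>R (- M s) = h *\<^sub>R M E"
        proof -
          have "E = \<theta> *\<^sub>R P' + s" unfolding E_def P'_def by (simp add: algebra_simps)
          hence "h *\<^sub>R M E = (h * \<theta>) *\<^sub>R M P' + h *\<^sub>R M s" by (simp add: linear_add[OF M] linear_cmul[OF M] scaleR_add_right)
          moreover have "(h / 2) *\<^sub>R M s + (h / 2) *\<^sub>R M s = h *\<^sub>R M s" by (simp flip: scaleR_left_distrib)
          ultimately show ?thesis by simp
        qed
        ultimately show ?thesis by simp
      qed
      also have "norm \<dots> \<le> norm D1 + norm (h *\<^sub>R M E)" by (rule norm_Pair_le)
      also have "\<dots> \<le> h\<^sup>2 * ((3 * k * (k * k) + k) * norm s) + 1 * (k * (h\<^sup>2 * ((9 * k * k * (k * k) + k * k) * norm s)))"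
        using nD1 h hle order_trans[OF nM[of E] mult_left_mono[OF nE k0(1)]] by (intro add_mono norm_scaleR_le) auto
      also have "\<dots> = c3 * (h\<^sup>2 * norm s)" unfolding c3_def by (simp add: algebra_simps)
      also have "\<dots> \<le> \<kappa> * (h\<^sup>2 * norm s)" using \<kappa>0 by (intro mult_right_mono) auto
      finally show "norm (scheme_noise M v G h s - ((- s, 0) + (h / 2) *\<^sub>R B (- s, 0))) \<le> \<kappa> * h\<^sup>2 * norm s"
        by (simp add: mult.assoc)
    qed
  qed
qed

section \<open>The Langevin equation\<close>

text \<open>The quadratic form attains a positive minimum on the compact unit sphere; homogeneity
  extends the bound to all vectors.\<close>

lemma posdef_coercive:
  fixes A :: "'p::euclidean_space \<Rightarrow> 'p"
  assumes A: "linear A" and pos: "\<And>x. x \<noteq> 0 \<Longrightarrow> x \<bullet> A x > 0"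
  shows "\<exists>a>0. \<forall>x. a * (norm x)\<^sup>2 \<le> x \<bullet> A x"
proof -
  have c: "continuous_on (sphere 0 1) (\<lambda>x. x \<bullet> A x)"
    using A by (intro continuous_intros linear_continuous_on) (simp add: linear_conv_bounded_linear)
  obtain u :: 'p where "u \<in> Basis" using nonempty_Basis by blast
  hence "sphere 0 1 \<noteq> ({} :: 'p set)" by (auto intro!: exI[of _ u])
  from continuous_attains_inf[OF compact_sphere this c]
  obtain y where y: "norm y = 1" "\<And>x. norm x = 1 \<Longrightarrow> y \<bullet> A y \<le> x \<bullet> A x" by auto
  have "(y \<bullet> A y) * (norm x)\<^sup>2 \<le> x \<bullet> A x" for x
  proof (cases "x = 0")
    case False
    define e where "e = x /\<^sub>R norm x"
    have x: "x = norm x *\<^sub>R e" and e: "norm e = 1" using False by (simp_all add: e_def)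
    have "x \<bullet> A x = (norm x)\<^sup>2 * (e \<bullet> A e)"
      by (subst (1 2) x) (simp add: linear_cmul[OF A] power2_eq_square)
    thus ?thesis using y(2)[OF e] mult_left_mono[of "y \<bullet> A y" "e \<bullet> A e" "(norm x)\<^sup>2"] by (simp add: mult.commute)
  qed (simp add: linear_0[OF A])
  moreover have "y \<bullet> A y > 0" using y(1) by (intro pos) auto
  ultimately show ?thesis by blast
qed

lemma linear_langevin_drift: "linear A \<Longrightarrow> linear M \<Longrightarrow> linear (langevin_drift A M v)"
  unfolding langevin_drift_def linear_iff by (auto simp: algebra_simps)

text \<open>The energy \<open>(p \<bullet> M p + q \<bullet> A q) / 2\<close> dissipates only through \<open>p\<close>; the small cross term
  \<open>\<epsilon> p \<bullet> q\<close> transfers the dissipation to \<open>q\<close>.\<close>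

lemma langevin_lyapunov:
  fixes A M :: "'p::euclidean_space \<Rightarrow> 'p"
  assumes A: "linear A" "\<And>x y. A x \<bullet> y = x \<bullet> A y" "a > 0" "\<And>x. a * (norm x)\<^sup>2 \<le> x \<bullet> A x"
    and M: "linear M" "\<And>x y. M x \<bullet> y = x \<bullet> M y" "m > 0" "\<And>x. m * (norm x)\<^sup>2 \<le> x \<bullet> M x"
    and v: "v > 0"
  shows "\<exists>V lam v0. lyapunov (langevin_drift A M v) V lam v0"
proof -
  \<comment> \<open>The first entry keeps the cross term below a quarter of
    \<open>p \<bullet> M p + q \<bullet> A q\<close>, so \<open>V\<close> stays equivalent to the
    energy. The second ensures that what the cross term adds in the momentum, directly and through
    Young's inequality, is at most half of the friction.\<close>
  define \<epsilon> where "\<epsilon> = min (min m a / 2) ((v / 2) / (1 + v\<^sup>2 / (2 * a * m)))"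
  have den: "1 + v\<^sup>2 / (2 * a * m) > 0" using A(3) M(3) by (simp add: add_pos_nonneg)
  have \<epsilon>: "\<epsilon> > 0" "\<epsilon> \<le> m / 2" "\<epsilon> \<le> a / 2" "\<epsilon> * (1 + v\<^sup>2 / (2 * a * m)) \<le> v / 2"
  proof -
    show "\<epsilon> > 0" unfolding \<epsilon>_def using A(3) M(3) v den by simp
    have "\<epsilon> \<le> min m a / 2" unfolding \<epsilon>_def by (rule min.cobounded1)
    thus "\<epsilon> \<le> m / 2" "\<epsilon> \<le> a / 2" using min.cobounded1[of m a] min.cobounded2[of m a] by linarith+
    have "\<epsilon> \<le> (v / 2) / (1 + v\<^sup>2 / (2 * a * m))" unfolding \<epsilon>_def by simp
    thus "\<epsilon> * (1 + v\<^sup>2 / (2 * a * m)) \<le> v / 2" using den by (simp only: pos_le_divide_eq)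
  qed
  define V where "V = (\<lambda>x y. (fst x \<bullet> M (fst y) + snd x \<bullet> A (snd y)) / 2 + \<epsilon> / 2 * (fst x \<bullet> snd y + snd x \<bullet> fst y))"
  define lam where "lam = min v \<epsilon> / 4"
  define v0 where "v0 = min m a / 4"
  have "lyapunov (langevin_drift A M v) V lam v0"
  proof (rule lyapunov.intro)
    show "linear (langevin_drift A M v)" by (rule linear_langevin_drift[OF A(1) M(1)])
    show "bilinear V" unfolding bilinear_def linear_iff V_def
      by (simp add: inner_add_left inner_add_right linear_add[OF A(1)] linear_add[OF M(1)]
          linear_cmul[OF A(1)] linear_cmul[OF M(1)] algebra_simps add_divide_distrib)
    show "V x y = V y x" for x y
      unfolding V_def using A(2)[of "snd x" "snd y"] M(2)[of "fst x" "fst y"] by (simp add: inner_commute)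
    show "v0 > 0" unfolding v0_def using A(3) M(3) by simp
    show "lam > 0" unfolding lam_def using v \<epsilon> by simp
    fix x :: "'p \<times> 'p"
    obtain p q where x: "x = (p, q)" by (cases x)
    define E where "E = p \<bullet> M p + q \<bullet> A q"
    define P2 Q2 where "P2 = (norm p)\<^sup>2" and "Q2 = (norm q)\<^sup>2"
    have pq2: "2 * \<bar>p \<bullet> q\<bar> \<le> P2 + Q2"
    proof -
      have "2 * (norm p * norm q) \<le> P2 + Q2" unfolding P2_def Q2_def
        using sum_squares_bound[of "norm p" "norm q"] by simp
      thus ?thesis using Cauchy_Schwarz_ineq2[of p q] by linarith
    qed
    have coer: "m * P2 \<le> p \<bullet> M p" "a * Q2 \<le> q \<bullet> A q" using A(4) M(4) by (auto simp: P2_def Q2_def)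
    have nn: "P2 \<ge> 0" "Q2 \<ge> 0" "p \<bullet> M p \<ge> 0" "q \<bullet> A q \<ge> 0"
    proof -
      show "P2 \<ge> 0" "Q2 \<ge> 0" by (auto simp: P2_def Q2_def)
      thus "p \<bullet> M p \<ge> 0" "q \<bullet> A q \<ge> 0" using coer A(3) M(3) by (meson mult_nonneg_nonneg less_imp_le order_trans)+
    qed
    have V: "V x x = E / 2 + \<epsilon> * (p \<bullet> q)" by (simp add: V_def E_def x inner_commute)
    have cross: "\<epsilon> * \<bar>p \<bullet> q\<bar> \<le> E / 4"
    proof -
      have "\<epsilon> * (2 * \<bar>p \<bullet> q\<bar>) \<le> \<epsilon> * P2 + \<epsilon> * Q2"
        using mult_left_mono[OF pq2, of \<epsilon>] \<epsilon>(1) by (simp add: distrib_left)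
      also have "\<dots> \<le> m / 2 * P2 + a / 2 * Q2" using \<epsilon> nn by (intro add_mono mult_right_mono; simp)
      also have "\<dots> = (m * P2 + a * Q2) / 2" by (simp add: add_divide_distrib)
      also have "\<dots> \<le> E / 2" using coer unfolding E_def by simp
      finally show ?thesis by simp
    qed
    have ab: "\<epsilon> * (p \<bullet> q) \<le> \<epsilon> * \<bar>p \<bullet> q\<bar>" "- (\<epsilon> * (p \<bullet> q)) \<le> \<epsilon> * \<bar>p \<bullet> q\<bar>"
      using \<epsilon> by (auto simp: abs_if)
    have VE: "E / 4 \<le> V x x" "V x x \<le> 3 * E / 4" using V cross ab by linarith+
    have "(norm x)\<^sup>2 = P2 + Q2" by (simp add: x norm_Pair P2_def Q2_def)
    moreover have "min m a * P2 \<le> m * P2" "min m a * Q2 \<le> a * Q2" using nn by (auto intro!: mult_right_mono)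
    ultimately have "min m a * (norm x)\<^sup>2 \<le> E" using coer unfolding E_def by (simp add: distrib_left)
    thus "v0 * (norm x)\<^sup>2 \<le> V x x" using VE(1) unfolding v0_def by simp
    \<comment> \<open>The Hamiltonian coupling cancels by the symmetry of \<open>A\<close> and
      \<open>M\<close>. The cross term produces the missing dissipation in \<open>q\<close>, at the
      price of a term in \<open>p \<bullet> M p\<close> and of the mixed product
      \<open>p \<bullet> q\<close>.\<close>
    have LV: "2 * V x (langevin_drift A M v x) = - (v * (p \<bullet> M p)) + \<epsilon> * (p \<bullet> M p) - \<epsilon> * (q \<bullet> A q) - \<epsilon> * (v * (p \<bullet> q))"
    proof -
      have "p \<bullet> M (A q) = q \<bullet> A (M p)" using A(2)[of q "M p"] M(2)[of p "A q"] by (simp add: inner_commute)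
      thus ?thesis unfolding V_def langevin_drift_def x
        by (simp add: linear_diff[OF M(1)] linear_neg[OF M(1)] linear_cmul[OF M(1)] inner_diff_right inner_commute[of q p] field_simps)
    qed
    have young: "v * \<bar>p \<bullet> q\<bar> \<le> v\<^sup>2 / (2 * a) * P2 + a / 2 * Q2"
    proof -
      have "2 * ((v * norm p) * (a * norm q)) \<le> (v * norm p)\<^sup>2 + (a * norm q)\<^sup>2"
        using sum_squares_bound[of "v * norm p" "a * norm q"] by simp
      moreover have eq: "a * (v\<^sup>2 / (2 * a) * P2 + a / 2 * Q2) = ((v * norm p)\<^sup>2 + (a * norm q)\<^sup>2) / 2"
        using A(3) by (simp add: P2_def Q2_def power_mult_distrib distrib_left add_divide_distrib) (simp add: power2_eq_square)
      ultimately have "a * (v * (norm p * norm q)) \<le> a * (v\<^sup>2 / (2 * a) * P2 + a / 2 * Q2)"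
        unfolding eq by (simp add: mult_ac)
      hence "v * (norm p * norm q) \<le> v\<^sup>2 / (2 * a) * P2 + a / 2 * Q2" using A(3) by (simp only: mult_le_cancel_left_pos)
      moreover have "v * \<bar>p \<bullet> q\<bar> \<le> v * (norm p * norm q)"
        using v Cauchy_Schwarz_ineq2[of p q] by (intro mult_left_mono) auto
      ultimately show ?thesis by linarith
    qed
    define r where "r = v\<^sup>2 / (2 * a * m)"
    define X where "X = \<epsilon> * (v * \<bar>p \<bullet> q\<bar>)"
    have "v\<^sup>2 / (2 * a) * P2 = r * (m * P2)" using M(3) by (simp add: r_def)
    also have "\<dots> \<le> r * (p \<bullet> M p)" using coer A(3) M(3) unfolding r_def by (intro mult_left_mono) auto
    finally have "v\<^sup>2 / (2 * a) * P2 + a / 2 * Q2 \<le> r * (p \<bullet> M p) + (q \<bullet> A q) / 2"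
      using coer(2) by (intro add_mono) auto
    hence "v * \<bar>p \<bullet> q\<bar> \<le> r * (p \<bullet> M p) + (q \<bullet> A q) / 2" using young by (rule order_trans[rotated])
    hence "X \<le> \<epsilon> * (r * (p \<bullet> M p) + (q \<bullet> A q) / 2)"
      unfolding X_def using \<epsilon> by (intro mult_left_mono) auto
    hence X: "X \<le> \<epsilon> * (r * (p \<bullet> M p)) + \<epsilon> * (q \<bullet> A q) / 2" by (simp add: distrib_left)
    have X': "- (\<epsilon> * (v * (p \<bullet> q))) \<le> X"
      unfolding X_def using mult_nonneg_nonneg[of \<epsilon> v] \<epsilon> v by (auto simp: abs_if mult_le_0_iff)
    have "\<epsilon> * (1 + r) * (p \<bullet> M p) \<le> v / 2 * (p \<bullet> M p)"
      unfolding r_def using \<epsilon> nn by (intro mult_right_mono) auto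
    hence "\<epsilon> * (p \<bullet> M p) + \<epsilon> * (r * (p \<bullet> M p)) \<le> v * (p \<bullet> M p) / 2"
      by (simp add: distrib_left distrib_right mult.assoc)
    hence "2 * V x (langevin_drift A M v x) \<le> - (v * (p \<bullet> M p) / 2) - \<epsilon> * (q \<bullet> A q) / 2"
      using X X' unfolding LV by linarith
    moreover have "min v \<epsilon> * (p \<bullet> M p) \<le> v * (p \<bullet> M p)" "min v \<epsilon> * (q \<bullet> A q) \<le> \<epsilon> * (q \<bullet> A q)"
      using nn by (auto intro!: mult_right_mono)
    ultimately have "4 * V x (langevin_drift A M v x) \<le> - (min v \<epsilon> * E)"
      unfolding E_def distrib_left by linarith
    moreover have "min v \<epsilon> * V x x \<le> min v \<epsilon> * E"
      using VE nn v \<epsilon> by (intro mult_left_mono) (auto simp: E_def)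
    ultimately show "V x (langevin_drift A M v x) \<le> - lam * V x x"
      unfolding lam_def by simp
  qed
  thus ?thesis by blast
qed

section \<open>Linearity of the scheme, coercivity of the force, use of invariance\<close>

lemma linear_scheme_step:
  assumes A: "linear A" and M: "linear M" and G: "linear G" shows "linear (scheme_step A M v G h)"
  unfolding linear_iff scheme_step_def
  by (auto simp: Let_def algebra_simps linear_add[OF A] linear_cmul[OF A] linear_add[OF M] linear_diff[OF M]
      linear_cmul[OF M] linear_add[OF G] linear_diff[OF G] linear_cmul[OF G])

lemma linear_scheme_noise:
  assumes M: "linear M" and G: "linear G" and S: "linear S" shows "linear (\<lambda>w. scheme_noise M v G h (S w))"
  unfolding linear_iff scheme_noise_def
  by (auto simp: Let_def algebra_simps linear_add[OF S] linear_cmul[OF S] linear_add[OF M] linear_diff[OF M]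
      linear_neg[OF M] linear_cmul[OF M] linear_add[OF G] linear_diff[OF G] linear_cmul[OF G])

text \<open>Scaling argument: evaluate the growth condition at \<open>t *\<^sub>R x\<close>, drop
  the nonnegative potential, divide by t^2 and let t tend to infinity. Constant and linear parts
  vanish, and the quadratic term on the right forces positive definiteness.\<close>

lemma assumption_A_coercive:
  fixes A :: "real^'d^'d"
  assumes "assumption_A F f v" and f: "\<forall>x. f x = A *v x + b" and v: "v > 0"
  shows "\<exists>a>0. \<forall>x. a * (norm x)\<^sup>2 \<le> x \<bullet> (A *v x)"
proof -
  obtain \<alpha> \<beta> where F: "\<And>q. F q \<ge> 0" and \<beta>: "0 < \<beta>" "\<beta> < 1" and
    ineq: "\<And>q. (1/2) * (q \<bullet> f q) \<ge> \<beta> * F q + v^2 * (\<beta> * (2 - \<beta>) / (8 * (1 - \<beta>))) * (norm q)^2 - \<alpha>"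
    using assms(1) unfolding assumption_A_def by blast
  define c where "c = v^2 * (\<beta> * (2 - \<beta>) / (8 * (1 - \<beta>)))"
  have c: "c > 0" unfolding c_def using v \<beta> by simp
  have "2 * c * (norm x)\<^sup>2 \<le> x \<bullet> (A *v x)" for x
  proof -
    have *: "c * (norm x)\<^sup>2 \<le> (x \<bullet> (A *v x)) / 2 + (x \<bullet> b) / 2 * (1 / real (Suc n)) + \<alpha> * (1 / real (Suc n))\<^sup>2" for n
    proof -
      define t where "t = real (Suc n)"
      have t: "t > 0" by (simp add: t_def)
      have "c * (norm (t *\<^sub>R x))\<^sup>2 - \<alpha> \<le> (1/2) * ((t *\<^sub>R x) \<bullet> f (t *\<^sub>R x))"
        using ineq[of "t *\<^sub>R x"] mult_nonneg_nonneg[OF less_imp_le[OF \<beta>(1)] F[of "t *\<^sub>R x"]] unfolding c_def by linarith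
      also have "f (t *\<^sub>R x) = t *\<^sub>R (A *v x) + b" using f by (simp add: matrix_vector_mult_scaleR)
      finally have "t\<^sup>2 * (c * (norm x)\<^sup>2) \<le> t\<^sup>2 * (x \<bullet> (A *v x)) / 2 + t * (x \<bullet> b) / 2 + \<alpha>"
        by (simp add: power_mult_distrib inner_add_right power2_eq_square algebra_simps)
      also have "\<dots> = t\<^sup>2 * ((x \<bullet> (A *v x)) / 2 + (x \<bullet> b) / 2 * (1 / t) + \<alpha> * (1 / t)\<^sup>2)"
        using t by (simp add: field_simps power2_eq_square)
      finally show ?thesis using t unfolding t_def[symmetric] by (simp only: mult_le_cancel_left_pos zero_less_power)
    qed
    have "(\<lambda>n. 1 / real (Suc n)) \<longlonglongrightarrow> 0" by (rule LIMSEQ_Suc[OF lim_1_over_n])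
    hence "(\<lambda>n. (x \<bullet> (A *v x)) / 2 + (x \<bullet> b) / 2 * (1 / real (Suc n)) + \<alpha> * (1 / real (Suc n))\<^sup>2)
      \<longlonglongrightarrow> (x \<bullet> (A *v x)) / 2 + (x \<bullet> b) / 2 * 0 + \<alpha> * 0\<^sup>2" by (intro tendsto_intros)
    hence "c * (norm x)\<^sup>2 \<le> (x \<bullet> (A *v x)) / 2 + (x \<bullet> b) / 2 * 0 + \<alpha> * 0\<^sup>2"
      using * by (intro LIMSEQ_le_const) auto
    thus ?thesis by simp
  qed
  thus ?thesis using c by (intro exI[of _ "2 * c"]) auto
qed

lemma symmetric_matrix_inner:
  fixes A :: "real^'d^'d"
  assumes "transpose A = A" shows "(A *v x) \<bullet> y = x \<bullet> (A *v y)"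
  using dot_lmul_matrix[of x A y] assms by (metis transpose_matrix_vector)

text \<open>The set identity says that the image of \<open>\<mu> \<Otimes>\<^sub>M \<Omega>\<close>
  under the solution map is \<open>\<mu>\<close> again; joint measurability makes this image
  meaningful, and Fubini yields the iterated integral.\<close>

lemma invariant_measure_expectation:
  fixes X :: "('e::euclidean_space) \<Rightarrow> 'a \<Rightarrow> 'e"
  assumes \<Omega>: "prob_space \<Omega>" and \<mu>: "prob_space \<mu>" "sets \<mu> = sets borel"
    and Xm: "(\<lambda>(x, \<omega>). X x \<omega>) \<in> borel_measurable (borel \<Otimes>\<^sub>M \<Omega>)"
    and inv: "\<And>B. B \<in> sets borel \<Longrightarrow> (\<integral>\<^sup>+ x. emeasure \<Omega> {\<omega> \<in> space \<Omega>. X x \<omega> \<in> B} \<partial>\<mu>) = emeasure \<mu> B"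
    and \<psi>: "BC \<psi>"
  shows "(\<integral>x. (\<integral>\<omega>. \<psi> (X x \<omega>) \<partial>\<Omega>) \<partial>\<mu>) = (\<integral>z. \<psi> z \<partial>\<mu>)"
proof -
  interpret \<Omega>: prob_space \<Omega> by fact
  interpret \<mu>: prob_space \<mu> by fact
  interpret PP: pair_prob_space \<mu> \<Omega> ..
  let ?X = "\<lambda>p. X (fst p) (snd p)"
  have Xm': "?X \<in> borel_measurable (\<mu> \<Otimes>\<^sub>M \<Omega>)"
    using Xm \<mu>(2) by (simp add: case_prod_beta' cong: measurable_cong_sets sets_pair_measure_cong)
  have law: "distr (\<mu> \<Otimes>\<^sub>M \<Omega>) borel ?X = \<mu>"
  proof (rule measure_eqI)
    fix B assume "B \<in> sets (distr (\<mu> \<Otimes>\<^sub>M \<Omega>) borel ?X)"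
    hence B: "B \<in> sets borel" by simp
    have "emeasure (distr (\<mu> \<Otimes>\<^sub>M \<Omega>) borel ?X) B = emeasure (\<mu> \<Otimes>\<^sub>M \<Omega>) (?X -` B \<inter> space (\<mu> \<Otimes>\<^sub>M \<Omega>))"
      by (rule emeasure_distr[OF Xm' B])
    also have "\<dots> = (\<integral>\<^sup>+x. emeasure \<Omega> (Pair x -` (?X -` B \<inter> space (\<mu> \<Otimes>\<^sub>M \<Omega>))) \<partial>\<mu>)"
      by (rule \<Omega>.emeasure_pair_measure_alt[OF measurable_sets[OF Xm' B]])
    also have "\<dots> = (\<integral>\<^sup>+x. emeasure \<Omega> {\<omega> \<in> space \<Omega>. X x \<omega> \<in> B} \<partial>\<mu>)"
      by (intro nn_integral_cong arg_cong[where f = "emeasure \<Omega>"]) (auto simp: space_pair_measure)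
    also have "\<dots> = emeasure \<mu> B" by (rule inv[OF B])
    finally show "emeasure (distr (\<mu> \<Otimes>\<^sub>M \<Omega>) borel ?X) B = emeasure \<mu> B" .
  qed (simp add: \<mu>(2))
  have "(\<integral>z. \<psi> z \<partial>\<mu>) = (\<integral>z. \<psi> z \<partial>distr (\<mu> \<Otimes>\<^sub>M \<Omega>) borel ?X)" unfolding law ..
  also have "\<dots> = (\<integral>p. \<psi> (?X p) \<partial>(\<mu> \<Otimes>\<^sub>M \<Omega>))" by (rule integral_distr[OF Xm' BC_measurable[OF \<psi>]])
  also have "\<dots> = (\<integral>x. (\<integral>\<omega>. \<psi> (X x \<omega>) \<partial>\<Omega>) \<partial>\<mu>)"
    using PP.integral_fst'[OF PP.integrable_BC[OF \<psi> Xm']] by simp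
  finally show ?thesis by simp
qed

section \<open>Assembly for the affine force\<close>

theorem theorem4p4:
  fixes F :: "real^'d \<Rightarrow> real" and f :: "real^'d \<Rightarrow> real^'d"
    and A :: "real^'d^'d" and b :: "real^'d" and M :: "real^'d^'d" and v :: real
    and \<sigma> :: "real^'m^'d" and \<Omega> :: "'a measure" and W :: "real \<Rightarrow> 'a \<Rightarrow> real^'m"
    and \<mu> :: "((real^'d) \<times> (real^'d)) measure" and \<psi> :: "(real^'d) \<times> (real^'d) \<Rightarrow> real"
    and p q :: "real^'d"
  assumes dm: "CARD('d) \<le> CARD('m)"
    and F_smooth: "smooth_fun F"
    and f_grad: "\<forall>x. (F has_derivative (\<lambda>y. f x \<bullet> y)) (at x)"
    and M_spd: "sym_posdef M"
    and v_pos: "v > 0"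
    and \<sigma>_rank: "rank \<sigma> = CARD('d)"
    and W_wiener: "std_wiener \<Omega> W"
    and A_assm: "assumption_A F f v"
    and A_sym: "transpose A = A"
    and f_affine: "\<forall>x. f x = A *v x + b"
    and \<mu>_inv: "langevin_invariant \<Omega> W f M v \<sigma> \<mu>"
    and \<psi>_Cb6: "Cb 6 \<psi>"
  shows "\<exists>h0>0. \<exists>C>0. \<forall>h. 0 < h \<and> h \<le> h0 \<longrightarrow>
           (\<forall>Ph Qh. langevin_scheme W f (\<lambda>x. jacobian f (at x)) M v \<sigma> h p q Ph Qh \<longrightarrow>
              (\<forall>N::nat. N \<ge> 1 \<longrightarrow>
                 \<bar>(1 / real N) * (\<Sum>n=1..N. (\<integral>\<omega>. \<psi> (Ph n \<omega>, Qh n \<omega>) \<partial>\<Omega>))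
                    - (\<integral>z. \<psi> z \<partial>\<mu>)\<bar> \<le> C * (h^2 + 1 / (real N * h))))"
proof -
  interpret \<Omega>: prob_space \<Omega> using W_wiener by (simp add: std_wiener_def)
  let ?A = "\<lambda>x. A *v x" and ?M = "\<lambda>x. M *v x"
  have linA: "linear ?A" and linM: "linear ?M" and lin\<sigma>: "linear (\<lambda>w. \<sigma> *v w)" by (rule matrix_vector_mul_linear)+
  obtain a where a: "a > 0" "\<And>x. a * (norm x)\<^sup>2 \<le> x \<bullet> (A *v x)"
    using assumption_A_coercive[OF A_assm f_affine v_pos] by blast
  obtain m where m: "m > 0" "\<And>x. m * (norm x)\<^sup>2 \<le> x \<bullet> (M *v x)"
    using posdef_coercive[OF linM] M_spd unfolding sym_posdef_def by blast
  have symM: "transpose M = M" using M_spd by (simp add: sym_posdef_def)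
  define B where "B = langevin_drift ?A ?M v"
  obtain V lam v0 where "lyapunov B V lam v0"
    using langevin_lyapunov[OF linA symmetric_matrix_inner[OF A_sym] a linM symmetric_matrix_inner[OF symM] m v_pos]
    unfolding B_def by blast
  then interpret lyapunov B V lam v0 .
  have "inj ?A" unfolding linear_injective_0[OF linA]
  proof (intro allI impI)
    fix x assume "A *v x = 0"
    hence "a * (norm x)\<^sup>2 \<le> 0" using a(2)[of x] by simp
    thus "x = 0" using a(1) by (simp add: mult_le_0_iff)
  qed
  hence "surj ?A" by (intro linear_injective_imp_surjective[OF linA]) simp_all
  then obtain qs where qs: "A *v qs = - b" by (metis surjD)
  have f_shift: "f (x + qs) = A *v x" for x using f_affine qs by (simp add: matrix_vector_right_distrib)
  \<comment> \<open>The equilibrium of the noiseless equation: zero momentum, and the position where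
    the force vanishes.\<close>
  define z :: "(real^'d) \<times> (real^'d)" where "z = (0, qs)"
  define Sig where "Sig = (\<lambda>w. (- (\<sigma> *v w), 0 :: real^'d))"
  have Sig: "linear Sig" unfolding Sig_def linear_iff by (simp add: matrix_vector_right_distrib matrix_vector_mult_scaleR)
  have C3: "Cb 3 \<psi>"
  proof -
    have "Suc (Suc (Suc 3)) = 6" by simp
    hence "Cb (Suc (Suc (Suc 3))) \<psi>" using \<psi>_Cb6 by (simp only:)
    thus ?thesis by (rule Cb_Suc_imp[OF Cb_Suc_imp[OF Cb_Suc_imp]])
  qed
  obtain Bd L K where cls: "Bd \<ge> 0" "L \<ge> 0" "K \<ge> 0" "tclass Bd L \<psi>" and Lip: "\<And>x y. \<bar>\<psi> (x + y) - \<psi> x\<bar> \<le> K * norm y"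
    by (rule Cb_imp_tclass[OF C3]) blast
  define \<phi> where "\<phi> = (\<lambda>x. \<psi> (x + z))"
  have \<phi>: "tclass Bd L \<phi>" unfolding \<phi>_def by (rule tclass_translate[OF cls(4)])
  have \<phi>_Lip: "\<bar>\<phi> (x + y) - \<phi> x\<bar> \<le> K * norm y" for x y
    using Lip[of "x + z" y] by (simp add: \<phi>_def ac_simps)
  define g where "g = (\<lambda>x \<omega> t. x + Sig (W t \<omega> - W 0 \<omega>))"
  obtain X where Xm: "\<And>t. t \<ge> 0 \<Longrightarrow> (\<lambda>(x, \<omega>). X x t \<omega>) \<in> borel_measurable (borel \<Otimes>\<^sub>M \<Omega>)"
    and Xsol: "AE \<omega> in \<Omega>. \<forall>x. continuous_on {0..} (\<lambda>t. X x t \<omega>) \<and>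
       (\<forall>t\<ge>0. X x t \<omega> = g x \<omega> t + integral {0..t} (\<lambda>s. B (X x s \<omega>)))"
    and Xlim: "\<And>x t. t \<ge> 0 \<Longrightarrow> AE \<omega> in \<Omega>. (\<lambda>n. euler B (g x \<omega>) (t / real (Suc n)) (Suc n)) \<longlonglongrightarrow> X x t \<omega>"
    and em: "\<And>x \<tau> k. \<tau> \<ge> 0 \<Longrightarrow> (\<lambda>\<omega>. euler B (g x \<omega>) \<tau> k) \<in> borel_measurable \<Omega>"
    unfolding g_def using linear_sde_solution_exists[OF W_wiener B Sig] by blast
  define Xo where "Xo = (\<lambda>x t \<omega>. X (x - z) t \<omega> + z)"
  have Xo_m: "(\<lambda>(x, \<omega>). Xo x t \<omega>) \<in> borel_measurable (borel \<Otimes>\<^sub>M \<Omega>)" if "t \<ge> 0" for t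
  proof -
    have "(\<lambda>p. (fst p - z, snd p)) \<in> borel \<Otimes>\<^sub>M \<Omega> \<rightarrow>\<^sub>M borel \<Otimes>\<^sub>M \<Omega>" by measurable
    from measurable_compose[OF this Xm[OF that]] show ?thesis unfolding Xo_def case_prod_beta' by simp
  qed
  \<comment> \<open>Invariance is a statement about every family of solutions of the original
    equation. Exhibiting the shifted-back family as one of them gives the hypothesis content and
    transfers invariance to \<open>X\<close>.\<close>
  have sol: "langevin_solution \<Omega> W f M v \<sigma> x (Xo x)" for x
    unfolding langevin_solution_def
  proof (intro conjI allI impI)
    fix t :: real assume "t \<ge> 0"
    from measurable_compose[OF measurable_Pair1' Xo_m[OF this], of x]
    show "Xo x t \<in> borel_measurable \<Omega>" by simp
  next
    show "AE \<omega> in \<Omega>. continuous_on {0..} (\<lambda>t. Xo x t \<omega>) \<and>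
        (\<forall>t\<ge>0.
          fst (Xo x t \<omega>) = fst x - integral {0..t} (\<lambda>s. f (snd (Xo x s \<omega>)) + v *\<^sub>R fst (Xo x s \<omega>))
                           - \<sigma> *v (W t \<omega> - W 0 \<omega>) \<and>
          snd (Xo x t \<omega>) = snd x + integral {0..t} (\<lambda>s. M *v fst (Xo x s \<omega>)))"
      using Xsol
    proof eventually_elim
      case (elim \<omega>)
      define y where "y = (\<lambda>t. X (x - z) t \<omega>)"
      have cy: "continuous_on {0..} y" and y: "\<And>t. t \<ge> 0 \<Longrightarrow> y t = g (x - z) \<omega> t + integral {0..t} (\<lambda>s. B (y s))"
        unfolding y_def by (simp_all only: elim[rule_format])
      have Xoy: "Xo x t \<omega> = y t + z" for t by (simp add: Xo_def y_def)
      have "continuous_on {0..} (\<lambda>t. Xo x t \<omega>)" unfolding Xoy by (intro continuous_intros cy)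
      moreover have "fst (Xo x t \<omega>) = fst x - integral {0..t} (\<lambda>s. f (snd (Xo x s \<omega>)) + v *\<^sub>R fst (Xo x s \<omega>)) - \<sigma> *v (W t \<omega> - W 0 \<omega>)
          \<and> snd (Xo x t \<omega>) = snd x + integral {0..t} (\<lambda>s. M *v fst (Xo x s \<omega>))" if t: "t \<ge> 0" for t
      proof -
        have "continuous_on {0..t} (\<lambda>s. B (y s))"
          using B by (intro bounded_linear.continuous_on[of B] continuous_on_subset[OF cy]) (auto simp: linear_conv_bounded_linear)
        hence int: "(\<lambda>s. B (y s)) integrable_on {0..t}" by (rule integrable_continuous_real)
        have fB: "- (f (snd (Xo x s \<omega>)) + v *\<^sub>R fst (Xo x s \<omega>)) = fst (B (y s))" for s
          by (simp add: B_def langevin_drift_def case_prod_beta' Xoy z_def f_shift)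
        have 1: "fst (integral {0..t} (\<lambda>s. B (y s))) = - integral {0..t} (\<lambda>s. f (snd (Xo x s \<omega>)) + v *\<^sub>R fst (Xo x s \<omega>))"
          using integral_linear[OF int bounded_linear_fst] unfolding integral_neg[symmetric] fB by (simp add: comp_def)
        have 2: "snd (integral {0..t} (\<lambda>s. B (y s))) = integral {0..t} (\<lambda>s. M *v fst (Xo x s \<omega>))"
          using integral_linear[OF int bounded_linear_snd]
          by (simp add: comp_def B_def langevin_drift_def case_prod_beta' Xoy z_def)
        show ?thesis unfolding Xoy[of t] using y[OF t] 1 2
          by (simp add: g_def Sig_def z_def)
      qed
      ultimately show ?case by blast
    qed
  qed
  have \<mu>: "prob_space \<mu>" "sets \<mu> = sets borel" using \<mu>_inv by (auto simp: langevin_invariant_def)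
  have inv: "(\<integral>\<^sup>+ x. emeasure \<Omega> {\<omega> \<in> space \<Omega>. Xo x t \<omega> \<in> E} \<partial>\<mu>) = emeasure \<mu> E"
    if "t \<ge> 0" "E \<in> sets borel" for t E
    using \<mu>_inv sol that unfolding langevin_invariant_def by blast
  have I: "(\<integral>x. (\<integral>\<omega>. \<phi> (X (x - z) t \<omega>) \<partial>\<Omega>) \<partial>\<mu>) = (\<integral>z. \<psi> z \<partial>\<mu>)" if "t \<ge> 0" for t
    using invariant_measure_expectation[OF \<Omega>.prob_space_axioms \<mu> Xo_m[OF that] inv[OF that] tclass_BC[OF cls(4)]]
    by (simp add: Xo_def \<phi>_def)
  have shift_m: "(\<lambda>x. x - z) \<in> borel_measurable \<mu>"
    using \<mu>(2) by (simp cong: measurable_cong_sets)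
  obtain \<kappa>1 h1 where \<kappa>1: "\<kappa>1 \<ge> 0" and h1: "h1 > 0" and ex: "\<And>h. 0 < h \<Longrightarrow> h \<le> h1 \<Longrightarrow> (\<exists>G. linear G \<and>
    (\<forall>P w. P + (h\<^sup>2 / 2) *\<^sub>R (A *v (M *v P)) = w \<longleftrightarrow> P = G w) \<and>
    (\<forall>x. norm (scheme_step ?A ?M v G h x - (x + h *\<^sub>R B x + (h\<^sup>2 / 2) *\<^sub>R B (B x))) \<le> \<kappa>1 * h ^ 3 * norm x) \<and>
    (\<forall>s. norm (scheme_noise ?M v G h s - ((- s, 0) + (h / 2) *\<^sub>R B (- s, 0))) \<le> \<kappa>1 * h\<^sup>2 * norm s))"
    using scheme_expansion[OF linA linM v_pos] unfolding B_def by blast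
  obtain k\<sigma> where k\<sigma>: "k\<sigma> > 0" "\<And>w. norm (\<sigma> *v w) \<le> k\<sigma> * norm w" using linear_bounded_pos[OF lin\<sigma>] by blast
  \<comment> \<open>One constant for both defects: the noise bound is evaluated at the images under
    \<open>\<sigma>\<close> of unit vectors, whose norms are at most
    \<open>k\<sigma>\<close>.\<close>
  define \<kappa> where "\<kappa> = \<kappa>1 * (1 + k\<sigma>)"
  have \<kappa>: "\<kappa> \<ge> 0" "\<kappa>1 \<le> \<kappa>" "\<kappa>1 * k\<sigma> \<le> \<kappa>" unfolding \<kappa>_def using \<kappa>1 k\<sigma> by (auto simp: algebra_simps)
  obtain h2 C where h2: "h2 > 0" and C: "C > 0" and rate: "\<forall>h R S Y. 0 < h \<longrightarrow> h \<le> h2 \<longrightarrow> linear R \<longrightarrow> linear S \<longrightarrow>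
    (\<forall>x. norm (R x - (x + h *\<^sub>R B x + (h\<^sup>2 / 2) *\<^sub>R B (B x))) \<le> \<kappa> * h ^ 3 * norm x) \<longrightarrow>
    (\<forall>b\<in>Basis. norm (S b - (Sig b + (h / 2) *\<^sub>R B (Sig b))) \<le> \<kappa> * h\<^sup>2) \<longrightarrow>
    (\<forall>\<omega>. Y 0 \<omega> = (p, q - qs)) \<longrightarrow>
    (\<forall>n \<omega>. Y (Suc n) \<omega> = R (Y n \<omega>) + S (W (real (Suc n) * h) \<omega> - W (real n * h) \<omega>)) \<longrightarrow>
    (\<forall>N. N \<ge> 1 \<longrightarrow> \<bar>(1 / real N) * (\<Sum>n=1..N. (\<integral>\<omega>. \<phi> (Y n \<omega>) \<partial>\<Omega>)) - (\<integral>z. \<psi> z \<partial>\<mu>)\<bar> \<le> C * (h\<^sup>2 + 1 / (real N * h)))"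
    using linear_scheme_ergodic_rate[OF W_wiener Sig \<phi> cls(2,1,3) \<phi>_Lip \<kappa>(1) Xm
        Xlim[unfolded g_def] em[unfolded g_def] \<mu>(1) shift_m I, of "(p, q - qs)"] by blast
  have jac: "jacobian f (at x) = A" for x
  proof -
    have "f = (\<lambda>x. A *v x + b)" using f_affine by auto
    hence "(f has_derivative ?A) (at x)"
      using linA by (auto intro!: derivative_eq_intros bounded_linear_imp_has_derivative simp: linear_conv_bounded_linear)
    hence "frechet_derivative f (at x) = ?A" by (rule frechet_derivative_at[symmetric])
    thus ?thesis by (simp add: jacobian_def)
  qed
  show ?thesis
  proof (rule exI[of _ "min h1 h2"], rule conjI, goal_cases)
    case 1
    show ?case using h1 h2 by simp
  next
    case 2
    show ?case
    proof (rule exI[of _ C], intro conjI allI impI C)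
      fix h Ph Qh and N :: nat
      assume h: "0 < h \<and> h \<le> min h1 h2"
        and sch: "langevin_scheme W f (\<lambda>x. jacobian f (at x)) M v \<sigma> h p q Ph Qh" and N: "1 \<le> N"
      have h': "0 < h" "h \<le> h1" "h \<le> h2" using h by auto
      obtain G where G: "linear G" and Geq: "\<And>P w. P + (h\<^sup>2 / 2) *\<^sub>R (A *v (M *v P)) = w \<longleftrightarrow> P = G w"
        and step: "\<And>x. norm (scheme_step ?A ?M v G h x - (x + h *\<^sub>R B x + (h\<^sup>2 / 2) *\<^sub>R B (B x))) \<le> \<kappa>1 * h ^ 3 * norm x"
        and noise: "\<And>s. norm (scheme_noise ?M v G h s - ((- s, 0) + (h / 2) *\<^sub>R B (- s, 0))) \<le> \<kappa>1 * h\<^sup>2 * norm s"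
        using ex[OF h'(1,2)] by blast
      let ?R = "scheme_step ?A ?M v G h" and ?S = "\<lambda>w. scheme_noise ?M v G h (\<sigma> *v w)"
      define Y where "Y = (\<lambda>n \<omega>. (Ph n \<omega>, Qh n \<omega> - qs))"
      have R2: "\<forall>x. norm (?R x - (x + h *\<^sub>R B x + (h\<^sup>2 / 2) *\<^sub>R B (B x))) \<le> \<kappa> * h ^ 3 * norm x"
      proof
        fix x :: "(real^'d) \<times> (real^'d)"
        have "\<kappa>1 * (h ^ 3 * norm x) \<le> \<kappa> * (h ^ 3 * norm x)" using \<kappa> h' by (intro mult_right_mono) auto
        thus "norm (?R x - (x + h *\<^sub>R B x + (h\<^sup>2 / 2) *\<^sub>R B (B x))) \<le> \<kappa> * h ^ 3 * norm x"
          using step[of x] by (simp add: mult.assoc)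
      qed
      have S2: "\<forall>b\<in>Basis. norm (?S b - (Sig b + (h / 2) *\<^sub>R B (Sig b))) \<le> \<kappa> * h\<^sup>2"
      proof
        fix b :: "real^'m" assume "b \<in> Basis"
        hence "norm (\<sigma> *v b) \<le> k\<sigma>" using k\<sigma>(2)[of b] by simp
        hence "\<kappa>1 * h\<^sup>2 * norm (\<sigma> *v b) \<le> \<kappa>1 * h\<^sup>2 * k\<sigma>" using \<kappa>1 by (intro mult_left_mono) auto
        also have "\<dots> \<le> \<kappa> * h\<^sup>2" using mult_right_mono[OF \<kappa>(3), of "h\<^sup>2"] by (simp add: mult_ac)
        finally show "norm (?S b - (Sig b + (h / 2) *\<^sub>R B (Sig b))) \<le> \<kappa> * h\<^sup>2"
          using noise[of "\<sigma> *v b"] unfolding Sig_def by linarith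
      qed
      have Y0: "\<forall>\<omega>. Y 0 \<omega> = (p, q - qs)" using sch by (simp add: Y_def langevin_scheme_def)
      have YS: "\<forall>n \<omega>. Y (Suc n) \<omega> = ?R (Y n \<omega>) + ?S (W (real (Suc n) * h) \<omega> - W (real n * h) \<omega>)"
      proof (intro allI)
        fix n \<omega>
        define dW where "dW = W (real (Suc n) * h) \<omega> - W (real n * h) \<omega>"
        define Q where "Q = Qh n \<omega> - qs"
        define P' where "P' = Ph (Suc n) \<omega>"
        have fQ: "f (Qh n \<omega>) = A *v Q" using f_shift[of Q] by (simp add: Q_def)
        have eqs: "P' = exp (- v * h) *\<^sub>R Ph n \<omega> - (h\<^sup>2 / 2) *\<^sub>R (A *v (M *v P'))
            - (h * (1 + v * h / 2) * exp (- v * h)) *\<^sub>R (A *v Q)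
            - ((1 + v * h / 2) * exp (- v * h)) *\<^sub>R (\<sigma> *v dW)"
          "Qh (Suc n) \<omega> = Qh n \<omega> + (h * (1 - v * h / 2) * exp (v * h)) *\<^sub>R (M *v P')
            + (h\<^sup>2 / 2) *\<^sub>R (M *v (A *v Q)) + (h / 2) *\<^sub>R (M *v (\<sigma> *v dW))"
          using sch unfolding langevin_scheme_def Let_def jac fQ[symmetric] dW_def P'_def by blast+
        define w1 where "w1 = exp (- v * h) *\<^sub>R Ph n \<omega> - (h * (1 + v * h / 2) * exp (- v * h)) *\<^sub>R (A *v Q)"
        define w2 where "w2 = - (((1 + v * h / 2) * exp (- v * h)) *\<^sub>R (\<sigma> *v dW))"
        \<comment> \<open>The scheme gives the new momentum only implicitly; with the implicit term
          on the left, \<open>Geq\<close> determines it, and linearity of \<open>G\<close> separates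
          drift from noise.\<close>
        have impl: "P' + (h\<^sup>2 / 2) *\<^sub>R (A *v (M *v P')) = w1 + w2"
          by (subst eqs(1)) (simp add: w1_def w2_def)
        define n2 where "n2 = - (((1 + v * h / 2) * exp (- v * h)) *\<^sub>R G (\<sigma> *v dW))"
        define th where "th = h * (1 - v * h / 2) * exp (v * h)"
        have "P' = G (w1 + w2)" using impl unfolding Geq .
        hence P': "P' = G w1 + n2"
          unfolding w2_def n2_def by (simp only: linear_add[OF G] linear_neg[OF G] linear_cmul[OF G])
        have "?R (Y n \<omega>) = (G w1, Q + th *\<^sub>R (M *v G w1) + (h\<^sup>2 / 2) *\<^sub>R (M *v (A *v Q)))"
          unfolding Y_def scheme_step_def w1_def Q_def th_def by (simp only: Let_def prod.case)
        moreover have "?S dW = (n2, th *\<^sub>R (M *v n2) + (h / 2) *\<^sub>R (M *v (\<sigma> *v dW)))"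
          unfolding scheme_noise_def n2_def th_def by (simp only: Let_def)
        moreover have "Y (Suc n) \<omega> = (P', Q + th *\<^sub>R (M *v P') + (h\<^sup>2 / 2) *\<^sub>R (M *v (A *v Q)) + (h / 2) *\<^sub>R (M *v (\<sigma> *v dW)))"
          unfolding Y_def eqs(2) P'_def[symmetric] Q_def th_def by simp
        ultimately show "Y (Suc n) \<omega> = ?R (Y n \<omega>) + ?S (W (real (Suc n) * h) \<omega> - W (real n * h) \<omega>)"
          unfolding dW_def[symmetric] P' by (simp add: matrix_vector_right_distrib scaleR_add_right)
      qed
      have "(\<integral>\<omega>. \<phi> (Y n \<omega>) \<partial>\<Omega>) = (\<integral>\<omega>. \<psi> (Ph n \<omega>, Qh n \<omega>) \<partial>\<Omega>)" for n
        by (simp add: \<phi>_def Y_def z_def)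
      thus "\<bar>(1 / real N) * (\<Sum>n=1..N. (\<integral>\<omega>. \<psi> (Ph n \<omega>, Qh n \<omega>) \<partial>\<Omega>)) - (\<integral>z. \<psi> z \<partial>\<mu>)\<bar> \<le> C * (h^2 + 1 / (real N * h))"
        using rate[rule_format, of h ?R ?S Y N] h' R2 S2 Y0 YS N
          linear_scheme_step[OF linA linM G] linear_scheme_noise[OF linM G lin\<sigma>] by simp
    qed
  qed
qed

end
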